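(* Let $R$ be a Dedekind ring. Assume that $A$ is an $R$-finite saturated normal Hopf subalgebra of an $R$-flat Hopf algebra $B$. Let $C:=B\otimes_A R$ be the quotient Hopf algebra. Then $B$ possesses a non-zero left (resp. right) integral if and only if $C$ possesses a non-zero left (resp. right) integral.
   Context: $R$-finite means finitely generated as an $R$-module. A Hopf subalgebra $A\subset B$ of an $R$-flat Hopf algebra is saturated if $B/A$ is $R$-torsion-free (equivalently $R$-flat), and normal if for all $a\in A$, $b\in B$ one has $\sum b_1 a S(b_2)\in A$ and $\sum S(b_1)ab_2\in A$. $R$ is a left $A$-module via the counit $\varepsilon_A$, so $C=B/BA^+$ with $A^+=\ker\varepsilon_A$; since $A$ is normal, $BA^+=A^+B$ is a Hopf ideal and $C$ is a Hopf algebra. A left integral on an $R$-flat Hopf algebra $H$ is an $R$-linear map $\varphi:H\to R$ with $\sum h_1\varphi(h_2)=\varphi(h)1$ for all $h\in H$; a right integral is an $R$-linear map $\varphi:H\to R$ with $\sum\varphi(h_1)h_2=\varphi(h)1$ for all $h\in H$. *)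

theory Defs
  imports "HOL-Algebra.Module" "HOL-Algebra.Subrings" "HOL-Algebra.QuotRing" "HOL-Algebra.Ideal_Product" "HOL-Algebra.Ring_Divisibility"
begin

section \<open>Dedekind rings\<close>

text \<open>Integral closedness says that a fraction \<open>a / b\<close> which is a root of a monic polynomial
  over \<open>R\<close> lies in \<open>R\<close>; the equation is written with the denominators cleared, i.e.
  multiplied by \<open>b ^ n\<close>. Fields count as Dedekind rings.\<close>

locale dedekind_ring = noetherian_domain R for R (structure) +
  assumes integrally_closed:
      "\<lbrakk> a \<in> carrier R; b \<in> carrier R; b \<noteq> \<zero>; c \<in> {..<n::nat} \<rightarrow> carrier R;
         a [^] n \<oplus> (\<Oplus>i\<in>{..<n}. c i \<otimes> a [^] i \<otimes> b [^] (n - i)) = \<zero> \<rbrakk>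
       \<Longrightarrow> \<exists>q\<in>carrier R. a = b \<otimes> q"
    and prime_imp_maximal:
      "\<lbrakk> primeideal P R; P \<noteq> {\<zero>} \<rbrakk> \<Longrightarrow> maximalideal P R"


section \<open>Modules\<close>

definition self_module :: "('r, 'x) ring_scheme \<Rightarrow> ('r, 'r) module" where
  "self_module R = \<lparr>carrier = carrier R, monoid.mult = monoid.mult R, one = one R,
                    zero = zero R, add = add R, smult = monoid.mult R\<rparr>"

definition module_hom ::
    "('r, 'x) ring_scheme \<Rightarrow> ('r, 'm, 'y) module_scheme \<Rightarrow> ('r, 'n, 'z) module_scheme \<Rightarrow> ('m \<Rightarrow> 'n) set" where
  "module_hom R M N = {f \<in> carrier M \<rightarrow> carrier N.
      (\<forall>x\<in>carrier M. \<forall>y\<in>carrier M. f (x \<oplus>\<^bsub>M\<^esub> y) = f x \<oplus>\<^bsub>N\<^esub> f y) \<and>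
      (\<forall>r\<in>carrier R. \<forall>x\<in>carrier M. f (r \<odot>\<^bsub>M\<^esub> x) = r \<odot>\<^bsub>N\<^esub> f x)}"

definition module_span ::
    "('r, 'x) ring_scheme \<Rightarrow> ('r, 'm, 'y) module_scheme \<Rightarrow> 'm set \<Rightarrow> 'm set" where
  "module_span R M X = \<Inter>{N. submodule N R M \<and> X \<subseteq> N}"

definition finitely_generated_module ::
    "('r, 'x) ring_scheme \<Rightarrow> ('r, 'm, 'y) module_scheme \<Rightarrow> bool" where
  "finitely_generated_module R M \<longleftrightarrow>
     (\<exists>X\<subseteq>carrier M. finite X \<and> module_span R M X = carrier M)"

definition torsion_free ::
    "('r, 'x) ring_scheme \<Rightarrow> ('r, 'm, 'y) module_scheme \<Rightarrow> bool" where
  "torsion_free R M \<longleftrightarrow>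
     (\<forall>r\<in>carrier R. \<forall>x\<in>carrier M. r \<odot>\<^bsub>M\<^esub> x = \<zero>\<^bsub>M\<^esub> \<longrightarrow> r = \<zero>\<^bsub>R\<^esub> \<or> x = \<zero>\<^bsub>M\<^esub>)"

text \<open>The quotient by a submodule, or the quotient algebra if \<open>N\<close> is an ideal of the algebra
  \<open>M\<close> closed under scalars. Here and below, \<open>the_elem (g ` X)\<close> is the map on cosets induced by
  a map \<open>g\<close> that is constant on each coset \<open>X\<close>.\<close>

definition quot_module :: "('r, 'm, 'y) module_scheme \<Rightarrow> 'm set \<Rightarrow> ('r, 'm set) module" where
  "quot_module M N = ring.extend (M Quot N)
     (module.fields (\<lambda>r X. the_elem ((\<lambda>x. N +>\<^bsub>M\<^esub> (r \<odot>\<^bsub>M\<^esub> x)) ` X)))"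


section \<open>Tensor products\<close>

text \<open>Only the module structure of the free module matters.\<close>

definition free_module :: "('r, 'x) ring_scheme \<Rightarrow> 'a set \<Rightarrow> ('r, 'a \<Rightarrow> 'r) module" where
  "free_module R S =
     \<lparr>carrier = {f. range f \<subseteq> carrier R \<and> finite {p. f p \<noteq> \<zero>\<^bsub>R\<^esub>} \<and> {p. f p \<noteq> \<zero>\<^bsub>R\<^esub>} \<subseteq> S},
      monoid.mult = undefined, one = undefined,
      zero = (\<lambda>_. \<zero>\<^bsub>R\<^esub>), add = (\<lambda>f g p. f p \<oplus>\<^bsub>R\<^esub> g p), smult = (\<lambda>r f p. r \<otimes>\<^bsub>R\<^esub> f p)\<rparr>"

definition free_gen :: "('r, 'x) ring_scheme \<Rightarrow> 'a \<Rightarrow> 'a \<Rightarrow> 'r" where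
  "free_gen R p = (\<lambda>q. if q = p then \<one>\<^bsub>R\<^esub> else \<zero>\<^bsub>R\<^esub>)"

abbreviation tensor_free ::
    "('r, 'x) ring_scheme \<Rightarrow> ('r, 'm, 'y) module_scheme \<Rightarrow> ('r, 'n, 'z) module_scheme \<Rightarrow> ('r, 'm \<times> 'n \<Rightarrow> 'r) module" where
  "tensor_free R M N \<equiv> free_module R (carrier M \<times> carrier N)"

definition tensor_rels ::
    "('r, 'x) ring_scheme \<Rightarrow> ('r, 'm, 'y) module_scheme \<Rightarrow> ('r, 'n, 'z) module_scheme \<Rightarrow> ('m \<times> 'n \<Rightarrow> 'r) set" where
  "tensor_rels R M N = (let F = tensor_free R M N; e = (\<lambda>m n. free_gen R (m, n)) in module_span R F
     ({e (m \<oplus>\<^bsub>M\<^esub> m') n \<ominus>\<^bsub>F\<^esub> (e m n \<oplus>\<^bsub>F\<^esub> e m' n) | m m' n.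
         m \<in> carrier M \<and> m' \<in> carrier M \<and> n \<in> carrier N} \<union>
      {e m (n \<oplus>\<^bsub>N\<^esub> n') \<ominus>\<^bsub>F\<^esub> (e m n \<oplus>\<^bsub>F\<^esub> e m n') | m n n'.
         m \<in> carrier M \<and> n \<in> carrier N \<and> n' \<in> carrier N} \<union>
      {e (r \<odot>\<^bsub>M\<^esub> m) n \<ominus>\<^bsub>F\<^esub> r \<odot>\<^bsub>F\<^esub> e m n | r m n.
         r \<in> carrier R \<and> m \<in> carrier M \<and> n \<in> carrier N} \<union>
      {e m (r \<odot>\<^bsub>N\<^esub> n) \<ominus>\<^bsub>F\<^esub> r \<odot>\<^bsub>F\<^esub> e m n | r m n.
         r \<in> carrier R \<and> m \<in> carrier M \<and> n \<in> carrier N}))"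

definition tensor_space ::
    "('r, 'x) ring_scheme \<Rightarrow> ('r, 'm, 'y) module_scheme \<Rightarrow> ('r, 'n, 'z) module_scheme \<Rightarrow> ('r, ('m \<times> 'n \<Rightarrow> 'r) set) module" where
  "tensor_space R M N = quot_module (tensor_free R M N) (tensor_rels R M N)"

definition pure_tensor ::
    "('r, 'x) ring_scheme \<Rightarrow> ('r, 'm, 'y) module_scheme \<Rightarrow> ('r, 'n, 'z) module_scheme \<Rightarrow> 'm \<Rightarrow> 'n \<Rightarrow> ('m \<times> 'n \<Rightarrow> 'r) set" where
  "pure_tensor R M N m n = tensor_rels R M N +>\<^bsub>tensor_free R M N\<^esub> free_gen R (m, n)"

text \<open>The linear map to \<open>P\<close> induced by a bilinear map \<open>\<beta>\<close>; in Sweedler notation, it sends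
  \<open>t = \<Sum> t\<^sub>1 \<otimes> t\<^sub>2\<close> to \<open>\<Sum> \<beta> t\<^sub>1 t\<^sub>2\<close>.\<close>

definition tensor_lift ::
    "('r, 'x) ring_scheme \<Rightarrow> ('r, 'p, 'y) module_scheme \<Rightarrow> ('m \<Rightarrow> 'n \<Rightarrow> 'p) \<Rightarrow> ('m \<times> 'n \<Rightarrow> 'r) set \<Rightarrow> 'p" where
  "tensor_lift R P \<beta> t =
     the_elem ((\<lambda>f. \<Oplus>\<^bsub>P\<^esub>p\<in>{p. f p \<noteq> \<zero>\<^bsub>R\<^esub>}. f p \<odot>\<^bsub>P\<^esub> \<beta> (fst p) (snd p)) ` t)"

text \<open>The module \<open>M \<otimes>\<^sub>R N\<close>, with the multiplication \<open>(a \<otimes> b) (c \<otimes> d) = a c \<otimes> b d\<close> and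
  the unit \<open>1 \<otimes> 1\<close> that make it an algebra when \<open>M\<close> and \<open>N\<close> are algebras
  (these two fields are irrelevant otherwise).\<close>

definition tensor ::
    "('r, 'x) ring_scheme \<Rightarrow> ('r, 'm, 'y) module_scheme \<Rightarrow> ('r, 'n, 'z) module_scheme \<Rightarrow> ('r, ('m \<times> 'n \<Rightarrow> 'r) set) module" where
  "tensor R M N = (tensor_space R M N)
     \<lparr>monoid.mult := (\<lambda>t u. tensor_lift R (tensor_space R M N) (\<lambda>a b.
                       tensor_lift R (tensor_space R M N) (\<lambda>c d.
                         pure_tensor R M N (a \<otimes>\<^bsub>M\<^esub> c) (b \<otimes>\<^bsub>N\<^esub> d)) u) t),
      one := pure_tensor R M N \<one>\<^bsub>M\<^esub> \<one>\<^bsub>N\<^esub>\<rparr>"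

text \<open>\<open>f \<otimes> g\<close>, with codomain \<open>M' \<otimes> N'\<close>.\<close>

definition tensor_map ::
    "('r, 'x) ring_scheme \<Rightarrow> ('r, 'm2, 'y) module_scheme \<Rightarrow> ('r, 'n2, 'z) module_scheme \<Rightarrow>
     ('m \<Rightarrow> 'm2) \<Rightarrow> ('n \<Rightarrow> 'n2) \<Rightarrow> ('m \<times> 'n \<Rightarrow> 'r) set \<Rightarrow> ('m2 \<times> 'n2 \<Rightarrow> 'r) set" where
  "tensor_map R M' N' f g =
     tensor_lift R (tensor R M' N') (\<lambda>m n. pure_tensor R M' N' (f m) (g n))"

text \<open>\<open>(M \<otimes> N) \<otimes> P \<rightarrow> M \<otimes> (N \<otimes> P)\<close>\<close>

definition tensor_assoc ::
    "('r, 'x) ring_scheme \<Rightarrow> ('r, 'm, 'y) module_scheme \<Rightarrow> ('r, 'n, 'z) module_scheme \<Rightarrow> ('r, 'p, 'w) module_scheme \<Rightarrow>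
     (('m \<times> 'n \<Rightarrow> 'r) set \<times> 'p \<Rightarrow> 'r) set \<Rightarrow> ('m \<times> ('n \<times> 'p \<Rightarrow> 'r) set \<Rightarrow> 'r) set" where
  "tensor_assoc R M N P = tensor_lift R (tensor R M (tensor R N P)) (\<lambda>t p.
     tensor_lift R (tensor R M (tensor R N P)) (\<lambda>m n.
       pure_tensor R M (tensor R N P) m (pure_tensor R N P n p)) t)"

text \<open>\<open>M\<close> is flat if tensoring with \<open>M\<close> preserves injectivity of linear maps. HOL cannot quantify
  over all carrier types here; the type \<open>(nat \<Rightarrow> 'r) set\<close> contains a copy of every quotient of
  \<open>R\<^sup>n\<close>, hence of every finitely generated module, and these suffice to test flatness.\<close>

definition flat_module ::
    "('r, 'x) ring_scheme \<Rightarrow> ('r, 'm, 'y) module_scheme \<Rightarrow> bool" where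
  "flat_module R M \<longleftrightarrow> module R M \<and>
     (\<forall>(N :: ('r, (nat \<Rightarrow> 'r) set) module) (N' :: ('r, (nat \<Rightarrow> 'r) set) module) f.
        module R N \<and> module R N' \<and> f \<in> module_hom R N N' \<and> inj_on f (carrier N)
        \<longrightarrow> inj_on (tensor_map R N' M f (\<lambda>x. x)) (carrier (tensor R N M)))"


section \<open>Hopf algebras\<close>

record ('r, 'b) hopf = "('r, 'b) module" +
  comult :: "'b \<Rightarrow> ('b \<times> 'b \<Rightarrow> 'r) set"
  counit :: "'b \<Rightarrow> 'r"
  antipode :: "'b \<Rightarrow> 'b"

text \<open>Neither commutativity nor cocommutativity is assumed, nor is the antipode assumed bijective.\<close>

locale hopf_algebra = module R B + B?: ring B
  for R (structure) and B :: "('r, 'b, 'y) hopf_scheme" (structure) +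
  assumes smult_mult_left:
      "\<lbrakk> r \<in> carrier R; x \<in> carrier B; y \<in> carrier B \<rbrakk> \<Longrightarrow>
         (r \<odot>\<^bsub>B\<^esub> x) \<otimes>\<^bsub>B\<^esub> y = r \<odot>\<^bsub>B\<^esub> (x \<otimes>\<^bsub>B\<^esub> y)"
    and smult_mult_right:
      "\<lbrakk> r \<in> carrier R; x \<in> carrier B; y \<in> carrier B \<rbrakk> \<Longrightarrow>
         x \<otimes>\<^bsub>B\<^esub> (r \<odot>\<^bsub>B\<^esub> y) = r \<odot>\<^bsub>B\<^esub> (x \<otimes>\<^bsub>B\<^esub> y)"
    and comult_linear: "comult B \<in> module_hom R B (tensor R B B)"
    and comult_mult: "comult B \<in> ring_hom B (tensor R B B)"
    and counit_linear: "counit B \<in> module_hom R B (self_module R)"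
    and counit_mult: "counit B \<in> ring_hom B R"
    and coassoc:
      "x \<in> carrier B \<Longrightarrow>
         tensor_assoc R B B B (tensor_map R (tensor R B B) B (comult B) (\<lambda>y. y) (comult B x))
         = tensor_map R B (tensor R B B) (\<lambda>y. y) (comult B) (comult B x)"
    and counit_left:
      "x \<in> carrier B \<Longrightarrow> tensor_lift R B (\<lambda>y z. counit B y \<odot>\<^bsub>B\<^esub> z) (comult B x) = x"
    and counit_right:
      "x \<in> carrier B \<Longrightarrow> tensor_lift R B (\<lambda>y z. counit B z \<odot>\<^bsub>B\<^esub> y) (comult B x) = x"
    and antipode_linear: "antipode B \<in> module_hom R B B"
    and antipode_left:
      "x \<in> carrier B \<Longrightarrow>
         tensor_lift R B (\<lambda>y z. antipode B y \<otimes>\<^bsub>B\<^esub> z) (comult B x) = counit B x \<odot>\<^bsub>B\<^esub> \<one>\<^bsub>B\<^esub>"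
    and antipode_right:
      "x \<in> carrier B \<Longrightarrow>
         tensor_lift R B (\<lambda>y z. y \<otimes>\<^bsub>B\<^esub> antipode B z) (comult B x) = counit B x \<odot>\<^bsub>B\<^esub> \<one>\<^bsub>B\<^esub>"

text \<open>\<open>\<Delta>(A) \<subseteq> A \<otimes> A\<close> refers to the image of \<open>A \<otimes> A\<close> in \<open>B \<otimes> B\<close>; over a Dedekind ring
  \<open>A \<otimes> A \<rightarrow> B \<otimes> B\<close> is injective when \<open>B\<close> is flat.\<close>

definition hopf_subalgebra ::
    "'b set \<Rightarrow> ('r, 'x) ring_scheme \<Rightarrow> ('r, 'b, 'y) hopf_scheme \<Rightarrow> bool" where
  "hopf_subalgebra A R B \<longleftrightarrow> submodule A R B \<and> subring A B \<and>
     (\<forall>a\<in>A. comult B a \<in>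
        module_span R (tensor R B B) {pure_tensor R B B a' a'' | a' a''. a' \<in> A \<and> a'' \<in> A}) \<and>
     (\<forall>a\<in>A. antipode B a \<in> A)"

definition saturated ::
    "'b set \<Rightarrow> ('r, 'x) ring_scheme \<Rightarrow> ('r, 'b, 'y) hopf_scheme \<Rightarrow> bool" where
  "saturated A R B \<longleftrightarrow> torsion_free R (quot_module B A)"

definition normal_hopf_subalgebra ::
    "'b set \<Rightarrow> ('r, 'x) ring_scheme \<Rightarrow> ('r, 'b, 'y) hopf_scheme \<Rightarrow> bool" where
  "normal_hopf_subalgebra A R B \<longleftrightarrow> hopf_subalgebra A R B \<and>
     (\<forall>a\<in>A. \<forall>b\<in>carrier B.
        tensor_lift R B (\<lambda>x y. x \<otimes>\<^bsub>B\<^esub> a \<otimes>\<^bsub>B\<^esub> antipode B y) (comult B b) \<in> A \<and>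
        tensor_lift R B (\<lambda>x y. antipode B x \<otimes>\<^bsub>B\<^esub> a \<otimes>\<^bsub>B\<^esub> y) (comult B b) \<in> A)"

definition augmentation_ideal ::
    "'b set \<Rightarrow> ('r, 'x) ring_scheme \<Rightarrow> ('r, 'b, 'y) hopf_scheme \<Rightarrow> 'b set" where
  "augmentation_ideal A R B = {a \<in> A. counit B a = \<zero>\<^bsub>R\<^esub>}"

text \<open>The quotient by a Hopf ideal \<open>I\<close>, with the structure maps induced by those of \<open>B\<close>.\<close>

definition quot_hopf ::
    "('r, 'x) ring_scheme \<Rightarrow> ('r, 'b, 'y) hopf_scheme \<Rightarrow> 'b set \<Rightarrow> ('r, 'b set) hopf" where
  "quot_hopf R B I = (let Q = quot_module B I; \<pi> = (\<lambda>x. I +>\<^bsub>B\<^esub> x) in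
     module.extend Q (hopf.fields
       (\<lambda>X. the_elem ((\<lambda>x. tensor_map R Q Q \<pi> \<pi> (comult B x)) ` X))
       (\<lambda>X. the_elem (counit B ` X))
       (\<lambda>X. the_elem ((\<lambda>x. \<pi> (antipode B x)) ` X))))"

text \<open>\<open>B \<otimes>\<^sub>A R = B / B A\<^sup>+\<close>; \<^const>\<open>ideal_prod\<close> consists of the finite sums of products.\<close>

definition hopf_quotient_by ::
    "('r, 'x) ring_scheme \<Rightarrow> ('r, 'b, 'y) hopf_scheme \<Rightarrow> 'b set \<Rightarrow> ('r, 'b set) hopf" where
  "hopf_quotient_by R B A = quot_hopf R B (carrier B \<cdot>\<^bsub>B\<^esub> augmentation_ideal A R B)"


section \<open>Integrals\<close>

definition left_integral ::
    "('r, 'x) ring_scheme \<Rightarrow> ('r, 'b, 'y) hopf_scheme \<Rightarrow> ('b \<Rightarrow> 'r) \<Rightarrow> bool" where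
  "left_integral R H \<phi> \<longleftrightarrow> \<phi> \<in> module_hom R H (self_module R) \<and>
     (\<forall>h\<in>carrier H. tensor_lift R H (\<lambda>x y. \<phi> y \<odot>\<^bsub>H\<^esub> x) (comult H h) = \<phi> h \<odot>\<^bsub>H\<^esub> \<one>\<^bsub>H\<^esub>)"

definition right_integral ::
    "('r, 'x) ring_scheme \<Rightarrow> ('r, 'b, 'y) hopf_scheme \<Rightarrow> ('b \<Rightarrow> 'r) \<Rightarrow> bool" where
  "right_integral R H \<phi> \<longleftrightarrow> \<phi> \<in> module_hom R H (self_module R) \<and>
     (\<forall>h\<in>carrier H. tensor_lift R H (\<lambda>x y. \<phi> x \<odot>\<^bsub>H\<^esub> y) (comult H h) = \<phi> h \<odot>\<^bsub>H\<^esub> \<one>\<^bsub>H\<^esub>)"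

definition has_nonzero_left_integral ::
    "('r, 'x) ring_scheme \<Rightarrow> ('r, 'b, 'y) hopf_scheme \<Rightarrow> bool" where
  "has_nonzero_left_integral R H \<longleftrightarrow>
     (\<exists>\<phi>. left_integral R H \<phi> \<and> (\<exists>h\<in>carrier H. \<phi> h \<noteq> \<zero>\<^bsub>R\<^esub>))"

definition has_nonzero_right_integral ::
    "('r, 'x) ring_scheme \<Rightarrow> ('r, 'b, 'y) hopf_scheme \<Rightarrow> bool" where
  "has_nonzero_right_integral R H \<longleftrightarrow>
     (\<exists>\<phi>. right_integral R H \<phi> \<and> (\<exists>h\<in>carrier H. \<phi> h \<noteq> \<zero>\<^bsub>R\<^esub>))"

end

theory Submission
  imports Defs
begin

text \<open>
  Let \<open>I = B A\<^sup>+\<close>, let \<open>C = B / I\<close>, and let \<open>K\<close> be the fraction field of \<open>R\<close>. A left integral \<open>\<phi>\<close> on \<open>C\<close>, pulled back to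
  \<open>B\<close>, yields the map \<open>E b = \<Sum> b\<^sub>1 \<phi>(b\<^sub>2)\<close> from \<open>B\<close> to the coinvariants of \<open>B\<close> over \<open>C\<close>. These lie in \<open>A\<close>, so
  composing \<open>E\<close> with a left integral on \<open>A\<close> gives a left integral on \<open>B\<close>: for functions on a group, one
  integrates over a normal subgroup and then over the quotient group. Conversely, if \<open>\<phi>\<close> is a left integral on
  \<open>B\<close> and \<open>\<Lambda>\<close> is a left integral in \<open>A\<close>, that is, \<open>a \<Lambda> = \<epsilon>(a) \<Lambda>\<close> for \<open>a \<in> A\<close>, then \<open>b \<mapsto> \<phi>(b \<Lambda>)\<close> vanishes on
  \<open>B A\<^sup>+\<close> and is a left integral on \<open>C\<close>.

  Both directions need integrals of \<open>A\<close> that are not only nonzero but pair to something nonzero: a right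
  integral \<open>F\<close> on \<open>A\<close> and a left integral \<open>\<Lambda>\<close> in \<open>A\<close> with \<open>F(\<Lambda>) \<noteq> 0\<close> (\<open>exists_dual_integrals\<close>). The argument is
  that of Larson and Sweedler for finite-dimensional Hopf algebras over \<open>K\<close>. The projections of the Hopf modules
  \<open>A\<^sup>*\<close> and \<open>A\<close> to their coinvariants are traces over a dual basis of \<open>A \<otimes> K\<close> (\<open>P\<close> and \<open>Q\<close>); the identities
  \<open>sum_P\<close> and \<open>sum_Q\<close>, which say that these Hopf modules are generated by coinvariants, show first that some \<open>F\<close> is
  nonzero and then that \<open>F\<close> cannot vanish on all \<open>\<Lambda>\<close>. The pair \<open>(F, \<Lambda>)\<close> shows that the induced integrals are
  nonzero, and it shows that coinvariants lie in \<open>A\<close>: the map \<open>b \<mapsto> \<Sum> F(b \<Lambda>\<^sub>1) S(\<Lambda>\<^sub>2)\<close> is right \<open>A\<close>-linear with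
  values in \<open>A \<otimes> K\<close>, it sends \<open>1\<close> to \<open>F(\<Lambda>)\<close>, and it multiplies every coinvariant by \<open>F(\<Lambda>)\<close>
  (\<open>coinvariants_in_subalgebra\<close>). Denominators are cleared because \<open>A\<close> is finitely generated, and
  saturation brings elements of \<open>B \<inter> (A \<otimes> K)\<close> back to \<open>A\<close>.

  Normality gives \<open>B A\<^sup>+ = A\<^sup>+ B\<close>. All hypotheses are therefore invariant under reversing both the
  multiplication and the comultiplication of \<open>B\<close>, which leaves the antipode unchanged and turns left integrals into
  right ones; the statement on right integrals is the one on left integrals for the reversed Hopf algebra.

  The computations avoid tensor products. A flat module over a domain is torsion-free, and \<open>R\<close>-linear maps from
  a torsion-free module to \<open>K\<close> separate points, even points from a saturated submodule
  (\<open>functional_separating\<close>). So \<open>\<Delta> b\<close> is represented by a finite list of pairs, the Hopf algebra axioms are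
  applied to \<open>K\<close>-valued multilinear forms, and elements of \<open>B\<close> are compared by functionals. Membership in \<open>I\<close> is
  shown with sums in \<open>B\<close> itself, because functionals do not detect torsion in \<open>B / I\<close>.
\<close>

section \<open>Fraction fields\<close>

definition fraction_pair :: "('r, 'x) ring_scheme \<Rightarrow> 'r \<times> 'r \<Rightarrow> bool" where
  "fraction_pair S p \<longleftrightarrow> fst p \<in> carrier S \<and> snd p \<in> carrier S \<and> snd p \<noteq> \<zero>\<^bsub>S\<^esub>"

definition fraction_eq :: "('r, 'x) ring_scheme \<Rightarrow> 'r \<times> 'r \<Rightarrow> 'r \<times> 'r \<Rightarrow> bool" where
  "fraction_eq S p q \<longleftrightarrow> fraction_pair S p \<and> fraction_pair S q \<and>
     fst p \<otimes>\<^bsub>S\<^esub> snd q = fst q \<otimes>\<^bsub>S\<^esub> snd p"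

context domain
begin

lemma fraction_eq_trans:
  assumes "fraction_eq R p q" "fraction_eq R q s"
  shows "fraction_eq R p s"
proof -
  have c: "fst p \<in> carrier R" "snd p \<in> carrier R" "fst q \<in> carrier R" "snd q \<in> carrier R"
    "fst s \<in> carrier R" "snd s \<in> carrier R" "snd q \<noteq> \<zero>"
    and e: "fst p \<otimes> snd q = fst q \<otimes> snd p" "fst q \<otimes> snd s = fst s \<otimes> snd q"
    using assms by (auto simp: fraction_eq_def fraction_pair_def)
  have "snd q \<otimes> (fst p \<otimes> snd s) = (fst p \<otimes> snd q) \<otimes> snd s"
    using c by (simp add: m_ac)
  also have "\<dots> = (fst q \<otimes> snd s) \<otimes> snd p" unfolding e(1) using c by (simp add: m_ac)
  also have "\<dots> = snd q \<otimes> (fst s \<otimes> snd p)" unfolding e(2) using c by (simp add: m_ac)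
  finally have "fst p \<otimes> snd s = fst s \<otimes> snd p"
    using c m_lcancel[of "snd q" "fst p \<otimes> snd s" "fst s \<otimes> snd p"] by simp
  thus ?thesis using assms by (simp add: fraction_eq_def)
qed

lemma fraction_eq_add:
  assumes "fraction_eq R p p'" "fraction_eq R q q'"
  shows "fraction_eq R (fst p \<otimes> snd q \<oplus> fst q \<otimes> snd p, snd p \<otimes> snd q)
           (fst p' \<otimes> snd q' \<oplus> fst q' \<otimes> snd p', snd p' \<otimes> snd q')"
proof -
  obtain a b where p: "p = (a, b)" by (cases p)
  obtain c d where q: "q = (c, d)" by (cases q)
  obtain a' b' where p': "p' = (a', b')" by (cases p')
  obtain c' d' where q': "q' = (c', d')" by (cases q')
  have c: "a \<in> carrier R" "b \<in> carrier R" "c \<in> carrier R" "d \<in> carrier R"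
    "a' \<in> carrier R" "b' \<in> carrier R" "c' \<in> carrier R" "d' \<in> carrier R"
    and n: "b \<noteq> \<zero>" "d \<noteq> \<zero>" "b' \<noteq> \<zero>" "d' \<noteq> \<zero>"
    and e: "a \<otimes> b' = a' \<otimes> b" "c \<otimes> d' = c' \<otimes> d"
    using assms by (auto simp: fraction_eq_def fraction_pair_def p q p' q')
  have "(a \<otimes> d \<oplus> c \<otimes> b) \<otimes> (b' \<otimes> d') = (a \<otimes> b') \<otimes> (d \<otimes> d') \<oplus> (c \<otimes> d') \<otimes> (b \<otimes> b')"
    using c by algebra
  also have "\<dots> = (a' \<otimes> d' \<oplus> c' \<otimes> b') \<otimes> (b \<otimes> d)"
    unfolding e using c by algebra
  finally show ?thesis
    using c n by (simp add: fraction_eq_def fraction_pair_def p q p' q' integral_iff)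
qed

lemma fraction_eq_mult:
  assumes "fraction_eq R p p'" "fraction_eq R q q'"
  shows "fraction_eq R (fst p \<otimes> fst q, snd p \<otimes> snd q) (fst p' \<otimes> fst q', snd p' \<otimes> snd q')"
proof -
  obtain a b where p: "p = (a, b)" by (cases p)
  obtain c d where q: "q = (c, d)" by (cases q)
  obtain a' b' where p': "p' = (a', b')" by (cases p')
  obtain c' d' where q': "q' = (c', d')" by (cases q')
  have c: "a \<in> carrier R" "b \<in> carrier R" "c \<in> carrier R" "d \<in> carrier R"
    "a' \<in> carrier R" "b' \<in> carrier R" "c' \<in> carrier R" "d' \<in> carrier R"
    and n: "b \<noteq> \<zero>" "d \<noteq> \<zero>" "b' \<noteq> \<zero>" "d' \<noteq> \<zero>"
    and e: "a \<otimes> b' = a' \<otimes> b" "c \<otimes> d' = c' \<otimes> d"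
    using assms by (auto simp: fraction_eq_def fraction_pair_def p q p' q')
  have "(a \<otimes> c) \<otimes> (b' \<otimes> d') = (a \<otimes> b') \<otimes> (c \<otimes> d')"
    using c by algebra
  also have "\<dots> = (a' \<otimes> c') \<otimes> (b \<otimes> d)"
    unfolding e using c by algebra
  finally show ?thesis
    using c n by (simp add: fraction_eq_def fraction_pair_def p q p' q' integral_iff)
qed

lemma fraction_eq_uminus:
  assumes "fraction_eq R p p'"
  shows "fraction_eq R (\<ominus> fst p, snd p) (\<ominus> fst p', snd p')"
  using assms by (auto simp: fraction_eq_def fraction_pair_def l_minus)

end

text \<open>Identities will be checked with values in the fraction field \<open>K\<close> of \<open>R\<close>. For sums in \<open>K\<close> to be sums
  of a type class, \<open>K\<close> has to lie in a type that does not depend on \<open>R\<close>. An element of that type picks a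
  fraction for every domain structure \<open>S\<close> on \<open>'r\<close>: the type is the product of all these fraction fields.\<close>

definition fractions_eq :: "('r ring \<Rightarrow> 'r \<times> 'r) \<Rightarrow> ('r ring \<Rightarrow> 'r \<times> 'r) \<Rightarrow> bool" where
  "fractions_eq f g \<longleftrightarrow> (\<forall>S. domain S \<longrightarrow> fraction_eq S (f S) (g S))"

lemma fractions_eqI: "(\<And>S. domain S \<Longrightarrow> fraction_eq S (f S) (g S)) \<Longrightarrow> fractions_eq f g"
  by (simp add: fractions_eq_def)

lemma fractions_eq_reflD:
  assumes "fractions_eq f f" "domain S"
  shows "fst (f S) \<in> carrier S" "snd (f S) \<in> carrier S" "snd (f S) \<noteq> \<zero>\<^bsub>S\<^esub>"
  using assms by (auto simp: fractions_eq_def fraction_eq_def fraction_pair_def)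

quotient_type 'r ufrac = "'r ring \<Rightarrow> 'r \<times> 'r" / partial: fractions_eq
proof (rule part_equivpI)
  show "\<exists>f :: 'r ring \<Rightarrow> 'r \<times> 'r. fractions_eq f f"
    by (rule exI[of _ "\<lambda>S. (\<zero>\<^bsub>S\<^esub>, \<one>\<^bsub>S\<^esub>)"])
      (auto simp: fractions_eq_def fraction_eq_def fraction_pair_def cring.cring_simprules domain.axioms(1)
        dest: domain.one_not_zero)
  show "symp (fractions_eq :: ('r ring \<Rightarrow> _) \<Rightarrow> _)"
    by (auto simp: symp_def fractions_eq_def fraction_eq_def)
  show "transp (fractions_eq :: ('r ring \<Rightarrow> _) \<Rightarrow> _)"
    by (auto simp: transp_def fractions_eq_def intro: domain.fraction_eq_trans)
qed

instantiation ufrac :: (type) comm_ring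
begin

lift_definition zero_ufrac :: "'a ufrac" is "\<lambda>S. (\<zero>\<^bsub>S\<^esub>, \<one>\<^bsub>S\<^esub>)"
  by (auto simp: fractions_eq_def fraction_eq_def fraction_pair_def cring.cring_simprules
        domain.axioms(1) dest: domain.one_not_zero)

lift_definition plus_ufrac :: "'a ufrac \<Rightarrow> 'a ufrac \<Rightarrow> 'a ufrac" is
  "\<lambda>f g S. (fst (f S) \<otimes>\<^bsub>S\<^esub> snd (g S) \<oplus>\<^bsub>S\<^esub> fst (g S) \<otimes>\<^bsub>S\<^esub> snd (f S),
     snd (f S) \<otimes>\<^bsub>S\<^esub> snd (g S))"
  by (simp add: fractions_eq_def domain.fraction_eq_add)

lift_definition times_ufrac :: "'a ufrac \<Rightarrow> 'a ufrac \<Rightarrow> 'a ufrac" is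
  "\<lambda>f g S. (fst (f S) \<otimes>\<^bsub>S\<^esub> fst (g S), snd (f S) \<otimes>\<^bsub>S\<^esub> snd (g S))"
  by (simp add: fractions_eq_def domain.fraction_eq_mult)

lift_definition uminus_ufrac :: "'a ufrac \<Rightarrow> 'a ufrac" is "\<lambda>f S. (\<ominus>\<^bsub>S\<^esub> fst (f S), snd (f S))"
  by (simp add: fractions_eq_def domain.fraction_eq_uminus)

definition minus_ufrac :: "'a ufrac \<Rightarrow> 'a ufrac \<Rightarrow> 'a ufrac" where
  "minus_ufrac x y = x + - y"

instance
proof
  note simps = fraction_eq_def fraction_pair_def fractions_eq_reflD domain.integral_iff
    cring.cring_simprules[OF domain.axioms(1)]
  fix a b c :: "'a ufrac"
  show "a + b + c = a + (b + c)"
    by (transfer, rule fractions_eqI) (simp add: simps)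
  show "a + b = b + a"
    by (transfer, rule fractions_eqI) (simp add: simps)
  show "0 + a = a"
    by (transfer, rule fractions_eqI) (simp add: simps domain.one_not_zero)
  show "- a + a = 0"
    by (transfer, rule fractions_eqI) (simp add: simps domain.one_not_zero)
  show "a - b = a + - b"
    by (simp add: minus_ufrac_def)
  show "a * b * c = a * (b * c)"
    by (transfer, rule fractions_eqI) (simp add: simps)
  show "a * b = b * a"
    by (transfer, rule fractions_eqI) (simp add: simps)
  show "(a + b) * c = a * c + b * c"
    by (transfer, rule fractions_eqI) (simp add: simps)
qed

end

text \<open>The fraction \<open>a / b\<close> in the factor of \<open>R\<close> and \<open>0\<close> in every other factor. In particular the fraction
  \<open>1 / 1\<close> is the idempotent that cuts out the factor \<open>K\<close>.\<close>

lift_definition ufrac_of :: "('r, 'x) ring_scheme \<Rightarrow> 'r \<Rightarrow> 'r \<Rightarrow> 'r ufrac" is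
  "\<lambda>R a b S. if S = ring.truncate R \<and> fraction_pair S (a, b) then (a, b) else (\<zero>\<^bsub>S\<^esub>, \<one>\<^bsub>S\<^esub>)"
  by (auto simp: fractions_eq_def fraction_eq_def fraction_pair_def cring.cring_simprules
        domain.axioms(1) dest: domain.one_not_zero)

lemma domain_truncate:
  fixes R (structure)
  assumes "domain R"
  shows "domain (ring.truncate R)"
proof -
  interpret domain R by fact
  have inv: "\<And>x. x \<in> carrier R \<Longrightarrow> \<exists>y\<in>carrier R. y \<oplus> x = \<zero>"
    by (meson a_inv_closed l_neg)
  show ?thesis
    by (intro domain.intro cringI domain_axioms.intro abelian_groupI comm_monoidI)
      (auto simp: ring.truncate_def inv intro: a_assoc a_comm m_assoc m_comm l_distr dest: integral)
qed

text \<open>The elements \<open>k\<close> with \<open>\<iota> 1 k = k\<close> form the fraction field \<open>K\<close>; the idempotent \<open>\<iota> 1\<close> need not be a unit of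
  the ambient ring. Multiplication by \<open>\<iota> s\<close> projects to \<open>K\<close>, which is why every \<open>k\<close> can be asked to have a
  denominator.\<close>

locale fraction_embedding = domain R for R (structure) +
  fixes \<iota> :: "'a \<Rightarrow> 'k :: comm_ring"
  assumes emb_add: "\<lbrakk> a \<in> carrier R; b \<in> carrier R \<rbrakk> \<Longrightarrow> \<iota> (a \<oplus> b) = \<iota> a + \<iota> b"
    and emb_mult: "\<lbrakk> a \<in> carrier R; b \<in> carrier R \<rbrakk> \<Longrightarrow> \<iota> (a \<otimes> b) = \<iota> a * \<iota> b"
    and emb_inj: "\<lbrakk> a \<in> carrier R; \<iota> a = 0 \<rbrakk> \<Longrightarrow> a = \<zero>"
    and emb_inverse: "\<lbrakk> s \<in> carrier R; s \<noteq> \<zero> \<rbrakk> \<Longrightarrow> \<exists>k. \<iota> s * k = \<iota> \<one>"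
    and fraction: "\<exists>a\<in>carrier R. \<exists>s\<in>carrier R. s \<noteq> \<zero> \<and> \<iota> s * k = \<iota> a"

lemma fraction_embedding_ufrac:
  fixes R :: "('r, 'x) ring_scheme" (structure)
  assumes "domain R"
  shows "fraction_embedding R (\<lambda>r. ufrac_of R r \<one>\<^bsub>R\<^esub>)"
proof -
  interpret domain R by fact
  have [simp]: "carrier (ring.truncate R) = carrier R" "zero (ring.truncate R) = \<zero>"
    "one (ring.truncate R) = \<one>" "add (ring.truncate R) = add R" "monoid.mult (ring.truncate R) = monoid.mult R"
    by (auto simp: ring.truncate_def)
  note simps = fraction_eq_def fraction_pair_def fractions_eq_reflD domain.integral_iff
    domain.one_not_zero cring.cring_simprules[OF domain.axioms(1)]
  note simps' = fraction_eq_def fraction_pair_def m_comm domain.one_not_zero cring.cring_simprules(2,6,8,12,26,27)[OF domain.axioms(1)]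
  show ?thesis
  proof (intro fraction_embedding.intro fraction_embedding_axioms.intro)
    show "domain R" by fact
  next
    fix a b assume "a \<in> carrier R" "b \<in> carrier R"
    then show "ufrac_of R (a \<oplus> b) \<one> = ufrac_of R a \<one> + ufrac_of R b \<one>"
      by (transfer fixing: R, intro fractions_eqI, case_tac "S = ring.truncate R")
        (simp_all add: simps')
  next
    fix a b assume "a \<in> carrier R" "b \<in> carrier R"
    then show "ufrac_of R (a \<otimes> b) \<one> = ufrac_of R a \<one> * ufrac_of R b \<one>"
      by (transfer fixing: R, intro fractions_eqI, case_tac "S = ring.truncate R")
        (simp_all add: simps')
  next
    fix a assume a: "a \<in> carrier R" "ufrac_of R a \<one> = 0"
    have "fractions_eq (\<lambda>S. if S = ring.truncate R \<and> fraction_pair S (a, \<one>) then (a, \<one>)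
        else (\<zero>\<^bsub>S\<^esub>, \<one>\<^bsub>S\<^esub>)) (\<lambda>S. (\<zero>\<^bsub>S\<^esub>, \<one>\<^bsub>S\<^esub>))"
      using a(2) by (transfer fixing: R)
    then show "a = \<zero>"
      using a(1) domain_truncate[OF assms] unfolding fractions_eq_def fraction_eq_def fraction_pair_def
      by (elim allE[of _ "ring.truncate R"]) simp
  next
    fix s assume s: "s \<in> carrier R" "s \<noteq> \<zero>"
    have "ufrac_of R s \<one> * ufrac_of R \<one> s = ufrac_of R \<one> \<one>"
      using s
      by (transfer fixing: R, intro fractions_eqI, case_tac "S = ring.truncate R")
        (simp_all add: simps')
    then show "\<exists>k. ufrac_of R s \<one> * k = ufrac_of R \<one> \<one>" ..
  next
    fix k :: "'r ufrac"
    show "\<exists>a\<in>carrier R. \<exists>s\<in>carrier R. s \<noteq> \<zero> \<and> ufrac_of R s \<one> * k = ufrac_of R a \<one>"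
    proof (transfer fixing: R)
      fix k :: "'r ring \<Rightarrow> 'r \<times> 'r" assume k: "fractions_eq k k"
      define T where "T = ring.truncate R"
      have T: "domain T" unfolding T_def by (rule domain_truncate) fact
      define a s where "a = fst (k T)" and "s = snd (k T)"
      have as: "a \<in> carrier R" "s \<in> carrier R" "s \<noteq> \<zero>"
        using fractions_eq_reflD[OF k T] unfolding a_def s_def by (auto simp: T_def)
      show "\<exists>a\<in>carrier R. \<exists>s\<in>carrier R. s \<noteq> \<zero> \<and> fractions_eq
          (\<lambda>S. (fst (if S = ring.truncate R \<and> fraction_pair S (s, \<one>) then (s, \<one>) else (\<zero>\<^bsub>S\<^esub>, \<one>\<^bsub>S\<^esub>)) \<otimes>\<^bsub>S\<^esub> fst (k S),
                snd (if S = ring.truncate R \<and> fraction_pair S (s, \<one>) then (s, \<one>) else (\<zero>\<^bsub>S\<^esub>, \<one>\<^bsub>S\<^esub>)) \<otimes>\<^bsub>S\<^esub> snd (k S)))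
          (\<lambda>S. if S = ring.truncate R \<and> fraction_pair S (a, \<one>) then (a, \<one>) else (\<zero>\<^bsub>S\<^esub>, \<one>\<^bsub>S\<^esub>))"
      proof (rule bexI[of _ a], rule bexI[of _ s], rule conjI, rule as, rule fractions_eqI)
        fix S :: "'r ring"
        assume S: "domain S"
        show "fraction_eq S (fst (if S = ring.truncate R \<and> fraction_pair S (s, \<one>) then (s, \<one>) else (\<zero>\<^bsub>S\<^esub>, \<one>\<^bsub>S\<^esub>)) \<otimes>\<^bsub>S\<^esub> fst (k S),
                snd (if S = ring.truncate R \<and> fraction_pair S (s, \<one>) then (s, \<one>) else (\<zero>\<^bsub>S\<^esub>, \<one>\<^bsub>S\<^esub>)) \<otimes>\<^bsub>S\<^esub> snd (k S))
          (if S = ring.truncate R \<and> fraction_pair S (a, \<one>) then (a, \<one>) else (\<zero>\<^bsub>S\<^esub>, \<one>\<^bsub>S\<^esub>))"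
        proof (cases "S = ring.truncate R")
          case True
          then have "fst (k S) = a" "snd (k S) = s"
            by (auto simp: a_def s_def T_def)
          with True as show ?thesis
            using m_comm[of s a] by (simp add: fraction_eq_def fraction_pair_def)
        next
          case False
          with fractions_eq_reflD[OF k S] S show ?thesis
            by (simp add: simps)
        qed
      qed (use as in simp_all)
    qed
  qed
qed

section \<open>Functionals on torsion-free modules\<close>

definition msum :: "('b, 'y) ring_scheme \<Rightarrow> 'b list \<Rightarrow> 'b" where
  "msum P xs = foldr (add P) xs (zero P)"

lemma msum_simps [simp]: "msum P [] = \<zero>\<^bsub>P\<^esub>" "msum P (x # xs) = x \<oplus>\<^bsub>P\<^esub> msum P xs"
  by (auto simp: msum_def)

lemma (in abelian_monoid) msum_closed [simp]: "set xs \<subseteq> carrier G \<Longrightarrow> msum G xs \<in> carrier G"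
  by (induction xs) auto

lemma (in module) submodule_if_closed:
  assumes "N \<subseteq> carrier M" "\<zero>\<^bsub>M\<^esub> \<in> N" "\<And>x y. x \<in> N \<Longrightarrow> y \<in> N \<Longrightarrow> x \<oplus>\<^bsub>M\<^esub> y \<in> N"
    "\<And>r x. r \<in> carrier R \<Longrightarrow> x \<in> N \<Longrightarrow> r \<odot>\<^bsub>M\<^esub> x \<in> N"
  shows "submodule N R M"
proof (rule submoduleI)
  fix x assume x: "x \<in> N"
  have "\<ominus>\<^bsub>M\<^esub> x = (\<ominus> \<one>) \<odot>\<^bsub>M\<^esub> x"
    using smult_l_minus[of \<one> x] x assms(1) by auto
  then show "\<ominus>\<^bsub>M\<^esub> x \<in> N" using assms(4)[of "\<ominus> \<one>" x] x by simp
qed (use assms in auto)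

context fraction_embedding
begin

lemma emb_zero [simp]: "\<iota> \<zero> = 0"
  using emb_add[of \<zero> \<zero>] by simp

lemma emb_uminus: "a \<in> carrier R \<Longrightarrow> \<iota> (\<ominus> a) = - \<iota> a"
  using emb_add[of a "\<ominus> a"] group_add_class.minus_unique[of "\<iota> a" "\<iota> (\<ominus> a)"] by (simp add: r_neg)

lemma emb_one_mult [simp]: "a \<in> carrier R \<Longrightarrow> \<iota> \<one> * \<iota> a = \<iota> a"
  using emb_mult[of \<one> a] by simp

lemma emb_cancel:
  assumes "s \<in> carrier R" "s \<noteq> \<zero>" "\<iota> s * k = 0" "\<iota> \<one> * k = k"
  shows "k = 0"
proof -
  obtain l where "\<iota> s * l = \<iota> \<one>"
    using emb_inverse assms by blast
  then have "k = l * (\<iota> s * k)"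
    using assms(4) by (metis mult.assoc mult.commute)
  then show ?thesis using assms(3) by simp
qed

lemma emb_eqD:
  assumes "a \<in> carrier R" "b \<in> carrier R" "\<iota> a = \<iota> b"
  shows "a = b"
  using emb_inj[of "a \<ominus> b"] assms r_right_minus_eq[of a b]
  by (simp add: emb_add emb_uminus minus_eq)

text \<open>The ambient ring has zero divisors; the two conditions \<open>\<iota> 1 k = k\<close> and \<open>\<iota> 1 l = l\<close> place \<open>k\<close> and \<open>l\<close> in the
  field \<open>K\<close>.\<close>

lemma value_cancel:
  assumes "k * l = 0" "\<iota> \<one> * k = k" "\<iota> \<one> * l = l" "k \<noteq> 0"
  shows "l = 0"
proof -
  obtain a s where as: "a \<in> carrier R" "s \<in> carrier R" "s \<noteq> \<zero>" "\<iota> s * k = \<iota> a"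
    using fraction by blast
  have "a \<noteq> \<zero>"
    using emb_cancel[OF as(2,3), of k] as(4) assms by auto
  moreover have "\<iota> a * l = 0"
    using as(4) assms(1) by (metis mult.assoc mult_zero_right)
  ultimately show ?thesis
    using emb_cancel[OF as(1)] assms(3) by blast
qed

lemma finite_common_denominator:
  assumes "finite Y"
  shows "\<exists>d\<in>carrier R. d \<noteq> \<zero> \<and> (\<forall>k\<in>Y. \<exists>r\<in>carrier R. \<iota> d * k = \<iota> r)"
  using assms
proof (induction Y rule: finite_induct)
  case empty
  then show ?case by (intro bexI[of _ \<one>]) auto
next
  case (insert y Y)
  obtain d where d: "d \<in> carrier R" "d \<noteq> \<zero>" "\<And>k. k \<in> Y \<Longrightarrow> \<exists>r\<in>carrier R. \<iota> d * k = \<iota> r"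
    using insert.IH by blast
  obtain a s where as: "a \<in> carrier R" "s \<in> carrier R" "s \<noteq> \<zero>" "\<iota> s * y = \<iota> a"
    using fraction by blast
  have "\<exists>r\<in>carrier R. \<iota> (d \<otimes> s) * k = \<iota> r" if k: "k \<in> insert y Y" for k
  proof (cases "k = y")
    case True
    have "\<iota> (d \<otimes> s) * y = \<iota> d * (\<iota> s * y)"
      using d(1) as(2) by (simp add: emb_mult mult.assoc)
    also have "\<dots> = \<iota> (d \<otimes> a)" using d(1) as by (simp add: emb_mult)
    finally show ?thesis
      using d(1) as(1) True by (intro bexI[of _ "d \<otimes> a"]) simp_all
  next
    case False
    then obtain r where r: "r \<in> carrier R" "\<iota> d * k = \<iota> r"
      using d(3)[of k] k by auto
    have "\<iota> (d \<otimes> s) * k = \<iota> s * (\<iota> d * k)"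
      using d(1) as(2) by (simp add: emb_mult ac_simps)
    also have "\<dots> = \<iota> (s \<otimes> r)" using r as(2) by (simp add: emb_mult)
    finally show ?thesis
      using r as(2) by (intro bexI[of _ "s \<otimes> r"]) simp_all
  qed
  then show ?case
    using d as by (intro bexI[of _ "d \<otimes> s"]) (auto simp: integral_iff)
qed

end

locale torsion_free_module = R?: fraction_embedding R \<iota> + module R B
  for R (structure) and B (structure) and \<iota> :: "_ \<Rightarrow> 'k :: comm_ring" +
  assumes torsion_free: "torsion_free R B"
begin

text \<open>The values of an \<open>R\<close>-linear map lie in \<open>K\<close> automatically, because \<open>1 \<in> R\<close> acts as the identity on \<open>B\<close>.\<close>

definition lin :: "('c \<Rightarrow> 'k) \<Rightarrow> bool" where
  "lin \<psi> \<longleftrightarrow> (\<forall>x\<in>carrier B. \<forall>y\<in>carrier B. \<psi> (x \<oplus>\<^bsub>B\<^esub> y) = \<psi> x + \<psi> y) \<and>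
     (\<forall>r\<in>carrier R. \<forall>x\<in>carrier B. \<psi> (r \<odot>\<^bsub>B\<^esub> x) = \<iota> r * \<psi> x)"

lemma linI:
  assumes "\<And>x y. x \<in> carrier B \<Longrightarrow> y \<in> carrier B \<Longrightarrow> \<psi> (x \<oplus>\<^bsub>B\<^esub> y) = \<psi> x + \<psi> y"
    and "\<And>r x. r \<in> carrier R \<Longrightarrow> x \<in> carrier B \<Longrightarrow> \<psi> (r \<odot>\<^bsub>B\<^esub> x) = \<iota> r * \<psi> x"
  shows "lin \<psi>"
  using assms by (simp add: lin_def)

lemma lin_add: "lin \<psi> \<Longrightarrow> x \<in> carrier B \<Longrightarrow> y \<in> carrier B \<Longrightarrow> \<psi> (x \<oplus>\<^bsub>B\<^esub> y) = \<psi> x + \<psi> y"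
  and lin_smult: "lin \<psi> \<Longrightarrow> r \<in> carrier R \<Longrightarrow> x \<in> carrier B \<Longrightarrow> \<psi> (r \<odot>\<^bsub>B\<^esub> x) = \<iota> r * \<psi> x"
  by (auto simp: lin_def)

lemma lin_zero: "lin \<psi> \<Longrightarrow> \<psi> \<zero>\<^bsub>B\<^esub> = 0"
  using lin_add[of \<psi> "\<zero>\<^bsub>B\<^esub>" "\<zero>\<^bsub>B\<^esub>"] by simp

lemma lin_value: "lin \<psi> \<Longrightarrow> x \<in> carrier B \<Longrightarrow> \<iota> \<one> * \<psi> x = \<psi> x"
  using lin_smult[of \<psi> \<one> x] by simp

lemma lin_uminus:
  assumes "lin \<psi>" "y \<in> carrier B"
  shows "\<psi> (\<ominus>\<^bsub>B\<^esub> y) = - \<psi> y"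
proof -
  have "\<psi> (\<ominus>\<^bsub>B\<^esub> y) + \<psi> y = 0"
    using lin_add[OF assms(1), of "\<ominus>\<^bsub>B\<^esub> y" y] assms by (simp add: M.l_neg lin_zero)
  then show ?thesis by (simp only: eq_neg_iff_add_eq_0)
qed

lemma lin_minus:
  assumes "lin \<psi>" "x \<in> carrier B" "y \<in> carrier B"
  shows "\<psi> (x \<ominus>\<^bsub>B\<^esub> y) = \<psi> x - \<psi> y"
  using assms by (simp add: M.minus_eq lin_add lin_uminus)

lemma submodule_add: "submodule N R B \<Longrightarrow> x \<in> N \<Longrightarrow> y \<in> N \<Longrightarrow> x \<oplus>\<^bsub>B\<^esub> y \<in> N"
  and submodule_smult: "submodule N R B \<Longrightarrow> r \<in> carrier R \<Longrightarrow> x \<in> N \<Longrightarrow> r \<odot>\<^bsub>B\<^esub> x \<in> N"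
  and submodule_subset: "submodule N R B \<Longrightarrow> N \<subseteq> carrier B"
  and submodule_uminus: "submodule N R B \<Longrightarrow> x \<in> N \<Longrightarrow> \<ominus>\<^bsub>B\<^esub> x \<in> N"
  using submoduleE[of N] by simp_all

lemma submodule_minus: "submodule N R B \<Longrightarrow> x \<in> N \<Longrightarrow> y \<in> N \<Longrightarrow> x \<ominus>\<^bsub>B\<^esub> y \<in> N"
  by (simp add: M.minus_eq submodule_add submodule_uminus)

lemma submodule_zero: "submodule N R B \<Longrightarrow> \<zero>\<^bsub>B\<^esub> \<in> N"
  using subgroup.one_closed[OF submodule.axioms(1)] by fastforce

lemma submodule_zero_set: "submodule {\<zero>\<^bsub>B\<^esub>} R B"
  by (rule submodule_if_closed) auto

lemma submodule_adjoin:
  assumes N: "submodule N R B" and b: "b \<in> carrier B"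
  shows "submodule {n \<oplus>\<^bsub>B\<^esub> r \<odot>\<^bsub>B\<^esub> b | n r. n \<in> N \<and> r \<in> carrier R} R B" (is "submodule ?N R B")
proof (rule submodule_if_closed)
  have sub: "\<And>n. n \<in> N \<Longrightarrow> n \<in> carrier B" using submodule_subset[OF N] by auto
  show "?N \<subseteq> carrier B" using sub b by auto
  show "\<zero>\<^bsub>B\<^esub> \<in> ?N"
    using submodule_zero[OF N] b by (intro CollectI exI[of _ "\<zero>\<^bsub>B\<^esub>"] exI[of _ \<zero>]) auto
  show "a \<oplus>\<^bsub>B\<^esub> a' \<in> ?N" if aa': "a \<in> ?N" "a' \<in> ?N" for a a'
  proof -
    from aa' obtain n r n' r' where a: "a = n \<oplus>\<^bsub>B\<^esub> r \<odot>\<^bsub>B\<^esub> b" "n \<in> N" "r \<in> carrier R"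
      "a' = n' \<oplus>\<^bsub>B\<^esub> r' \<odot>\<^bsub>B\<^esub> b" "n' \<in> N" "r' \<in> carrier R" by auto
    then have "a \<oplus>\<^bsub>B\<^esub> a' = (n \<oplus>\<^bsub>B\<^esub> n') \<oplus>\<^bsub>B\<^esub> (r \<oplus> r') \<odot>\<^bsub>B\<^esub> b"
      using b sub by (simp add: smult_l_distr M.a_ac)
    then show ?thesis using a(2,3,5,6) submodule_add[OF N, of n n']
      by (intro CollectI exI[of _ "n \<oplus>\<^bsub>B\<^esub> n'"] exI[of _ "r \<oplus> r'"]) simp
  qed
  show "c \<odot>\<^bsub>B\<^esub> a \<in> ?N" if "c \<in> carrier R" "a \<in> ?N" for c a
  proof -
    from that obtain n r where a: "a = n \<oplus>\<^bsub>B\<^esub> r \<odot>\<^bsub>B\<^esub> b" "n \<in> N" "r \<in> carrier R" by auto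
    then have "c \<odot>\<^bsub>B\<^esub> a = c \<odot>\<^bsub>B\<^esub> n \<oplus>\<^bsub>B\<^esub> (c \<otimes> r) \<odot>\<^bsub>B\<^esub> b"
      using b sub that(1) by (simp add: smult_r_distr smult_assoc1)
    then show ?thesis using a(2,3) that(1) submodule_smult[OF N, of c n]
      by (intro CollectI exI[of _ "c \<odot>\<^bsub>B\<^esub> n"] exI[of _ "c \<otimes> r"]) simp
  qed
qed

text \<open>By Zorn's lemma there is a maximal submodule \<open>M\<close> over \<open>N\<close> that contains no nonzero multiple of \<open>x\<close>.
  Adjoining any \<open>b\<close> to \<open>M\<close> destroys this, so modulo \<open>M\<close> every \<open>b\<close> is a \<open>K\<close>-multiple of \<open>x\<close>.\<close>

lemma maximal_independent_submodule:
  assumes N: "submodule N R B"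
    and x: "x \<in> carrier B" "\<And>r. r \<in> carrier R \<Longrightarrow> r \<noteq> \<zero> \<Longrightarrow> r \<odot>\<^bsub>B\<^esub> x \<notin> N"
  obtains M where "submodule M R B" "N \<subseteq> M"
    "\<And>r. r \<in> carrier R \<Longrightarrow> r \<noteq> \<zero> \<Longrightarrow> r \<odot>\<^bsub>B\<^esub> x \<notin> M"
    "\<And>b. b \<in> carrier B \<Longrightarrow> \<exists>s\<in>carrier R. \<exists>r\<in>carrier R. s \<noteq> \<zero> \<and> s \<odot>\<^bsub>B\<^esub> b \<ominus>\<^bsub>B\<^esub> r \<odot>\<^bsub>B\<^esub> x \<in> M"
proof -
  define \<N> where "\<N> = {M. submodule M R B \<and> N \<subseteq> M \<and>
    (\<forall>r\<in>carrier R. r \<noteq> \<zero> \<longrightarrow> r \<odot>\<^bsub>B\<^esub> x \<notin> M)}"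
  have "\<exists>M\<in>\<N>. \<forall>X\<in>\<N>. M \<subseteq> X \<longrightarrow> X = M"
  proof (rule subset_Zorn_nonempty)
    show "\<N> \<noteq> {}" using N x by (auto simp: \<N>_def)
  next
    fix C assume C: "C \<noteq> {}" "subset.chain \<N> C"
    then have CN: "\<And>M. M \<in> C \<Longrightarrow> M \<in> \<N>"
      and cmp: "\<And>M M'. M \<in> C \<Longrightarrow> M' \<in> C \<Longrightarrow> M \<subseteq> M' \<or> M' \<subseteq> M"
      by (auto simp: subset_chain_def)
    have sub: "\<And>M. M \<in> C \<Longrightarrow> submodule M R B" using CN by (auto simp: \<N>_def)
    have "submodule (\<Union>C) R B"
    proof (rule submodule_if_closed)
      show "\<Union>C \<subseteq> carrier B" using sub submodule_subset by blast
      show "\<zero>\<^bsub>B\<^esub> \<in> \<Union>C" using C(1) sub submodule_zero by blast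
      show "\<And>a x. a \<in> carrier R \<Longrightarrow> x \<in> \<Union>C \<Longrightarrow> a \<odot>\<^bsub>B\<^esub> x \<in> \<Union>C" using sub submodule_smult by blast
      fix a b assume "a \<in> \<Union>C" "b \<in> \<Union>C"
      then obtain M where "M \<in> C" "a \<in> M" "b \<in> M" using cmp by blast
      then show "a \<oplus>\<^bsub>B\<^esub> b \<in> \<Union>C" using sub submodule_add by blast
    qed
    then show "\<Union>C \<in> \<N>"
      using C(1) CN by (fastforce simp: \<N>_def)
  qed
  then obtain M where M: "M \<in> \<N>" and max: "\<And>X. X \<in> \<N> \<Longrightarrow> M \<subseteq> X \<Longrightarrow> X = M" by blast
  have Msub: "submodule M R B" and NM: "N \<subseteq> M"
    and Mx: "\<And>r. r \<in> carrier R \<Longrightarrow> r \<noteq> \<zero> \<Longrightarrow> r \<odot>\<^bsub>B\<^esub> x \<notin> M"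
    using M by (auto simp: \<N>_def)
  have "\<exists>s\<in>carrier R. \<exists>r\<in>carrier R. s \<noteq> \<zero> \<and> s \<odot>\<^bsub>B\<^esub> b \<ominus>\<^bsub>B\<^esub> r \<odot>\<^bsub>B\<^esub> x \<in> M" if b: "b \<in> carrier B" for b
  proof (cases "b \<in> M")
    case True
    then have "\<one> \<odot>\<^bsub>B\<^esub> b \<ominus>\<^bsub>B\<^esub> \<zero> \<odot>\<^bsub>B\<^esub> x \<in> M"
      using b x(1) submodule_minus[OF Msub _ submodule_zero[OF Msub], of b] by simp
    then show ?thesis using one_not_zero by (intro bexI[of _ \<one>] bexI[of _ \<zero>]) auto
  next
    case False
    let ?M = "{n \<oplus>\<^bsub>B\<^esub> r \<odot>\<^bsub>B\<^esub> b | n r. n \<in> M \<and> r \<in> carrier R}"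
    have sub: "submodule ?M R B" by (rule submodule_adjoin[OF Msub b])
    have Msubs: "\<And>n. n \<in> M \<Longrightarrow> n \<in> carrier B" using submodule_subset[OF Msub] by auto
    have le: "M \<subseteq> ?M"
    proof
      fix n assume "n \<in> M"
      then show "n \<in> ?M" using b Msubs by (intro CollectI exI[of _ n] exI[of _ \<zero>]) auto
    qed
    have "b \<in> ?M"
      using b submodule_zero[OF Msub] by (intro CollectI exI[of _ "\<zero>\<^bsub>B\<^esub>"] exI[of _ \<one>]) auto
    then have "?M \<notin> \<N>" using max[OF _ le] False by auto
    then obtain r where r: "r \<in> carrier R" "r \<noteq> \<zero>" "r \<odot>\<^bsub>B\<^esub> x \<in> ?M"
      using sub le NM by (auto simp: \<N>_def)
    then obtain n s where ns: "n \<in> M" "s \<in> carrier R" "r \<odot>\<^bsub>B\<^esub> x = n \<oplus>\<^bsub>B\<^esub> s \<odot>\<^bsub>B\<^esub> b" by auto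
    have "s \<noteq> \<zero>" using Mx[OF r(1,2)] ns b Msubs by auto
    moreover have "s \<odot>\<^bsub>B\<^esub> b \<ominus>\<^bsub>B\<^esub> r \<odot>\<^bsub>B\<^esub> x = \<ominus>\<^bsub>B\<^esub> n"
      using ns(1,2) b Msubs unfolding ns(3) by (simp add: M.minus_eq M.minus_add M.a_ac M.r_neg2 M.r_neg1 M.r_neg)
    ultimately show ?thesis
      using ns(2) r(1) submodule_uminus[OF Msub ns(1)] by (intro bexI[of _ s] bexI[of _ r]) auto
  qed
  with Msub NM Mx that show ?thesis by blast
qed

text \<open>The functional sends \<open>b\<close> to the fraction \<open>r / s\<close> for a relation \<open>s b - r x \<in> M\<close> of the preceding lemma.\<close>

lemma functional_separating:
  assumes N: "submodule N R B"
    and x: "x \<in> carrier B" "\<And>r. r \<in> carrier R \<Longrightarrow> r \<noteq> \<zero> \<Longrightarrow> r \<odot>\<^bsub>B\<^esub> x \<notin> N"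
  obtains \<psi> where "lin \<psi>" "\<And>n. n \<in> N \<Longrightarrow> \<psi> n = 0" "\<psi> x = \<iota> \<one>"
proof -
  obtain M where M: "submodule M R B" "N \<subseteq> M"
    and Mx: "\<And>r. r \<in> carrier R \<Longrightarrow> r \<noteq> \<zero> \<Longrightarrow> r \<odot>\<^bsub>B\<^esub> x \<notin> M"
    and Mb: "\<And>b. b \<in> carrier B \<Longrightarrow> \<exists>s\<in>carrier R. \<exists>r\<in>carrier R. s \<noteq> \<zero> \<and> s \<odot>\<^bsub>B\<^esub> b \<ominus>\<^bsub>B\<^esub> r \<odot>\<^bsub>B\<^esub> x \<in> M"
    using maximal_independent_submodule[OF assms] by metis
  have "\<forall>s\<in>carrier R - {\<zero>}. \<exists>k. \<iota> s * k = \<iota> \<one>"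
    using emb_inverse by blast
  then obtain q where q: "\<And>s. s \<in> carrier R \<Longrightarrow> s \<noteq> \<zero> \<Longrightarrow> \<iota> s * q s = \<iota> \<one>"
    by (metis Diff_iff singletonD)
  have "\<forall>b\<in>carrier B. \<exists>s r. s \<in> carrier R \<and> r \<in> carrier R \<and> s \<noteq> \<zero> \<and> s \<odot>\<^bsub>B\<^esub> b \<ominus>\<^bsub>B\<^esub> r \<odot>\<^bsub>B\<^esub> x \<in> M"
    using Mb by blast
  then obtain den num where dn: "\<And>b. b \<in> carrier B \<Longrightarrow> den b \<in> carrier R \<and> num b \<in> carrier R \<and>
      den b \<noteq> \<zero> \<and> den b \<odot>\<^bsub>B\<^esub> b \<ominus>\<^bsub>B\<^esub> num b \<odot>\<^bsub>B\<^esub> x \<in> M"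
    by metis
  define \<psi> where "\<psi> b = \<iota> (num b) * q (den b)" for b
  \<comment> \<open>The value is determined by any relation between \<open>b\<close> and \<open>x\<close> modulo \<open>M\<close>.\<close>
  have char: "\<iota> s * \<psi> b = \<iota> r"
    if b: "b \<in> carrier B" and s: "s \<in> carrier R" and r: "r \<in> carrier R"
      and m: "s \<odot>\<^bsub>B\<^esub> b \<ominus>\<^bsub>B\<^esub> r \<odot>\<^bsub>B\<^esub> x \<in> M" for b s r
  proof -
    have d: "den b \<in> carrier R" "num b \<in> carrier R" "den b \<noteq> \<zero>"
      "den b \<odot>\<^bsub>B\<^esub> b \<ominus>\<^bsub>B\<^esub> num b \<odot>\<^bsub>B\<^esub> x \<in> M" using dn[OF b] by auto
    have "den b \<odot>\<^bsub>B\<^esub> (s \<odot>\<^bsub>B\<^esub> b \<ominus>\<^bsub>B\<^esub> r \<odot>\<^bsub>B\<^esub> x) \<ominus>\<^bsub>B\<^esub> s \<odot>\<^bsub>B\<^esub> (den b \<odot>\<^bsub>B\<^esub> b \<ominus>\<^bsub>B\<^esub> num b \<odot>\<^bsub>B\<^esub> x) \<in> M"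
      by (intro submodule_minus[OF M(1)] submodule_smult[OF M(1)] d m s)
    also have "den b \<odot>\<^bsub>B\<^esub> (s \<odot>\<^bsub>B\<^esub> b \<ominus>\<^bsub>B\<^esub> r \<odot>\<^bsub>B\<^esub> x) \<ominus>\<^bsub>B\<^esub> s \<odot>\<^bsub>B\<^esub> (den b \<odot>\<^bsub>B\<^esub> b \<ominus>\<^bsub>B\<^esub> num b \<odot>\<^bsub>B\<^esub> x) =
        (s \<otimes> num b \<ominus> den b \<otimes> r) \<odot>\<^bsub>B\<^esub> x"
    proof -
      have "den b \<odot>\<^bsub>B\<^esub> (s \<odot>\<^bsub>B\<^esub> b) = s \<odot>\<^bsub>B\<^esub> (den b \<odot>\<^bsub>B\<^esub> b)"
        using b s d by (simp add: smult_assoc1[symmetric] m_comm)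
      then show ?thesis
        using b s r d x(1)
        by (simp add: a_minus_def smult_r_distr smult_r_minus smult_l_distr smult_l_minus
            smult_assoc1 M.minus_add M.a_ac M.r_neg2 M.r_neg1 M.r_neg M.l_neg)
    qed
    finally have "s \<otimes> num b \<ominus> den b \<otimes> r = \<zero>"
      using Mx[of "s \<otimes> num b \<ominus> den b \<otimes> r"] s r d by auto
    then have eq: "s \<otimes> num b = den b \<otimes> r"
      using s r d by (simp add: r_right_minus_eq)
    have "\<iota> s * \<psi> b = \<iota> (s \<otimes> num b) * q (den b)"
      using s d by (simp add: \<psi>_def emb_mult mult.assoc)
    also have "\<dots> = \<iota> r * (\<iota> (den b) * q (den b))"
      unfolding eq using r d by (simp add: emb_mult ac_simps)
    also have "\<dots> = \<iota> r" using q[OF d(1,3)] r by (simp add: mult.commute[of _ "\<iota> \<one>"])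
    finally show ?thesis .
  qed
  have val: "\<iota> \<one> * \<psi> b = \<psi> b" if "b \<in> carrier B" for b
    using dn[OF that] by (simp add: \<psi>_def mult.assoc[symmetric])
  have chard: "\<psi> b = \<iota> r * k"
    if b: "b \<in> carrier B" and s: "s \<in> carrier R" "s \<noteq> \<zero>" and r: "r \<in> carrier R" and k: "\<iota> s * k = \<iota> \<one>"
      and m: "s \<odot>\<^bsub>B\<^esub> b \<ominus>\<^bsub>B\<^esub> r \<odot>\<^bsub>B\<^esub> x \<in> M" for b s r k
  proof -
    have "\<psi> b = (\<iota> s * k) * \<psi> b" using val[OF b] k by simp
    also have "\<dots> = (\<iota> s * \<psi> b) * k" by (simp add: ac_simps)
    finally show ?thesis using char[OF b s(1) r m] by simp
  qed
  have Msubs: "\<And>n. n \<in> M \<Longrightarrow> n \<in> carrier B" using submodule_subset[OF M(1)] by auto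
  have "lin \<psi>"
  proof (rule linI)
    fix y z assume y: "y \<in> carrier B" and z: "z \<in> carrier B"
    note dy = dn[OF y] and dz = dn[OF z]
    let ?s = "den y \<otimes> den z" and ?r = "den z \<otimes> num y \<oplus> den y \<otimes> num z"
    have "den z \<odot>\<^bsub>B\<^esub> (den y \<odot>\<^bsub>B\<^esub> y \<ominus>\<^bsub>B\<^esub> num y \<odot>\<^bsub>B\<^esub> x) \<oplus>\<^bsub>B\<^esub> den y \<odot>\<^bsub>B\<^esub> (den z \<odot>\<^bsub>B\<^esub> z \<ominus>\<^bsub>B\<^esub> num z \<odot>\<^bsub>B\<^esub> x) \<in> M"
      using dy dz by (intro submodule_add[OF M(1)] submodule_smult[OF M(1)]) auto
    also have "den z \<odot>\<^bsub>B\<^esub> (den y \<odot>\<^bsub>B\<^esub> y \<ominus>\<^bsub>B\<^esub> num y \<odot>\<^bsub>B\<^esub> x) \<oplus>\<^bsub>B\<^esub> den y \<odot>\<^bsub>B\<^esub> (den z \<odot>\<^bsub>B\<^esub> z \<ominus>\<^bsub>B\<^esub> num z \<odot>\<^bsub>B\<^esub> x)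
        = ?s \<odot>\<^bsub>B\<^esub> (y \<oplus>\<^bsub>B\<^esub> z) \<ominus>\<^bsub>B\<^esub> ?r \<odot>\<^bsub>B\<^esub> x"
    proof -
      have "den z \<odot>\<^bsub>B\<^esub> (den y \<odot>\<^bsub>B\<^esub> y) = den y \<odot>\<^bsub>B\<^esub> (den z \<odot>\<^bsub>B\<^esub> y)"
        using y dy dz by (simp add: smult_assoc1[symmetric] m_comm)
      then show ?thesis
        using y z dy dz x(1)
        by (simp add: a_minus_def smult_r_distr smult_r_minus smult_l_distr smult_l_minus
            smult_assoc1 M.minus_add M.a_ac)
    qed
    finally have "\<iota> ?s * \<psi> (y \<oplus>\<^bsub>B\<^esub> z) = \<iota> ?r"
      using y z dy dz by (intro char) auto
    also have "\<dots> = \<iota> (den z) * (\<iota> (den y) * \<psi> y) + \<iota> (den y) * (\<iota> (den z) * \<psi> z)"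
    proof -
      have "\<iota> (den y) * \<psi> y = \<iota> (num y)" "\<iota> (den z) * \<psi> z = \<iota> (num z)"
        using char[of y "den y" "num y"] char[of z "den z" "num z"] y z dy dz by blast+
      then show ?thesis using dy dz by (simp only: emb_add emb_mult m_closed)
    qed
    also have "\<dots> = \<iota> ?s * (\<psi> y + \<psi> z)"
      using dy dz by (simp add: emb_mult distrib_left mult.assoc mult.left_commute)
    finally have "\<iota> ?s * (\<psi> (y \<oplus>\<^bsub>B\<^esub> z) - (\<psi> y + \<psi> z)) = 0"
      by (simp add: right_diff_distrib)
    moreover have "\<iota> \<one> * (\<psi> (y \<oplus>\<^bsub>B\<^esub> z) - (\<psi> y + \<psi> z)) = \<psi> (y \<oplus>\<^bsub>B\<^esub> z) - (\<psi> y + \<psi> z)"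
      using val[of "y \<oplus>\<^bsub>B\<^esub> z"] val[of y] val[of z] y z by (simp add: right_diff_distrib distrib_left)
    moreover have "?s \<in> carrier R" "?s \<noteq> \<zero>" using dy dz by (simp_all add: integral_iff)
    ultimately have "\<psi> (y \<oplus>\<^bsub>B\<^esub> z) - (\<psi> y + \<psi> z) = 0" using emb_cancel by blast
    then show "\<psi> (y \<oplus>\<^bsub>B\<^esub> z) = \<psi> y + \<psi> z" by simp
  next
    fix r y assume r: "r \<in> carrier R" and y: "y \<in> carrier B"
    note dy = dn[OF y]
    have "r \<odot>\<^bsub>B\<^esub> (den y \<odot>\<^bsub>B\<^esub> y \<ominus>\<^bsub>B\<^esub> num y \<odot>\<^bsub>B\<^esub> x) \<in> M"
      using dy r by (intro submodule_smult[OF M(1)]) auto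
    also have "r \<odot>\<^bsub>B\<^esub> (den y \<odot>\<^bsub>B\<^esub> y \<ominus>\<^bsub>B\<^esub> num y \<odot>\<^bsub>B\<^esub> x) = den y \<odot>\<^bsub>B\<^esub> (r \<odot>\<^bsub>B\<^esub> y) \<ominus>\<^bsub>B\<^esub> (r \<otimes> num y) \<odot>\<^bsub>B\<^esub> x"
    proof -
      have "r \<odot>\<^bsub>B\<^esub> (den y \<odot>\<^bsub>B\<^esub> y) = den y \<odot>\<^bsub>B\<^esub> (r \<odot>\<^bsub>B\<^esub> y)"
        using y dy r by (simp add: smult_assoc1[symmetric] m_comm)
      then show ?thesis
        using y r dy x(1) by (simp add: M.minus_eq smult_r_distr smult_r_minus smult_assoc1)
    qed
    finally have "\<iota> (den y) * \<psi> (r \<odot>\<^bsub>B\<^esub> y) = \<iota> (r \<otimes> num y)"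
      using y r dy by (intro char) auto
    then have "\<iota> (den y) * (\<psi> (r \<odot>\<^bsub>B\<^esub> y) - \<iota> r * \<psi> y) = 0"
      using char[of y "den y" "num y"] y r dy
      by (simp add: right_diff_distrib emb_mult mult.left_commute)
    moreover have "\<iota> \<one> * (\<psi> (r \<odot>\<^bsub>B\<^esub> y) - \<iota> r * \<psi> y) = \<psi> (r \<odot>\<^bsub>B\<^esub> y) - \<iota> r * \<psi> y"
      using val[of "r \<odot>\<^bsub>B\<^esub> y"] y r by (simp add: right_diff_distrib mult.assoc[symmetric])
    ultimately have "\<psi> (r \<odot>\<^bsub>B\<^esub> y) - \<iota> r * \<psi> y = 0" using emb_cancel dy by blast
    then show "\<psi> (r \<odot>\<^bsub>B\<^esub> y) = \<iota> r * \<psi> y" by simp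
  qed
  moreover have "\<psi> n = 0" if n: "n \<in> N" for n
  proof -
    have "n \<in> M" using M(2) n by auto
    then have "\<one> \<odot>\<^bsub>B\<^esub> n \<ominus>\<^bsub>B\<^esub> \<zero> \<odot>\<^bsub>B\<^esub> x \<in> M" using Msubs x(1) submodule_minus[OF M(1) _ submodule_zero[OF M(1)], of n] by simp
    then have "\<iota> \<one> * \<psi> n = \<iota> \<zero>" using Msubs \<open>n \<in> M\<close> by (intro char) auto
    then show ?thesis using val[of n] Msubs \<open>n \<in> M\<close> by simp
  qed
  moreover have "\<psi> x = \<iota> \<one>"
  proof -
    have "\<one> \<odot>\<^bsub>B\<^esub> x \<ominus>\<^bsub>B\<^esub> \<one> \<odot>\<^bsub>B\<^esub> x \<in> M"
      using x submodule_zero[OF M(1)] by (simp add: M.minus_eq M.r_neg)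
    then have "\<iota> \<one> * \<psi> x = \<iota> \<one>" using x by (intro char) auto
    then show ?thesis using val[of x] x by simp
  qed
  ultimately show ?thesis using that by blast
qed

text \<open>Identities between Sweedler sums in \<open>B\<close> are proved by applying functionals, which turns them into
  identities between multilinear forms.\<close>

lemma eq_by_functionals:
  assumes "x \<in> carrier B" "y \<in> carrier B" "\<And>\<psi>. lin \<psi> \<Longrightarrow> \<psi> x = \<psi> y"
  shows "x = y"
proof (rule ccontr)
  assume "x \<noteq> y"
  moreover have "x = (x \<ominus>\<^bsub>B\<^esub> y) \<oplus>\<^bsub>B\<^esub> y"
    using assms by (simp add: M.minus_eq M.a_assoc M.l_neg)
  ultimately have ne: "x \<ominus>\<^bsub>B\<^esub> y \<noteq> \<zero>\<^bsub>B\<^esub>" using assms by auto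
  have "r \<odot>\<^bsub>B\<^esub> (x \<ominus>\<^bsub>B\<^esub> y) \<notin> {\<zero>\<^bsub>B\<^esub>}" if "r \<in> carrier R" "r \<noteq> \<zero>" for r
    using torsion_free that ne assms(1,2) M.minus_closed unfolding torsion_free_def by blast
  then obtain \<psi> where "lin \<psi>" "\<psi> (x \<ominus>\<^bsub>B\<^esub> y) = \<iota> \<one>"
    using functional_separating[OF submodule_zero_set, of "x \<ominus>\<^bsub>B\<^esub> y"] assms by (metis M.minus_closed)
  moreover have "\<iota> \<one> \<noteq> 0" using emb_inj[of \<one>] one_not_zero by auto
  ultimately show False using assms(1,2) assms(3)[of \<psi>] lin_minus[of \<psi> x y] by simp
qed

lemma lin_submodule:
  assumes "\<And>i. i \<in> J \<Longrightarrow> lin (\<phi> i)"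
  shows "submodule {b \<in> carrier B. \<forall>i\<in>J. \<phi> i b = 0} R B"
  by (rule submodule_if_closed) (auto simp: assms lin_zero lin_add lin_smult)

text \<open>Finite generation of \<open>A\<close> from the point of view of \<open>B\<close>: the submodules \<open>N\<close> that will be tested, such as
  kernels of functionals on \<open>B\<close>, are not contained in \<open>A\<close>.\<close>

definition generated_by :: "'c set \<Rightarrow> 'c set \<Rightarrow> bool" where
  "generated_by X A \<longleftrightarrow> finite X \<and> X \<subseteq> A \<and> A \<subseteq> carrier B \<and>
     (\<forall>N. submodule N R B \<longrightarrow> X \<subseteq> N \<longrightarrow> A \<subseteq> N)"

lemma finitely_generated_generated_by:
  assumes A: "submodule A R B" and fg: "finitely_generated_module R (B\<lparr>carrier := A\<rparr>)"
  obtains X where "generated_by X A"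
proof -
  interpret A: module R "B\<lparr>carrier := A\<rparr>"
    using submodule.submodule_is_module[OF A] module_axioms by blast
  obtain X where X: "X \<subseteq> A" "finite X" "module_span R (B\<lparr>carrier := A\<rparr>) X = A"
    using fg by (auto simp: finitely_generated_module_def)
  have "A \<subseteq> N" if N: "submodule N R B" "X \<subseteq> N" for N
  proof -
    have "submodule (N \<inter> A) R (B\<lparr>carrier := A\<rparr>)"
    proof (rule A.submodule_if_closed)
    qed (use submodule_zero[OF N(1)] submodule_zero[OF A] submodule_add[OF N(1)] submodule_add[OF A]
          submodule_smult[OF N(1)] submodule_smult[OF A] in auto)
    then have "module_span R (B\<lparr>carrier := A\<rparr>) X \<subseteq> N \<inter> A"
      using N(2) X(1) by (auto simp: module_span_def)
    then show ?thesis using X(3) by auto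
  qed
  then show ?thesis
    using that[of X] X submodule_subset[OF A] by (auto simp: generated_by_def)
qed

lemma lin_dual_defect:
  assumes "\<And>e. e \<in> E \<Longrightarrow> lin (f e)" "lin \<beta>"
  shows "lin (\<lambda>b. \<beta> b - (\<Sum>e\<in>E. f e b * \<beta> e))"
proof (rule linI)
  fix y z assume yz: "y \<in> carrier B" "z \<in> carrier B"
  have "(\<Sum>e\<in>E. f e (y \<oplus>\<^bsub>B\<^esub> z) * \<beta> e) = (\<Sum>e\<in>E. f e y * \<beta> e) + (\<Sum>e\<in>E. f e z * \<beta> e)"
    unfolding sum.distrib[symmetric] using yz assms(1) by (intro sum.cong) (auto simp: lin_add distrib_right)
  then show "\<beta> (y \<oplus>\<^bsub>B\<^esub> z) - (\<Sum>e\<in>E. f e (y \<oplus>\<^bsub>B\<^esub> z) * \<beta> e) =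
      \<beta> y - (\<Sum>e\<in>E. f e y * \<beta> e) + (\<beta> z - (\<Sum>e\<in>E. f e z * \<beta> e))"
    using yz assms(2) by (simp add: lin_add)
next
  fix r y assume ry: "r \<in> carrier R" "y \<in> carrier B"
  have "(\<Sum>e\<in>E. f e (r \<odot>\<^bsub>B\<^esub> y) * \<beta> e) = \<iota> r * (\<Sum>e\<in>E. f e y * \<beta> e)"
    unfolding sum_distrib_left using ry assms(1) by (intro sum.cong) (auto simp: lin_smult mult.assoc)
  then show "\<beta> (r \<odot>\<^bsub>B\<^esub> y) - (\<Sum>e\<in>E. f e (r \<odot>\<^bsub>B\<^esub> y) * \<beta> e) = \<iota> r * (\<beta> y - (\<Sum>e\<in>E. f e y * \<beta> e))"
    using ry assms(2) by (simp add: lin_smult right_diff_distrib)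
qed

text \<open>The elements of \<open>X\<close> are added one by one. A new \<open>x\<close> either has a nonzero multiple for which the formula
  already holds, and then the formula holds for \<open>x\<close> by cancelling in \<open>K\<close>; or a functional separates \<open>x\<close>
  from all elements for which it holds, and \<open>x\<close> with this functional enlarges the basis.\<close>

lemma dual_basis_on_finite_set:
  assumes "finite X" "X \<subseteq> carrier B"
  shows "\<exists>E f. finite E \<and> E \<subseteq> X \<and> (\<forall>e\<in>E. lin (f e)) \<and>
    (\<forall>\<beta> x. lin \<beta> \<longrightarrow> x \<in> X \<longrightarrow> \<beta> x = (\<Sum>e\<in>E. f e x * \<beta> e))"
  using assms
proof (induction X rule: finite_induct)
  case empty
  show ?case by (rule exI[of _ "{}"]) auto
next
  case (insert x X)
  then obtain E f where E: "finite E" "E \<subseteq> X" and f': "\<forall>e\<in>E. lin (f e)"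
    and dual': "\<forall>\<beta> y. lin \<beta> \<longrightarrow> y \<in> X \<longrightarrow> \<beta> y = (\<Sum>e\<in>E. f e y * \<beta> e)"
    by auto
  note f = f'[rule_format] and dual = dual'[rule_format]
  have x: "x \<in> carrier B" and EB: "E \<subseteq> carrier B" using insert E by auto
  have linsum: "lin (\<lambda>b. \<beta> b - (\<Sum>e\<in>E. f e b * \<beta> e))" if "lin \<beta>" for \<beta>
    using f that by (rule lin_dual_defect)
  define N where "N = {b \<in> carrier B. \<forall>\<beta>\<in>{\<beta>. lin \<beta>}. \<beta> b - (\<Sum>e\<in>E. f e b * \<beta> e) = 0}"
  have N: "submodule N R B" unfolding N_def
    by (rule lin_submodule[where \<phi>="\<lambda>\<beta> b. \<beta> b - (\<Sum>e\<in>E. f e b * \<beta> e)"]) (use linsum in auto)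
  have XN: "X \<subseteq> N"
  proof
    fix y assume "y \<in> X"
    then show "y \<in> N" using insert.prems dual by (auto simp: N_def simp flip: dual)
  qed
  show ?case
  proof (cases "\<exists>r\<in>carrier R. r \<noteq> \<zero> \<and> r \<odot>\<^bsub>B\<^esub> x \<in> N")
    case True
    then obtain r where r: "r \<in> carrier R" "r \<noteq> \<zero>" "r \<odot>\<^bsub>B\<^esub> x \<in> N" by blast
    have "\<beta> x = (\<Sum>e\<in>E. f e x * \<beta> e)" if \<beta>: "lin \<beta>" for \<beta>
    proof -
      have "\<iota> r * (\<beta> x - (\<Sum>e\<in>E. f e x * \<beta> e)) = 0"
        using r \<beta> lin_smult[OF linsum[OF \<beta>] r(1) x] by (auto simp: N_def)
      moreover have "\<iota> \<one> * (\<beta> x - (\<Sum>e\<in>E. f e x * \<beta> e)) = \<beta> x - (\<Sum>e\<in>E. f e x * \<beta> e)"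
        using lin_value[OF linsum[OF \<beta>] x] .
      ultimately have "\<beta> x - (\<Sum>e\<in>E. f e x * \<beta> e) = 0" using emb_cancel r by blast
      then show ?thesis by simp
    qed
    then show ?thesis
      using E f dual by (intro exI[of _ E] exI[of _ f]) auto
  next
    case False
    then obtain \<psi> where \<psi>: "lin \<psi>" "\<And>n. n \<in> N \<Longrightarrow> \<psi> n = 0" "\<psi> x = \<iota> \<one>"
      using functional_separating[OF N x] by metis
    define g where "g e = (if e = x then \<psi> else (\<lambda>b. f e b - f e x * \<psi> b))" for e
    have xE: "x \<notin> E" using insert.hyps E by auto
    have "lin (g e)" if "e \<in> insert x E" for e
      using that \<psi>(1) f by (auto simp: g_def lin_def algebra_simps)
    moreover have "\<beta> y = (\<Sum>e\<in>insert x E. g e y * \<beta> e)" if \<beta>: "lin \<beta>" and y: "y \<in> insert x X" for \<beta> y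
    proof -
      have s: "(\<Sum>e\<in>insert x E. g e y * \<beta> e) = \<psi> y * \<beta> x + (\<Sum>e\<in>E. (f e y - f e x * \<psi> y) * \<beta> e)"
        using xE E(1) by (simp add: g_def) (rule sum.cong, auto)
      show ?thesis
      proof (cases "y = x")
        case True
        have "(\<Sum>e\<in>E. (f e x - f e x * \<iota> \<one>) * \<beta> e) = 0"
          using f x by (intro sum.neutral) (auto simp: lin_value mult.commute[of _ "\<iota> \<one>"])
        then show ?thesis unfolding s using True \<psi>(3) \<beta> x by (simp add: lin_value)
      next
        case False
        then have "y \<in> X" using y by auto
        then show ?thesis unfolding s using \<psi>(2) XN dual[OF \<beta>] by auto
      qed
    qed
    ultimately show ?thesis
      using E by (intro exI[of _ "insert x E"] exI[of _ g]) auto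
  qed
qed

text \<open>\<open>E\<close> is a basis of \<open>A \<otimes> K\<close> and the \<open>f e\<close> are its coordinate functions, extended to \<open>B\<close>. The traces of
  endomorphisms of \<open>A\<close> that produce the integrals of \<open>A\<close> will be taken in this basis.\<close>

lemma dual_basis:
  assumes "generated_by X A"
  obtains E f where "finite E" "E \<subseteq> A" "\<And>e. e \<in> E \<Longrightarrow> lin (f e)"
    "\<And>\<beta> a. lin \<beta> \<Longrightarrow> a \<in> A \<Longrightarrow> \<beta> a = (\<Sum>e\<in>E. f e a * \<beta> e)"
proof -
  have X: "finite X" "X \<subseteq> A" "X \<subseteq> carrier B" "A \<subseteq> carrier B"
    and gen: "\<And>N. submodule N R B \<Longrightarrow> X \<subseteq> N \<Longrightarrow> A \<subseteq> N"
    using assms by (auto simp: generated_by_def)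
  obtain E f where E: "finite E" "E \<subseteq> X" "\<forall>e\<in>E. lin (f e)"
    and dual: "\<forall>\<beta> x. lin \<beta> \<longrightarrow> x \<in> X \<longrightarrow> \<beta> x = (\<Sum>e\<in>E. f e x * \<beta> e)"
    using dual_basis_on_finite_set[OF X(1,3)] by blast
  have "\<beta> a = (\<Sum>e\<in>E. f e a * \<beta> e)" if \<beta>: "lin \<beta>" and a: "a \<in> A" for \<beta> a
  proof -
    let ?h = "\<lambda>b. \<beta> b - (\<Sum>e\<in>E. f e b * \<beta> e)"
    have "lin ?h"
      using E(3) \<beta> by (intro lin_dual_defect) auto
    then have "submodule {b \<in> carrier B. \<forall>i\<in>{()}. ?h b = 0} R B"
      by (intro lin_submodule) auto
    moreover have "X \<subseteq> {b \<in> carrier B. \<forall>i\<in>{()}. ?h b = 0}"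
      using dual \<beta> X(3) by force
    ultimately show ?thesis using gen a by fastforce
  qed
  then show ?thesis using that[of E f] E X by auto
qed

lemma generated_common_denominator:
  assumes "generated_by X A" "finite J" "\<And>i. i \<in> J \<Longrightarrow> lin (\<phi> i)"
  obtains d where "d \<in> carrier R" "d \<noteq> \<zero>"
    "\<And>i a. i \<in> J \<Longrightarrow> a \<in> A \<Longrightarrow> \<exists>r\<in>carrier R. \<iota> d * \<phi> i a = \<iota> r"
proof -
  have X: "finite X" "X \<subseteq> A" "X \<subseteq> carrier B" "A \<subseteq> carrier B"
    and gen: "\<And>N. submodule N R B \<Longrightarrow> X \<subseteq> N \<Longrightarrow> A \<subseteq> N"
    using assms by (auto simp: generated_by_def)
  have "finite ((\<lambda>(i, x). \<phi> i x) ` (J \<times> X))" using X assms by auto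
  from finite_common_denominator[OF this] obtain d where d: "d \<in> carrier R" "d \<noteq> \<zero>"
    "\<And>i x. i \<in> J \<Longrightarrow> x \<in> X \<Longrightarrow> \<exists>r\<in>carrier R. \<iota> d * \<phi> i x = \<iota> r"
    by force
  let ?N = "{b \<in> carrier B. \<forall>i\<in>J. \<exists>r\<in>carrier R. \<iota> d * \<phi> i b = \<iota> r}"
  have "submodule ?N R B"
  proof (rule submodule_if_closed)
    show "\<zero>\<^bsub>B\<^esub> \<in> ?N"
      using assms(3) by (auto simp: lin_zero intro!: bexI[of _ \<zero>])
    show "a \<oplus>\<^bsub>B\<^esub> b \<in> ?N" if ab: "a \<in> ?N" "b \<in> ?N" for a b
    proof -
      have "\<exists>r\<in>carrier R. \<iota> d * \<phi> i (a \<oplus>\<^bsub>B\<^esub> b) = \<iota> r" if i: "i \<in> J" for i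
      proof -
        obtain r s where "r \<in> carrier R" "\<iota> d * \<phi> i a = \<iota> r" "s \<in> carrier R" "\<iota> d * \<phi> i b = \<iota> s"
          using ab i by blast
        then show ?thesis using ab lin_add[OF assms(3)[OF i]]
          by (intro bexI[of _ "r \<oplus> s"]) (auto simp: emb_add distrib_left)
      qed
      then show ?thesis using ab by auto
    qed
    show "c \<odot>\<^bsub>B\<^esub> a \<in> ?N" if ca: "c \<in> carrier R" "a \<in> ?N" for c a
    proof -
      have "\<exists>r\<in>carrier R. \<iota> d * \<phi> i (c \<odot>\<^bsub>B\<^esub> a) = \<iota> r" if i: "i \<in> J" for i
      proof -
        obtain r where "r \<in> carrier R" "\<iota> d * \<phi> i a = \<iota> r" using ca i by blast
        then show ?thesis using ca lin_smult[OF assms(3)[OF i]]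
          by (intro bexI[of _ "c \<otimes> r"]) (auto simp: emb_mult mult.left_commute)
      qed
      then show ?thesis using ca by auto
    qed
  qed auto
  moreover have "X \<subseteq> ?N" using X d by auto
  ultimately have "A \<subseteq> ?N" by (rule gen)
  then show ?thesis using that[of d] d by blast
qed

end

section \<open>Sweedler calculus with multilinear forms\<close>

named_theorems lin_intros

text \<open>The list \<open>cop b\<close> stands for a representation of \<open>\<Delta> b\<close> as a sum of pure tensors, so that \<open>D \<beta> b\<close> is the
  Sweedler sum \<open>\<Sum> \<beta> b\<^sub>1 b\<^sub>2\<close>. Iterated coproducts are nested \<open>D\<close>'s, and a computation in Sweedler notation
  becomes rewriting inside \<open>D\<close>.\<close>

locale coproduct_data = torsion_free_module R B \<iota> + B: ring B
  for R :: "('r, 'x) ring_scheme" (structure) and B :: "('r, 'b, 'y) module_scheme" (structure)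
    and \<iota> :: "'r \<Rightarrow> 'k :: comm_ring" +
  fixes cop :: "'b \<Rightarrow> ('b \<times> 'b) list" and \<epsilon> :: "'b \<Rightarrow> 'r" and S :: "'b \<Rightarrow> 'b"
begin

abbreviation mul (infixl "\<star>" 70) where "x \<star> y \<equiv> x \<otimes>\<^bsub>B\<^esub> y"
abbreviation eps :: "'b \<Rightarrow> 'k" where "eps x \<equiv> \<iota> (\<epsilon> x)"

definition bilin :: "('b \<Rightarrow> 'b \<Rightarrow> 'k) \<Rightarrow> bool" where
  "bilin \<beta> \<longleftrightarrow> (\<forall>x\<in>carrier B. lin (\<beta> x)) \<and> (\<forall>y\<in>carrier B. lin (\<lambda>x. \<beta> x y))"

definition trilin :: "('b \<Rightarrow> 'b \<Rightarrow> 'b \<Rightarrow> 'k) \<Rightarrow> bool" where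
  "trilin \<beta> \<longleftrightarrow> (\<forall>x\<in>carrier B. \<forall>y\<in>carrier B.
     lin (\<lambda>z. \<beta> x y z) \<and> lin (\<lambda>z. \<beta> x z y) \<and> lin (\<lambda>z. \<beta> z x y))"

definition linear_endo :: "('b \<Rightarrow> 'b) \<Rightarrow> bool" where
  "linear_endo f \<longleftrightarrow> f \<in> carrier B \<rightarrow> carrier B \<and>
     (\<forall>x\<in>carrier B. \<forall>y\<in>carrier B. f (x \<oplus>\<^bsub>B\<^esub> y) = f x \<oplus>\<^bsub>B\<^esub> f y) \<and>
     (\<forall>r\<in>carrier R. \<forall>x\<in>carrier B. f (r \<odot>\<^bsub>B\<^esub> x) = r \<odot>\<^bsub>B\<^esub> f x)"

definition D :: "('b \<Rightarrow> 'b \<Rightarrow> 'k) \<Rightarrow> 'b \<Rightarrow> 'k" where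
  "D \<beta> b = (\<Sum>(x, y)\<leftarrow>cop b. \<beta> x y)"

lemma bilinI [lin_intros]:
  assumes "\<And>x. x \<in> carrier B \<Longrightarrow> lin (\<lambda>y. \<beta> x y)" "\<And>y. y \<in> carrier B \<Longrightarrow> lin (\<lambda>x. \<beta> x y)"
  shows "bilin \<beta>"
  using assms by (simp add: bilin_def)

lemma trilinI [lin_intros]:
  assumes "\<And>x y. x \<in> carrier B \<Longrightarrow> y \<in> carrier B \<Longrightarrow> lin (\<lambda>z. \<beta> x y z)"
    "\<And>x y. x \<in> carrier B \<Longrightarrow> y \<in> carrier B \<Longrightarrow> lin (\<lambda>z. \<beta> x z y)"
    "\<And>x y. x \<in> carrier B \<Longrightarrow> y \<in> carrier B \<Longrightarrow> lin (\<lambda>z. \<beta> z x y)"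
  shows "trilin \<beta>"
  using assms by (simp add: trilin_def)

lemma lin_comp: "lin \<psi> \<Longrightarrow> linear_endo f \<Longrightarrow> lin (\<lambda>x. \<psi> (f x))"
  by (auto simp: lin_def linear_endo_def Pi_iff)

lemma bilin_comp_left: "bilin \<beta> \<Longrightarrow> y \<in> carrier B \<Longrightarrow> linear_endo f \<Longrightarrow> lin (\<lambda>x. \<beta> (f x) y)"
  unfolding bilin_def using lin_comp[of "\<lambda>x. \<beta> x y" f] by auto

lemma bilin_comp_right: "bilin \<beta> \<Longrightarrow> y \<in> carrier B \<Longrightarrow> linear_endo f \<Longrightarrow> lin (\<lambda>x. \<beta> y (f x))"
  unfolding bilin_def using lin_comp[of "\<beta> y" f] by auto

lemma lin_const_mult [lin_intros]: "lin \<psi> \<Longrightarrow> lin (\<lambda>x. k * \<psi> x)"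
  and lin_mult_const [lin_intros]: "lin \<psi> \<Longrightarrow> lin (\<lambda>x. \<psi> x * k)"
  by (auto simp: lin_def distrib_left distrib_right mult.assoc mult.left_commute)

lemma lin_sum [lin_intros]: "(\<And>i. i \<in> J \<Longrightarrow> lin (\<psi> i)) \<Longrightarrow> lin (\<lambda>x. \<Sum>i\<in>J. \<psi> i x)"
  by (auto simp: lin_def sum.distrib sum_distrib_left intro!: sum.cong)

lemma linear_endo_id [lin_intros]: "linear_endo (\<lambda>x. x)"
  by (auto simp: linear_endo_def)

lemma sum_list_smult: "(\<Sum>p\<leftarrow>xs. k * f p) = k * (\<Sum>p\<leftarrow>xs. f p)" for k :: 'k
  by (induction xs) (auto simp: distrib_left)

lemma D_const_mult: "D (\<lambda>x y. k * \<beta> x y) b = k * D \<beta> b"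
  by (simp add: D_def case_prod_unfold sum_list_smult)

lemma D_mult_const: "D (\<lambda>x y. \<beta> x y * k) b = D \<beta> b * k"
  using D_const_mult[of k \<beta> b] by (simp add: mult.commute)

lemma D_add: "D (\<lambda>x y. \<beta> x y + \<gamma> x y) b = D \<beta> b + D \<gamma> b"
  by (simp add: D_def case_prod_unfold sum_list_addf)

lemma D_zero: "D (\<lambda>x y. 0) b = 0"
  by (simp add: D_def case_prod_unfold)

lemma D_sum: "D (\<lambda>x y. \<Sum>i\<in>J. \<beta> i x y) b = (\<Sum>i\<in>J. D (\<beta> i) b)"
  by (induction J rule: infinite_finite_induct) (simp_all add: D_zero D_add)

lemma D_swap: "D (\<lambda>x y. D (\<lambda>u v. \<beta> x y u v) c) b = D (\<lambda>u v. D (\<lambda>x y. \<beta> x y u v) b) c"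
proof -
  have "(\<Sum>p\<leftarrow>xs. \<Sum>q\<leftarrow>ys. f p q) = (\<Sum>q\<leftarrow>ys. \<Sum>p\<leftarrow>xs. f p q)"
    for xs :: "('b \<times> 'b) list" and ys :: "('b \<times> 'b) list" and f :: "_ \<Rightarrow> _ \<Rightarrow> 'k"
    by (induction xs) (simp_all add: sum_list_addf)
  then show ?thesis by (simp add: D_def case_prod_unfold)
qed

text \<open>The Sweedler sum as an element of \<open>B\<close>. It serves for membership in a submodule whose quotient may have
  torsion: functionals do not detect it.\<close>

definition DB :: "('b \<Rightarrow> 'b \<Rightarrow> 'b) \<Rightarrow> 'b \<Rightarrow> 'b" where
  "DB h b = msum B (map (\<lambda>(x, y). h x y) (cop b))"

lemma msum_in:
  assumes "\<zero>\<^bsub>B\<^esub> \<in> N" "\<And>x y. x \<in> N \<Longrightarrow> y \<in> N \<Longrightarrow> x \<oplus>\<^bsub>B\<^esub> y \<in> N" "set xs \<subseteq> N"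
  shows "msum B xs \<in> N"
  using assms(3) by (induction xs) (auto intro: assms)

lemma lin_msum: "lin \<psi> \<Longrightarrow> set xs \<subseteq> carrier B \<Longrightarrow> \<psi> (msum B xs) = (\<Sum>x\<leftarrow>xs. \<psi> x)"
  by (induction xs) (auto simp: lin_zero lin_add)

end

text \<open>The axioms of a Hopf algebra as they appear to \<open>K\<close>-valued multilinear forms. They are symmetric under
  reversing the multiplication and the comultiplication at the same time.\<close>

locale hopf_calculus = coproduct_data R B \<iota> cop \<epsilon> S
  for R :: "('r, 'x) ring_scheme" (structure) and B :: "('r, 'b, 'y) module_scheme" (structure)
    and \<iota> :: "'r \<Rightarrow> 'k :: comm_ring" and cop \<epsilon> S +
  assumes cop_closed: "\<lbrakk> b \<in> carrier B; (x, y) \<in> set (cop b) \<rbrakk> \<Longrightarrow> x \<in> carrier B \<and> y \<in> carrier B"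
    and lin_D: "bilin \<beta> \<Longrightarrow> lin (D \<beta>)"
    and coassoc: "\<lbrakk> trilin \<gamma>; b \<in> carrier B \<rbrakk> \<Longrightarrow>
      D (\<lambda>w z. D (\<lambda>x y. \<gamma> x y z) w) b = D (\<lambda>x w. D (\<lambda>y z. \<gamma> x y z) w) b"
    and counit_left: "\<lbrakk> lin \<psi>; b \<in> carrier B \<rbrakk> \<Longrightarrow> D (\<lambda>x y. eps x * \<psi> y) b = \<psi> b"
    and counit_right: "\<lbrakk> lin \<psi>; b \<in> carrier B \<rbrakk> \<Longrightarrow> D (\<lambda>x y. eps y * \<psi> x) b = \<psi> b"
    and D_mult: "\<lbrakk> bilin \<beta>; b \<in> carrier B; c \<in> carrier B \<rbrakk> \<Longrightarrow>
      D \<beta> (b \<star> c) = D (\<lambda>x y. D (\<lambda>u v. \<beta> (x \<star> u) (y \<star> v)) c) b"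
    and D_one: "bilin \<beta> \<Longrightarrow> D \<beta> \<one>\<^bsub>B\<^esub> = \<beta> \<one>\<^bsub>B\<^esub> \<one>\<^bsub>B\<^esub>"
    and counit_closed [simp]: "b \<in> carrier B \<Longrightarrow> \<epsilon> b \<in> carrier R"
    and lin_eps: "lin (\<lambda>x. \<iota> (\<epsilon> x))"
    and counit_mult: "\<lbrakk> b \<in> carrier B; c \<in> carrier B \<rbrakk> \<Longrightarrow> \<epsilon> (b \<star> c) = \<epsilon> b \<otimes> \<epsilon> c"
    and counit_one [simp]: "\<epsilon> \<one>\<^bsub>B\<^esub> = \<one>"
    and linear_endo_S0: "linear_endo S"
    and antipode_left: "\<lbrakk> lin \<psi>; b \<in> carrier B \<rbrakk> \<Longrightarrow> D (\<lambda>x y. \<psi> (S x \<star> y)) b = eps b * \<psi> \<one>\<^bsub>B\<^esub>"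
    and antipode_right: "\<lbrakk> lin \<psi>; b \<in> carrier B \<rbrakk> \<Longrightarrow> D (\<lambda>x y. \<psi> (x \<star> S y)) b = eps b * \<psi> \<one>\<^bsub>B\<^esub>"
    and smult_mult_left: "\<lbrakk> r \<in> carrier R; x \<in> carrier B; y \<in> carrier B \<rbrakk> \<Longrightarrow>
      (r \<odot>\<^bsub>B\<^esub> x) \<star> y = r \<odot>\<^bsub>B\<^esub> (x \<star> y)"
    and smult_mult_right: "\<lbrakk> r \<in> carrier R; x \<in> carrier B; y \<in> carrier B \<rbrakk> \<Longrightarrow>
      x \<star> (r \<odot>\<^bsub>B\<^esub> y) = r \<odot>\<^bsub>B\<^esub> (x \<star> y)"
begin

lemma S_closed [simp]: "x \<in> carrier B \<Longrightarrow> S x \<in> carrier B"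
  using linear_endo_S0 by (auto simp: linear_endo_def)

lemma linear_endo_S [lin_intros]: "linear_endo f \<Longrightarrow> linear_endo (\<lambda>x. S (f x))"
  using linear_endo_S0 by (auto simp: linear_endo_def Pi_iff)

lemma linear_endo_mult_left [lin_intros]: "linear_endo f \<Longrightarrow> a \<in> carrier B \<Longrightarrow> linear_endo (\<lambda>x. a \<star> f x)"
  by (auto simp: linear_endo_def Pi_iff smult_mult_right B.r_distr)

lemma linear_endo_mult_right [lin_intros]: "linear_endo f \<Longrightarrow> a \<in> carrier B \<Longrightarrow> linear_endo (\<lambda>x. f x \<star> a)"
  by (auto simp: linear_endo_def Pi_iff smult_mult_left B.l_distr)

lemma lin_D_comp [lin_intros]: "bilin \<beta> \<Longrightarrow> linear_endo f \<Longrightarrow> lin (\<lambda>x. D \<beta> (f x))"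
  by (rule lin_comp[OF lin_D])

lemma lin_sum_list:
  "(\<And>p. p \<in> set xs \<Longrightarrow> lin (\<lambda>x. \<psi> p x)) \<Longrightarrow> lin (\<lambda>x. \<Sum>p\<leftarrow>xs. \<psi> p x)"
proof (induction xs)
  case Nil
  then show ?case by (simp add: lin_def)
next
  case (Cons p xs)
  then have "lin (\<psi> p)" "lin (\<lambda>x. \<Sum>p\<leftarrow>xs. \<psi> p x)" by auto
  then show ?case by (simp add: lin_def distrib_left)
qed

lemma lin_D_inner [lin_intros]:
  assumes "\<And>u v. u \<in> carrier B \<Longrightarrow> v \<in> carrier B \<Longrightarrow> lin (\<lambda>x. \<beta> u v x)" "b \<in> carrier B"
  shows "lin (\<lambda>x. D (\<lambda>u v. \<beta> u v x) b)"
  unfolding D_def case_prod_unfold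
  by (rule lin_sum_list) (use assms cop_closed[OF assms(2)] in \<open>auto simp: prod_eq_iff\<close>)

lemma D_cong:
  assumes "\<And>x y. x \<in> carrier B \<Longrightarrow> y \<in> carrier B \<Longrightarrow> \<beta> x y = \<gamma> x y" "b \<in> carrier B"
  shows "D \<beta> b = D \<gamma> b"
  unfolding D_def
  by (rule arg_cong[where f=sum_list], rule map_cong) (use assms cop_closed[OF assms(2)] in auto)

lemma eps_mult: "b \<in> carrier B \<Longrightarrow> c \<in> carrier B \<Longrightarrow> eps (b \<star> c) = eps b * eps c"
  by (simp add: counit_mult emb_mult)

lemma antipode_one [simp]: "S \<one>\<^bsub>B\<^esub> = \<one>\<^bsub>B\<^esub>"
proof (rule eq_by_functionals)
  fix \<psi> assume \<psi>: "lin \<psi>"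
  have "\<psi> (S \<one>\<^bsub>B\<^esub>) = \<psi> (S \<one>\<^bsub>B\<^esub> \<star> \<one>\<^bsub>B\<^esub>)" by simp
  also have "\<dots> = D (\<lambda>x y. \<psi> (S x \<star> y)) \<one>\<^bsub>B\<^esub>"
    by (rule D_one[symmetric]) (intro lin_intros lin_comp[OF \<psi>]; simp)
  also have "\<dots> = \<psi> \<one>\<^bsub>B\<^esub>" using \<psi> by (simp add: antipode_left lin_value)
  finally show "\<psi> (S \<one>\<^bsub>B\<^esub>) = \<psi> \<one>\<^bsub>B\<^esub>" .
qed simp_all

text \<open>The sum \<open>\<Sum> S(b\<^sub>1 c\<^sub>1) b\<^sub>2 c\<^sub>2 S(c\<^sub>3) S(b\<^sub>3)\<close> collapses to \<open>S(b c)\<close> when the last four factors are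
  contracted first, and to \<open>S(c) S(b)\<close> when the first two are.\<close>

lemma antipode_mult:
  assumes b: "b \<in> carrier B" and c: "c \<in> carrier B"
  shows "S (b \<star> c) = S c \<star> S b"
proof (rule eq_by_functionals)
  fix \<psi> assume \<psi>: "lin \<psi>"
  define K where "K b1 b2 b3 c1 c2 c3 = \<psi> (S (b1 \<star> c1) \<star> (b2 \<star> c2) \<star> (S c3 \<star> S b3))"
    for b1 b2 b3 c1 c2 c3
  define X where "X = D (\<lambda>b1 b'. D (\<lambda>c1 c'. D (\<lambda>b2 b3. D (\<lambda>c2 c3. K b1 b2 b3 c1 c2 c3) c') b') c) b"
  have "X = D (\<lambda>b1 b'. D (\<lambda>c1 c'. D (\<lambda>b2 b3. eps c' * \<psi> (S (b1 \<star> c1) \<star> (b2 \<star> S b3))) b') c) b"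
    unfolding X_def K_def
  proof (intro D_cong b c)
    fix b1 b' c1 c' b2 b3
    assume [simp]: "b1 \<in> carrier B" "b' \<in> carrier B" "c1 \<in> carrier B" "c' \<in> carrier B"
      "b2 \<in> carrier B" "b3 \<in> carrier B"
    have "D (\<lambda>c2 c3. \<psi> (S (b1 \<star> c1) \<star> (b2 \<star> c2) \<star> (S c3 \<star> S b3))) c' =
        D (\<lambda>c2 c3. \<psi> (S (b1 \<star> c1) \<star> (b2 \<star> ((c2 \<star> S c3) \<star> S b3)))) c'"
      by (rule D_cong) (simp_all add: B.m_assoc)
    also have "\<dots> = eps c' * \<psi> (S (b1 \<star> c1) \<star> (b2 \<star> (\<one>\<^bsub>B\<^esub> \<star> S b3)))"
      by (rule antipode_right[where \<psi>="\<lambda>t. \<psi> (S (b1 \<star> c1) \<star> (b2 \<star> (t \<star> S b3)))"])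
        ((intro lin_intros lin_comp[OF \<psi>])?; simp)+
    finally show "D (\<lambda>c2 c3. \<psi> (S (b1 \<star> c1) \<star> (b2 \<star> c2) \<star> (S c3 \<star> S b3))) c' =
        eps c' * \<psi> (S (b1 \<star> c1) \<star> (b2 \<star> S b3))" by simp
  qed
  also have "\<dots> = D (\<lambda>b1 b'. D (\<lambda>c1 c'. eps c' * (eps b' * \<psi> (S (b1 \<star> c1)))) c) b"
  proof (intro D_cong b c)
    fix b1 b' c1 c'
    assume [simp]: "b1 \<in> carrier B" "b' \<in> carrier B" "c1 \<in> carrier B" "c' \<in> carrier B"
    have "D (\<lambda>b2 b3. \<psi> (S (b1 \<star> c1) \<star> (b2 \<star> S b3))) b' = eps b' * \<psi> (S (b1 \<star> c1) \<star> \<one>\<^bsub>B\<^esub>)"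
      by (rule antipode_right[where \<psi>="\<lambda>t. \<psi> (S (b1 \<star> c1) \<star> t)"])
        ((intro lin_intros lin_comp[OF \<psi>])?; simp)+
    then show "D (\<lambda>b2 b3. eps c' * \<psi> (S (b1 \<star> c1) \<star> (b2 \<star> S b3))) b' =
        eps c' * (eps b' * \<psi> (S (b1 \<star> c1)))" by (simp add: D_const_mult)
  qed
  also have "\<dots> = D (\<lambda>b1 b'. eps b' * \<psi> (S (b1 \<star> c))) b"
  proof (intro D_cong b)
    fix b1 b' assume [simp]: "b1 \<in> carrier B" "b' \<in> carrier B"
    show "D (\<lambda>c1 c'. eps c' * (eps b' * \<psi> (S (b1 \<star> c1)))) c = eps b' * \<psi> (S (b1 \<star> c))"
      by (rule counit_right[where \<psi>="\<lambda>t. eps b' * \<psi> (S (b1 \<star> t))"])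
        ((intro lin_intros lin_comp[OF \<psi>] c)?; simp)+
  qed
  also have "\<dots> = \<psi> (S (b \<star> c))"
    by (rule counit_right[where \<psi>="\<lambda>t. \<psi> (S (t \<star> c))"])
      (use b c in \<open>(intro lin_intros lin_comp[OF \<psi>])?; simp\<close>)+
  finally have X1: "X = \<psi> (S (b \<star> c))" .
  have K_lin: "lin (\<lambda>t. K t b2 b3 c1 c2 c3)" "lin (\<lambda>t. K b1 t b3 c1 c2 c3)" "lin (\<lambda>t. K b1 b2 t c1 c2 c3)"
    "lin (\<lambda>t. K b1 b2 b3 t c2 c3)" "lin (\<lambda>t. K b1 b2 b3 c1 t c3)" "lin (\<lambda>t. K b1 b2 b3 c1 c2 t)"
    if [simp]: "b1 \<in> carrier B" "b2 \<in> carrier B" "b3 \<in> carrier B" "c1 \<in> carrier B" "c2 \<in> carrier B" "c3 \<in> carrier B"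
    for b1 b2 b3 c1 c2 c3
    unfolding K_def by ((intro lin_intros lin_comp[OF \<psi>])?; simp)+
  have "X = D (\<lambda>b1 b'. D (\<lambda>b2 b3. D (\<lambda>c1 c'. D (\<lambda>c2 c3. K b1 b2 b3 c1 c2 c3) c') c) b') b"
    unfolding X_def by (intro D_cong b D_swap)
  also have "\<dots> = D (\<lambda>b' b3. D (\<lambda>b1 b2. D (\<lambda>c1 c'. D (\<lambda>c2 c3. K b1 b2 b3 c1 c2 c3) c') c) b') b"
    by (rule coassoc[symmetric]) ((intro lin_intros K_lin b c)?; simp)+
  also have "\<dots> = D (\<lambda>b' b3. D (\<lambda>b1 b2. D (\<lambda>c' c3. D (\<lambda>c1 c2. K b1 b2 b3 c1 c2 c3) c') c) b') b"
    by (intro D_cong b coassoc[symmetric]) ((intro lin_intros K_lin b c)?; simp)+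
  also have "\<dots> = D (\<lambda>b' b3. D (\<lambda>c' c3. D (\<lambda>b1 b2. D (\<lambda>c1 c2. K b1 b2 b3 c1 c2 c3) c') b') c) b"
    by (intro D_cong b D_swap)
  also have "\<dots> = D (\<lambda>b' b3. D (\<lambda>c' c3. eps b' * (eps c' * \<psi> (S c3 \<star> S b3))) c) b"
  proof (intro D_cong b c)
    fix b' b3 c' c3
    assume [simp]: "b' \<in> carrier B" "b3 \<in> carrier B" "c' \<in> carrier B" "c3 \<in> carrier B"
    have "D (\<lambda>b1 b2. D (\<lambda>c1 c2. K b1 b2 b3 c1 c2 c3) c') b' =
        D (\<lambda>x y. \<psi> (S x \<star> y \<star> (S c3 \<star> S b3))) (b' \<star> c')"
      unfolding K_def
      by (rule D_mult[symmetric]) ((intro lin_intros lin_comp[OF \<psi>])?; simp)+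
    also have "\<dots> = eps (b' \<star> c') * \<psi> (\<one>\<^bsub>B\<^esub> \<star> (S c3 \<star> S b3))"
      by (rule antipode_left[where \<psi>="\<lambda>t. \<psi> (t \<star> (S c3 \<star> S b3))"])
        ((intro lin_intros lin_comp[OF \<psi>])?; simp)+
    finally show "D (\<lambda>b1 b2. D (\<lambda>c1 c2. K b1 b2 b3 c1 c2 c3) c') b' = eps b' * (eps c' * \<psi> (S c3 \<star> S b3))"
      by (simp add: eps_mult mult.assoc)
  qed
  also have "\<dots> = D (\<lambda>b' b3. eps b' * \<psi> (S c \<star> S b3)) b"
  proof (intro D_cong b)
    fix b' b3
    assume [simp]: "b' \<in> carrier B" "b3 \<in> carrier B"
    have "D (\<lambda>c' c3. eps c' * \<psi> (S c3 \<star> S b3)) c = \<psi> (S c \<star> S b3)"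
      by (rule counit_left[where \<psi>="\<lambda>t. \<psi> (S t \<star> S b3)"]) ((intro lin_intros lin_comp[OF \<psi>] c)?; simp)+
    then show "D (\<lambda>c' c3. eps b' * (eps c' * \<psi> (S c3 \<star> S b3))) c = eps b' * \<psi> (S c \<star> S b3)"
      by (simp add: D_const_mult)
  qed
  also have "\<dots> = \<psi> (S c \<star> S b)"
    by (rule counit_left[where \<psi>="\<lambda>t. \<psi> (S c \<star> S t)"])
      (use b c in \<open>(intro lin_intros lin_comp[OF \<psi>])?; simp\<close>)+
  finally show "\<psi> (S (b \<star> c)) = \<psi> (S c \<star> S b)" using X1 by simp
qed (use b c in simp_all)

text \<open>The sum \<open>\<Sum> S(b\<^sub>1)\<^sub>1 b\<^sub>2 S(b\<^sub>5) \<otimes> S(b\<^sub>1)\<^sub>2 b\<^sub>3 S(b\<^sub>4)\<close> collapses to \<open>\<Delta>(S b)\<close> when \<open>b\<^sub>3 S(b\<^sub>4)\<close> and then \<open>b\<^sub>2 S(b\<^sub>5)\<close>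
  are contracted, and to \<open>\<Sum> S(b\<^sub>2) \<otimes> S(b\<^sub>1)\<close> when \<open>S(b\<^sub>1)\<close> is multiplied with \<open>\<Delta>(b\<^sub>2)\<close> first.\<close>

lemma antipode_comult:
  assumes \<beta>: "bilin \<beta>" and b: "b \<in> carrier B"
  shows "D \<beta> (S b) = D (\<lambda>x y. \<beta> (S y) (S x)) b"
proof -
  define N where "N b1 b2 b3 b4 b5 = D (\<lambda>s1 s2. \<beta> (s1 \<star> b2 \<star> S b5) (s2 \<star> b3 \<star> S b4)) (S b1)"
    for b1 b2 b3 b4 b5
  note \<beta>_intros = lin_intros bilin_comp_left[OF \<beta>] bilin_comp_right[OF \<beta>]
  have N_lin: "lin (\<lambda>t. N t b2 b3 b4 b5)" "lin (\<lambda>t. N b1 t b3 b4 b5)" "lin (\<lambda>t. N b1 b2 t b4 b5)"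
    "lin (\<lambda>t. N b1 b2 b3 t b5)" "lin (\<lambda>t. N b1 b2 b3 b4 t)"
    if [simp]: "b1 \<in> carrier B" "b2 \<in> carrier B" "b3 \<in> carrier B" "b4 \<in> carrier B" "b5 \<in> carrier B"
    for b1 b2 b3 b4 b5
    unfolding N_def by ((intro \<beta>_intros)?; simp)+
  define X where "X = D (\<lambda>p q. D (\<lambda>b4 b5. D (\<lambda>b1 r. D (\<lambda>b2 b3. N b1 b2 b3 b4 b5) r) p) q) b"
  have "X = D (\<lambda>p q. D (\<lambda>b4 b5. eps p * \<beta> (S b5) (S b4)) q) b"
    unfolding X_def
  proof (intro D_cong b)
    fix p q b4 b5
    assume [simp]: "p \<in> carrier B" "q \<in> carrier B" "b4 \<in> carrier B" "b5 \<in> carrier B"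
    let ?\<gamma> = "\<lambda>x y. \<beta> (x \<star> S b5) (y \<star> S b4)"
    have \<gamma>: "bilin ?\<gamma>" by (intro \<beta>_intros; simp)
    have "D (\<lambda>b1 r. D (\<lambda>b2 b3. N b1 b2 b3 b4 b5) r) p = D (\<lambda>b1 r. D ?\<gamma> (S b1 \<star> r)) p"
    proof (rule D_cong)
      fix b1 r assume [simp]: "b1 \<in> carrier B" "r \<in> carrier B"
      show "D (\<lambda>b2 b3. N b1 b2 b3 b4 b5) r = D ?\<gamma> (S b1 \<star> r)"
        unfolding N_def by (subst D_swap, rule D_mult[OF \<gamma>, symmetric]) simp_all
    qed simp
    also have "\<dots> = eps p * D ?\<gamma> \<one>\<^bsub>B\<^esub>"
      by (rule antipode_left[OF lin_D[OF \<gamma>]]) simp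
    also have "D ?\<gamma> \<one>\<^bsub>B\<^esub> = \<beta> (S b5) (S b4)"
      using D_one[OF \<gamma>] by simp
    finally show "D (\<lambda>b1 r. D (\<lambda>b2 b3. N b1 b2 b3 b4 b5) r) p = eps p * \<beta> (S b5) (S b4)" .
  qed
  also have "\<dots> = D (\<lambda>p q. eps p * D (\<lambda>b4 b5. \<beta> (S b5) (S b4)) q) b"
    by (simp add: D_const_mult)
  also have "\<dots> = D (\<lambda>b4 b5. \<beta> (S b5) (S b4)) b"
    by (rule counit_left) ((intro \<beta>_intros b)?; simp)+
  finally have X2: "X = D (\<lambda>x y. \<beta> (S y) (S x)) b" .
  have "X = D (\<lambda>p q. D (\<lambda>b1 r. D (\<lambda>b4 b5. D (\<lambda>b2 b3. N b1 b2 b3 b4 b5) r) q) p) b"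
    unfolding X_def by (intro D_cong b D_swap)
  also have "\<dots> = D (\<lambda>b1 w. D (\<lambda>r q. D (\<lambda>b4 b5. D (\<lambda>b2 b3. N b1 b2 b3 b4 b5) r) q) w) b"
    by (rule coassoc) ((intro lin_intros N_lin b)?; simp)+
  also have "\<dots> = D (\<lambda>b1 w. D (\<lambda>r q. D (\<lambda>b2 b3. D (\<lambda>b4 b5. N b1 b2 b3 b4 b5) q) r) w) b"
    by (intro D_cong b D_swap)
  also have "\<dots> = D (\<lambda>b1 w. D (\<lambda>b2 t. D (\<lambda>b3 q. D (\<lambda>b4 b5. N b1 b2 b3 b4 b5) q) t) w) b"
    by (intro D_cong b coassoc) ((intro lin_intros N_lin)?; simp)+
  also have "\<dots> = D (\<lambda>b1 w. D (\<lambda>b2 t. D (\<lambda>z b5. D (\<lambda>b3 b4. N b1 b2 b3 b4 b5) z) t) w) b"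
    by (intro D_cong b coassoc[symmetric]) ((intro lin_intros N_lin)?; simp)+
  also have "\<dots> = D (\<lambda>b1 w. D (\<lambda>v b5. D (\<lambda>b2 z. D (\<lambda>b3 b4. N b1 b2 b3 b4 b5) z) v) w) b"
    by (intro D_cong b coassoc[symmetric]) ((intro lin_intros N_lin)?; simp)+
  also have "\<dots> = D (\<lambda>b1 w. eps w * D \<beta> (S b1)) b"
  proof (intro D_cong b)
    fix b1 w assume [simp]: "b1 \<in> carrier B" "w \<in> carrier B"
    have "D (\<lambda>v b5. D (\<lambda>b2 z. D (\<lambda>b3 b4. N b1 b2 b3 b4 b5) z) v) w =
        D (\<lambda>v b5. D (\<lambda>b2 z. eps z * D (\<lambda>s1 s2. \<beta> (s1 \<star> b2 \<star> S b5) s2) (S b1)) v) w"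
    proof (intro D_cong)
      fix v b5 b2 z assume [simp]: "v \<in> carrier B" "b5 \<in> carrier B" "b2 \<in> carrier B" "z \<in> carrier B"
      have "D (\<lambda>b3 b4. N b1 b2 b3 b4 b5) z =
          D (\<lambda>b3 b4. D (\<lambda>s1 s2. \<beta> (s1 \<star> b2 \<star> S b5) (s2 \<star> (b3 \<star> S b4))) (S b1)) z"
        unfolding N_def by (intro D_cong) (simp_all add: B.m_assoc)
      also have "\<dots> = eps z * D (\<lambda>s1 s2. \<beta> (s1 \<star> b2 \<star> S b5) (s2 \<star> \<one>\<^bsub>B\<^esub>)) (S b1)"
        by (rule antipode_right[where \<psi>="\<lambda>t. D (\<lambda>s1 s2. \<beta> (s1 \<star> b2 \<star> S b5) (s2 \<star> t)) (S b1)"])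
          ((intro \<beta>_intros)?; simp)+
      also have "D (\<lambda>s1 s2. \<beta> (s1 \<star> b2 \<star> S b5) (s2 \<star> \<one>\<^bsub>B\<^esub>)) (S b1) =
          D (\<lambda>s1 s2. \<beta> (s1 \<star> b2 \<star> S b5) s2) (S b1)"
        by (rule D_cong) simp_all
      finally show "D (\<lambda>b3 b4. N b1 b2 b3 b4 b5) z =
          eps z * D (\<lambda>s1 s2. \<beta> (s1 \<star> b2 \<star> S b5) s2) (S b1)" .
    qed simp_all
    also have "\<dots> = D (\<lambda>v b5. D (\<lambda>s1 s2. \<beta> (s1 \<star> (v \<star> S b5)) s2) (S b1)) w"
    proof (intro D_cong)
      fix v b5 assume [simp]: "v \<in> carrier B" "b5 \<in> carrier B"
      have "D (\<lambda>b2 z. eps z * D (\<lambda>s1 s2. \<beta> (s1 \<star> b2 \<star> S b5) s2) (S b1)) v =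
          D (\<lambda>s1 s2. \<beta> (s1 \<star> v \<star> S b5) s2) (S b1)"
        by (rule counit_right[where \<psi>="\<lambda>t. D (\<lambda>s1 s2. \<beta> (s1 \<star> t \<star> S b5) s2) (S b1)"])
          ((intro \<beta>_intros)?; simp)+
      also have "\<dots> = D (\<lambda>s1 s2. \<beta> (s1 \<star> (v \<star> S b5)) s2) (S b1)"
        by (intro D_cong) (simp_all add: B.m_assoc)
      finally show "D (\<lambda>b2 z. eps z * D (\<lambda>s1 s2. \<beta> (s1 \<star> b2 \<star> S b5) s2) (S b1)) v = \<dots>" .
    qed simp
    also have "\<dots> = eps w * D (\<lambda>s1 s2. \<beta> (s1 \<star> \<one>\<^bsub>B\<^esub>) s2) (S b1)"
      by (rule antipode_right[where \<psi>="\<lambda>t. D (\<lambda>s1 s2. \<beta> (s1 \<star> t) s2) (S b1)"])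
        ((intro \<beta>_intros)?; simp)+
    also have "D (\<lambda>s1 s2. \<beta> (s1 \<star> \<one>\<^bsub>B\<^esub>) s2) (S b1) = D \<beta> (S b1)"
      by (intro D_cong) simp_all
    finally show "D (\<lambda>v b5. D (\<lambda>b2 z. D (\<lambda>b3 b4. N b1 b2 b3 b4 b5) z) v) w = eps w * D \<beta> (S b1)" .
  qed
  also have "\<dots> = D \<beta> (S b)"
    by (rule counit_right[where \<psi>="\<lambda>t. D \<beta> (S t)"]) ((intro lin_intros \<beta> b)?; simp)+
  finally show ?thesis using X2 by simp
qed

end

context hopf_calculus
begin

section \<open>Integrals of a Hopf subalgebra with a dual basis\<close>

lemma antipode2_comult:
  assumes "bilin \<beta>" "b \<in> carrier B"
  shows "D \<beta> (S (S b)) = D (\<lambda>x y. \<beta> (S (S x)) (S (S y))) b"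
proof -
  have "bilin (\<lambda>x y. \<beta> (S y) (S x))"
    by ((intro lin_intros bilin_comp_left[OF assms(1)] bilin_comp_right[OF assms(1)])?; simp)+
  then show ?thesis
    using assms antipode_comult[of \<beta> "S b"] antipode_comult[of "\<lambda>x y. \<beta> (S y) (S x)" b] by simp
qed

text \<open>Since \<open>\<Sum> S(y\<^sub>2) S\<^sup>2(y\<^sub>1) = \<epsilon>(y)\<close>, the second component of \<open>\<Delta> h\<close> can be replaced by \<open>S(y\<^sub>2)\<close> times the second
  component of \<open>\<Delta>(S\<^sup>2(y\<^sub>1) h)\<close>.\<close>

lemma twisted_shift_right:
  assumes G: "lin G" and \<psi>: "lin \<psi>" and y: "y \<in> carrier B" and h: "h \<in> carrier B"
  shows "D (\<lambda>h1 k. G (S (S y) \<star> h1) * \<psi> k) h =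
    D (\<lambda>y1 y2. D (\<lambda>v w. G v * \<psi> (S y2 \<star> w)) (S (S y1) \<star> h)) y"
proof -
  note I = lin_intros lin_comp[OF G] lin_comp[OF \<psi>]
  have "D (\<lambda>y1 y2. D (\<lambda>v w. G v * \<psi> (S y2 \<star> w)) (S (S y1) \<star> h)) y =
     D (\<lambda>y1 y2. D (\<lambda>p q. D (\<lambda>h1 k. G (S (S p) \<star> h1) * \<psi> (S y2 \<star> (S (S q) \<star> k))) h) y1) y"
  proof (intro D_cong y)
    fix y1 y2 assume [simp]: "y1 \<in> carrier B" "y2 \<in> carrier B"
    have "D (\<lambda>v w. G v * \<psi> (S y2 \<star> w)) (S (S y1) \<star> h) =
       D (\<lambda>p q. D (\<lambda>h1 k. G (p \<star> h1) * \<psi> (S y2 \<star> (q \<star> k))) h) (S (S y1))"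
      by (rule D_mult) ((intro I h)?; simp)+
    also have "\<dots> = D (\<lambda>p q. D (\<lambda>h1 k. G (S (S p) \<star> h1) * \<psi> (S y2 \<star> (S (S q) \<star> k))) h) y1"
      by (rule antipode2_comult) ((intro I h)?; simp)+
    finally show "D (\<lambda>v w. G v * \<psi> (S y2 \<star> w)) (S (S y1) \<star> h) = \<dots>" .
  qed
  also have "\<dots> = D (\<lambda>p z. D (\<lambda>q y2. D (\<lambda>h1 k. G (S (S p) \<star> h1) * \<psi> (S y2 \<star> (S (S q) \<star> k))) h) z) y"
    by (rule coassoc) ((intro I h y)?; simp)+
  also have "\<dots> = D (\<lambda>p z. D (\<lambda>h1 k. D (\<lambda>q y2. G (S (S p) \<star> h1) * \<psi> (S y2 \<star> (S (S q) \<star> k))) z) h) y"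
    by (intro D_cong y D_swap)
  also have "\<dots> = D (\<lambda>p z. D (\<lambda>h1 k. eps z * (G (S (S p) \<star> h1) * \<psi> k)) h) y"
  proof (intro D_cong y h)
    fix p z h1 k
    assume [simp]: "p \<in> carrier B" "z \<in> carrier B" "h1 \<in> carrier B" "k \<in> carrier B"
    have "D (\<lambda>q y2. \<psi> (S y2 \<star> (S (S q) \<star> k))) z = D (\<lambda>q y2. \<psi> (S (S q \<star> y2) \<star> k)) z"
      by (intro D_cong) (simp_all add: antipode_mult B.m_assoc)
    also have "\<dots> = eps z * \<psi> (S \<one>\<^bsub>B\<^esub> \<star> k)"
      by (rule antipode_left[where \<psi>="\<lambda>t. \<psi> (S t \<star> k)"]) ((intro I)?; simp)+
    finally show "D (\<lambda>q y2. G (S (S p) \<star> h1) * \<psi> (S y2 \<star> (S (S q) \<star> k))) z =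
        eps z * (G (S (S p) \<star> h1) * \<psi> k)"
      by (simp add: D_const_mult mult.left_commute)
  qed
  also have "\<dots> = D (\<lambda>p z. eps z * D (\<lambda>h1 k. G (S (S p) \<star> h1) * \<psi> k) h) y"
    by (simp add: D_const_mult)
  also have "\<dots> = D (\<lambda>h1 k. G (S (S y) \<star> h1) * \<psi> k) h"
    by (rule counit_right[where \<psi>="\<lambda>t. D (\<lambda>h1 k. G (S (S t) \<star> h1) * \<psi> k) h"]) ((intro I h y)?; simp)+
  finally show ?thesis by simp
qed

text \<open>The counterpart for multiplication: \<open>\<Sum> S(a\<^sub>2) S\<^sup>2(a\<^sub>1) = \<epsilon>(a)\<close> moves the factor \<open>a\<close> into the argument of the
  coproduct, at the price of a factor \<open>S(a\<^sub>2)\<close> in the second component.\<close>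

lemma twisted_shift_left:
  assumes \<psi>: "lin \<psi>" and \<chi>: "lin \<chi>" and a: "a \<in> carrier B" and y: "y \<in> carrier B"
  shows "D (\<lambda>u v. \<psi> (a \<star> u) * \<chi> (S (S v))) y =
    D (\<lambda>a1 a2. D (\<lambda>u v. \<psi> u * \<chi> (S a2 \<star> S (S v))) (a1 \<star> y)) a"
proof -
  note I = lin_intros lin_comp[OF \<chi>] lin_comp[OF \<psi>]
  have "D (\<lambda>a1 a2. D (\<lambda>u v. \<psi> u * \<chi> (S a2 \<star> S (S v))) (a1 \<star> y)) a =
    D (\<lambda>a1 a2. D (\<lambda>p q. D (\<lambda>u v. \<psi> (p \<star> u) * \<chi> (S a2 \<star> S (S (q \<star> v)))) y) a1) a"
    by (intro D_cong a D_mult) ((intro I y)?; simp)+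
  also have "\<dots> = D (\<lambda>p z. D (\<lambda>q a2. D (\<lambda>u v. \<psi> (p \<star> u) * \<chi> (S a2 \<star> S (S (q \<star> v)))) y) z) a"
    by (rule coassoc) ((intro I y a)?; simp)+
  also have "\<dots> = D (\<lambda>p z. D (\<lambda>u v. D (\<lambda>q a2. \<psi> (p \<star> u) * \<chi> (S a2 \<star> S (S (q \<star> v)))) z) y) a"
    by (intro D_cong a D_swap)
  also have "\<dots> = D (\<lambda>p z. D (\<lambda>u v. eps z * (\<psi> (p \<star> u) * \<chi> (S (S v)))) y) a"
  proof (intro D_cong a y)
    fix p z u v
    assume [simp]: "p \<in> carrier B" "z \<in> carrier B" "u \<in> carrier B" "v \<in> carrier B"
    have "D (\<lambda>q a2. \<chi> (S a2 \<star> S (S (q \<star> v)))) z = D (\<lambda>q a2. \<chi> (S (S q \<star> a2) \<star> S (S v))) z"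
      by (intro D_cong) (simp_all add: antipode_mult B.m_assoc)
    also have "\<dots> = eps z * \<chi> (S \<one>\<^bsub>B\<^esub> \<star> S (S v))"
      by (rule antipode_left[where \<psi>="\<lambda>t. \<chi> (S t \<star> S (S v))"]) ((intro I)?; simp)+
    finally show "D (\<lambda>q a2. \<psi> (p \<star> u) * \<chi> (S a2 \<star> S (S (q \<star> v)))) z =
        eps z * (\<psi> (p \<star> u) * \<chi> (S (S v)))"
      by (simp add: D_const_mult mult.left_commute)
  qed
  also have "\<dots> = D (\<lambda>p z. eps z * D (\<lambda>u v. \<psi> (p \<star> u) * \<chi> (S (S v))) y) a"
    by (simp add: D_const_mult)
  also have "\<dots> = D (\<lambda>u v. \<psi> (a \<star> u) * \<chi> (S (S v))) y"
    by (rule counit_right[where \<psi>="\<lambda>t. D (\<lambda>u v. \<psi> (t \<star> u) * \<chi> (S (S v))) y"]) ((intro I y a)?; simp)+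
  finally show ?thesis by simp
qed

end

locale hopf_sub = hopf_calculus R B \<iota> cop \<epsilon> S
  for R :: "('r, 'x) ring_scheme" (structure) and B :: "('r, 'b, 'y) module_scheme" (structure)
    and \<iota> :: "'r \<Rightarrow> 'k :: comm_ring" and cop \<epsilon> S +
  fixes A :: "'b set"
  assumes A_submodule: "submodule A R B"
    and A_one [simp]: "\<one>\<^bsub>B\<^esub> \<in> A"
    and A_mult [simp]: "\<lbrakk> a \<in> A; a' \<in> A \<rbrakk> \<Longrightarrow> a \<star> a' \<in> A"
    and A_antipode [simp]: "a \<in> A \<Longrightarrow> S a \<in> A"
    and A_cop: "\<lbrakk> a \<in> A; (x, y) \<in> set (cop a) \<rbrakk> \<Longrightarrow> x \<in> A \<and> y \<in> A"
begin

lemma A_carrier [simp]: "a \<in> A \<Longrightarrow> a \<in> carrier B"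
  using submodule_subset[OF A_submodule] by auto

lemma D_cong_sub:
  assumes "\<And>x y. x \<in> A \<Longrightarrow> y \<in> A \<Longrightarrow> \<beta> x y = \<gamma> x y" "a \<in> A"
  shows "D \<beta> a = D \<gamma> a"
  unfolding D_def
  by (rule arg_cong[where f=sum_list], rule map_cong) (use assms A_cop[OF assms(2)] in auto)

definition right_integral_on :: "('b \<Rightarrow> 'k) \<Rightarrow> bool" where
  "right_integral_on F \<longleftrightarrow> lin F \<and>
     (\<forall>h\<in>A. \<forall>\<psi>. lin \<psi> \<longrightarrow> D (\<lambda>x y. F x * \<psi> y) h = F h * \<psi> \<one>\<^bsub>B\<^esub>)"

definition left_integral_in :: "'b \<Rightarrow> bool" where
  "left_integral_in \<Lambda> \<longleftrightarrow> \<Lambda> \<in> A \<and> (\<forall>a\<in>A. a \<star> \<Lambda> = \<epsilon> a \<odot>\<^bsub>B\<^esub> \<Lambda>)"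

end

locale hopf_sub_basis = hopf_sub R B \<iota> cop \<epsilon> S A
  for R :: "('r, 'x) ring_scheme" (structure) and B :: "('r, 'b, 'y) module_scheme" (structure)
    and \<iota> :: "'r \<Rightarrow> 'k :: comm_ring" and cop \<epsilon> S A +
  fixes E :: "'b set" and f :: "'b \<Rightarrow> 'b \<Rightarrow> 'k"
  assumes finite_E: "finite E" and E_sub: "E \<subseteq> A"
    and lin_f: "e \<in> E \<Longrightarrow> lin (f e)"
    and expand: "\<lbrakk> lin \<beta>; a \<in> A \<rbrakk> \<Longrightarrow> (\<Sum>e\<in>E. f e a * \<beta> e) = \<beta> a"
begin

lemma E_A [simp]: "e \<in> E \<Longrightarrow> e \<in> A"
  using E_sub by auto

text \<open>By the theorem of Larson and Sweedler, the dual of \<open>A\<close> is a Hopf module whose coinvariants are the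
  integrals on \<open>A\<close>. \<open>P g\<close> is the image of \<open>g\<close> under the projection to the coinvariants, written as a trace
  over the dual basis.\<close>

definition P :: "('b \<Rightarrow> 'k) \<Rightarrow> 'b \<Rightarrow> 'k" where
  "P g h = (\<Sum>e\<in>E. D (\<lambda>x y. g x * f e y) (S (S e) \<star> h))"

text \<open>After the shift by \<open>S(y\<^sub>2)\<close>, expanding \<open>y\<^sub>1\<close> in the basis and summing up the expansion of \<open>w\<^sub>2\<close> is the identity
  \<open>tr (X Y) = tr (Y X)\<close>. It takes \<open>S(y\<^sub>2)\<close> next to the component of the coproduct with which it cancels.\<close>

lemma right_integral_P:
  assumes g: "lin g"
  shows "right_integral_on (P g)"
proof -
  note I = lin_intros lin_comp[OF g] lin_comp[OF lin_f]
  have "lin (P g)"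
    unfolding P_def by ((intro I)?; simp)+
  moreover have "D (\<lambda>x y. P g x * \<psi> y) h = P g h * \<psi> \<one>\<^bsub>B\<^esub>" if h: "h \<in> A" and \<psi>: "lin \<psi>" for h \<psi>
  proof -
    note J = I lin_comp[OF \<psi>]
    define G where "G e v = D (\<lambda>x y. g x * f e y) v" for e v
    have G: "lin (G e)" if "e \<in> E" for e
      unfolding G_def using that by ((intro I)?; simp)+
    have "D (\<lambda>x y. P g x * \<psi> y) h = (\<Sum>e\<in>E. D (\<lambda>h1 k. G e (S (S e) \<star> h1) * \<psi> k) h)"
      by (simp add: P_def G_def sum_distrib_right D_sum)
    also have "\<dots> = (\<Sum>e\<in>E. D (\<lambda>y1 y2. D (\<lambda>v w. G e v * \<psi> (S y2 \<star> w)) (S (S y1) \<star> h)) e)"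
      using G \<psi> h by (intro sum.cong refl twisted_shift_right) auto
    also have "\<dots> = (\<Sum>e\<in>E. D (\<lambda>y1 y2. \<Sum>k\<in>E. f k y1 * D (\<lambda>v w. G e v * \<psi> (S y2 \<star> w)) (S (S k) \<star> h)) e)"
    proof (intro sum.cong refl D_cong_sub)
      fix e y1 y2 assume e: "e \<in> E" and [simp]: "y1 \<in> A" "y2 \<in> A"
      show "D (\<lambda>v w. G e v * \<psi> (S y2 \<star> w)) (S (S y1) \<star> h) =
         (\<Sum>k\<in>E. f k y1 * D (\<lambda>v w. G e v * \<psi> (S y2 \<star> w)) (S (S k) \<star> h))"
        by (rule expand[where \<beta>="\<lambda>t. D (\<lambda>v w. G e v * \<psi> (S y2 \<star> w)) (S (S t) \<star> h)", symmetric])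
          (use h e in \<open>(intro J lin_comp[OF G])?; simp\<close>)+
    qed simp
    also have "\<dots> = (\<Sum>e\<in>E. \<Sum>k\<in>E. D (\<lambda>y1 y2. D (\<lambda>v w. D (\<lambda>w1 w2. g w1 * (f e w2 * (f k y1 * \<psi> (S y2 \<star> w)))) v) (S (S k) \<star> h)) e)"
      by (simp add: D_sum G_def D_mult_const[symmetric] D_const_mult[symmetric] ac_simps)
    also have "\<dots> = (\<Sum>k\<in>E. \<Sum>e\<in>E. D (\<lambda>y1 y2. D (\<lambda>v w. D (\<lambda>w1 w2. g w1 * (f e w2 * (f k y1 * \<psi> (S y2 \<star> w)))) v) (S (S k) \<star> h)) e)"
      by (rule sum.swap)
    also have "\<dots> = (\<Sum>k\<in>E. D (\<lambda>v w. D (\<lambda>w1 w2. g w1 * (\<Sum>e\<in>E. f e w2 * D (\<lambda>y1 y2. f k y1 * \<psi> (S y2 \<star> w)) e)) v) (S (S k) \<star> h))"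
    proof (rule sum.cong[OF refl])
      fix k assume "k \<in> E"
      have "(\<Sum>e\<in>E. D (\<lambda>y1 y2. D (\<lambda>v w. D (\<lambda>w1 w2. g w1 * (f e w2 * (f k y1 * \<psi> (S y2 \<star> w)))) v) (S (S k) \<star> h)) e)
        = (\<Sum>e\<in>E. D (\<lambda>v w. D (\<lambda>w1 w2. D (\<lambda>y1 y2. g w1 * (f e w2 * (f k y1 * \<psi> (S y2 \<star> w)))) e) v) (S (S k) \<star> h))"
        by (subst D_swap, rule sum.cong[OF refl], rule arg_cong2[where f=D, OF _ refl], intro ext, rule D_swap)
      also have "\<dots> = D (\<lambda>v w. D (\<lambda>w1 w2. g w1 * (\<Sum>e\<in>E. f e w2 * D (\<lambda>y1 y2. f k y1 * \<psi> (S y2 \<star> w)) e)) v) (S (S k) \<star> h)"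
        by (simp add: D_sum D_const_mult sum_distrib_left)
      finally show "(\<Sum>e\<in>E. D (\<lambda>y1 y2. D (\<lambda>v w. D (\<lambda>w1 w2. g w1 * (f e w2 * (f k y1 * \<psi> (S y2 \<star> w)))) v) (S (S k) \<star> h)) e) = \<dots>" .
    qed
    also have "\<dots> = (\<Sum>k\<in>E. D (\<lambda>v w. D (\<lambda>w1 w2. g w1 * D (\<lambda>y1 y2. f k y1 * \<psi> (S y2 \<star> w)) w2) v) (S (S k) \<star> h))"
    proof (intro sum.cong refl D_cong_sub)
      fix k v w w1 w2 assume "k \<in> E" and [simp]: "v \<in> A" "w \<in> A" "w1 \<in> A" "w2 \<in> A"
      have "(\<Sum>e\<in>E. f e w2 * D (\<lambda>y1 y2. f k y1 * \<psi> (S y2 \<star> w)) e) = D (\<lambda>y1 y2. f k y1 * \<psi> (S y2 \<star> w)) w2"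
        by (rule expand) (use \<open>k \<in> E\<close> in \<open>(intro J)?; simp\<close>)+
      then show "g w1 * (\<Sum>e\<in>E. f e w2 * D (\<lambda>y1 y2. f k y1 * \<psi> (S y2 \<star> w)) e) =
          g w1 * D (\<lambda>y1 y2. f k y1 * \<psi> (S y2 \<star> w)) w2" by simp
    qed (use h in simp_all)
    also have "\<dots> = (\<Sum>k\<in>E. D (\<lambda>w1 t. D (\<lambda>w2 w. g w1 * D (\<lambda>y1 y2. f k y1 * \<psi> (S y2 \<star> w)) w2) t) (S (S k) \<star> h))"
      by (intro sum.cong refl coassoc) (use h in \<open>(intro J)?; simp\<close>)+
    also have "\<dots> = (\<Sum>k\<in>E. D (\<lambda>w1 t. g w1 * f k t * \<psi> \<one>\<^bsub>B\<^esub>) (S (S k) \<star> h))"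
    proof (intro sum.cong refl D_cong)
      fix k w1 t assume k: "k \<in> E" and [simp]: "w1 \<in> carrier B" "t \<in> carrier B"
      have "D (\<lambda>w2 w. D (\<lambda>y1 y2. f k y1 * \<psi> (S y2 \<star> w)) w2) t = D (\<lambda>y1 z. D (\<lambda>y2 w. f k y1 * \<psi> (S y2 \<star> w)) z) t"
        by (rule coassoc) (use k in \<open>(intro J)?; simp\<close>)+
      also have "\<dots> = D (\<lambda>y1 z. eps z * (f k y1 * \<psi> \<one>\<^bsub>B\<^esub>)) t"
      proof (intro D_cong)
        fix y1 z assume [simp]: "y1 \<in> carrier B" "z \<in> carrier B"
        show "D (\<lambda>y2 w. f k y1 * \<psi> (S y2 \<star> w)) z = eps z * (f k y1 * \<psi> \<one>\<^bsub>B\<^esub>)"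
          using antipode_left[OF \<psi>, of z] by (simp add: D_const_mult mult.left_commute)
      qed simp
      also have "\<dots> = f k t * \<psi> \<one>\<^bsub>B\<^esub>"
        by (rule counit_right[where \<psi>="\<lambda>t. f k t * \<psi> \<one>\<^bsub>B\<^esub>"]) (use k in \<open>(intro J)?; simp\<close>)+
      finally show "D (\<lambda>w2 w. g w1 * D (\<lambda>y1 y2. f k y1 * \<psi> (S y2 \<star> w)) w2) t = g w1 * f k t * \<psi> \<one>\<^bsub>B\<^esub>"
        by (simp add: D_const_mult mult.assoc)
    qed (use h in simp_all)
    also have "\<dots> = P g h * \<psi> \<one>\<^bsub>B\<^esub>"
      by (simp add: P_def D_mult_const sum_distrib_right)
    finally show ?thesis .
  qed
  ultimately show ?thesis by (simp add: right_integral_on_def)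
qed

text \<open>A Hopf module is generated by its coinvariants. For the counit, evaluated at \<open>1\<close>, this is the identity
  below, and it shows that some \<open>P (f j)\<close> does not vanish on \<open>A\<close>.\<close>

lemma sum_P: "(\<Sum>j\<in>E. P (f j) (S j)) = \<iota> \<one>"
proof -
  have "(\<Sum>j\<in>E. P (f j) (S j)) = (\<Sum>j\<in>E. \<Sum>e\<in>E. D (\<lambda>x y. f j x * f e y) (S (j \<star> S e)))"
    by (simp add: P_def antipode_mult)
  also have "\<dots> = (\<Sum>j\<in>E. \<Sum>e\<in>E. \<Sum>k\<in>E. f k (S (j \<star> S e)) * D (\<lambda>x y. f j x * f e y) k)"
    by (intro sum.cong refl expand[symmetric]) ((intro lin_intros lin_comp[OF lin_f])?; simp)+
  also have "\<dots> = (\<Sum>j\<in>E. \<Sum>k\<in>E. \<Sum>e\<in>E. f k (S (j \<star> S e)) * D (\<lambda>x y. f j x * f e y) k)"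
    by (rule sum.cong[OF refl], rule sum.swap)
  also have "\<dots> = (\<Sum>k\<in>E. \<Sum>j\<in>E. \<Sum>e\<in>E. f k (S (j \<star> S e)) * D (\<lambda>x y. f j x * f e y) k)"
    by (rule sum.swap)
  also have "\<dots> = (\<Sum>k\<in>E. D (\<lambda>x y. \<Sum>j\<in>E. f j x * (\<Sum>e\<in>E. f e y * f k (S (j \<star> S e)))) k)"
    by (simp add: D_sum D_const_mult[symmetric] sum_distrib_left mult_ac)
  also have "\<dots> = (\<Sum>k\<in>E. D (\<lambda>x y. f k (S (x \<star> S y))) k)"
  proof (intro sum.cong refl D_cong_sub)
    fix k x y assume k: "k \<in> E" and [simp]: "x \<in> A" "y \<in> A"
    have "(\<Sum>e\<in>E. f e y * f k (S (j \<star> S e))) = f k (S (j \<star> S y))" if "j \<in> E" for j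
      by (rule expand[where \<beta>="\<lambda>t. f k (S (j \<star> S t))"])
        (use k that in \<open>(intro lin_intros lin_comp[OF lin_f])?; simp\<close>)+
    then have "(\<Sum>j\<in>E. f j x * (\<Sum>e\<in>E. f e y * f k (S (j \<star> S e)))) = (\<Sum>j\<in>E. f j x * f k (S (j \<star> S y)))"
      by simp
    also have "\<dots> = f k (S (x \<star> S y))"
      by (rule expand[where \<beta>="\<lambda>t. f k (S (t \<star> S y))"])
        (use k in \<open>(intro lin_intros lin_comp[OF lin_f])?; simp\<close>)+
    finally show "(\<Sum>j\<in>E. f j x * (\<Sum>e\<in>E. f e y * f k (S (j \<star> S e)))) = f k (S (x \<star> S y))" .
  qed simp
  also have "\<dots> = (\<Sum>k\<in>E. f k \<one>\<^bsub>B\<^esub> * eps k)"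
  proof (intro sum.cong refl)
    fix k assume k: "k \<in> E"
    have "D (\<lambda>x y. f k (S (x \<star> S y))) k = eps k * f k (S \<one>\<^bsub>B\<^esub>)"
      by (rule antipode_right[where \<psi>="\<lambda>t. f k (S t)"])
        (use k in \<open>(intro lin_intros lin_comp[OF lin_f])?; simp\<close>)+
    then show "D (\<lambda>x y. f k (S (x \<star> S y))) k = f k \<one>\<^bsub>B\<^esub> * eps k" by (simp add: mult.commute)
  qed
  also have "\<dots> = eps \<one>\<^bsub>B\<^esub>"
    by (rule expand[OF lin_eps]) simp
  finally show ?thesis by simp
qed

text \<open>The projection of the Hopf module \<open>A\<close> to the integrals in \<open>A\<close>, dual to \<open>P\<close>. The projection of \<open>x\<close> has
  coordinates in \<open>K\<close>; \<open>Q \<psi> x\<close> is its value under the functional \<open>\<psi>\<close>.\<close>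

definition Q :: "('b \<Rightarrow> 'k) \<Rightarrow> 'b \<Rightarrow> 'k" where
  "Q \<psi> x = (\<Sum>e\<in>E. D (\<lambda>u v. \<psi> u * f e (S (S v))) (e \<star> x))"

text \<open>The cyclicity of the trace turns \<open>S(a\<^sub>2) \<dots> a\<^sub>1\<close> into \<open>a\<^sub>1 S(a\<^sub>2) = \<epsilon>(a)\<close>.\<close>

lemma Q_left_invariant:
  assumes \<psi>: "lin \<psi>" and a: "a \<in> A" and x: "x \<in> A"
  shows "Q (\<lambda>u. \<psi> (a \<star> u)) x = eps a * Q \<psi> x"
proof -
  note I = lin_intros lin_comp[OF \<psi>] lin_comp[OF lin_f]
  define H where "H e a1 a2 y = D (\<lambda>u v. \<psi> u * f e (S a2 \<star> S (S v))) y" for e and a1 a2 y :: 'b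
  have "Q (\<lambda>u. \<psi> (a \<star> u)) x =
      (\<Sum>e\<in>E. D (\<lambda>a1 a2. D (\<lambda>u v. \<psi> u * f e (S a2 \<star> S (S v))) (a1 \<star> (e \<star> x))) a)"
    unfolding Q_def using \<psi> lin_f a x by (intro sum.cong refl twisted_shift_left) auto
  also have "\<dots> = (\<Sum>e\<in>E. D (\<lambda>a1 a2. \<Sum>k\<in>E. f k (a1 \<star> e) * D (\<lambda>u v. \<psi> u * f e (S a2 \<star> S (S v))) (k \<star> x)) a)"
  proof (intro sum.cong refl D_cong_sub a)
    fix e a1 a2 assume e: "e \<in> E" and [simp]: "a1 \<in> A" "a2 \<in> A"
    have "D (\<lambda>u v. \<psi> u * f e (S a2 \<star> S (S v))) (a1 \<star> (e \<star> x)) =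
        D (\<lambda>u v. \<psi> u * f e (S a2 \<star> S (S v))) ((a1 \<star> e) \<star> x)"
      using e x by (simp add: B.m_assoc)
    also have "\<dots> = (\<Sum>k\<in>E. f k (a1 \<star> e) * D (\<lambda>u v. \<psi> u * f e (S a2 \<star> S (S v))) (k \<star> x))"
      by (rule expand[where \<beta>="\<lambda>t. D (\<lambda>u v. \<psi> u * f e (S a2 \<star> S (S v))) (t \<star> x)", symmetric])
        (use e x in \<open>(intro I)?; simp\<close>)+
    finally show "D (\<lambda>u v. \<psi> u * f e (S a2 \<star> S (S v))) (a1 \<star> (e \<star> x)) = \<dots>" .
  qed
  also have "\<dots> = (\<Sum>e\<in>E. \<Sum>k\<in>E. D (\<lambda>a1 a2. D (\<lambda>u v. \<psi> u * (f e (S a2 \<star> S (S v)) * f k (a1 \<star> e))) (k \<star> x)) a)"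
    by (simp add: D_sum D_const_mult[symmetric] mult_ac)
  also have "\<dots> = (\<Sum>k\<in>E. \<Sum>e\<in>E. D (\<lambda>a1 a2. D (\<lambda>u v. \<psi> u * (f e (S a2 \<star> S (S v)) * f k (a1 \<star> e))) (k \<star> x)) a)"
    by (rule sum.swap)
  also have "\<dots> = (\<Sum>k\<in>E. D (\<lambda>a1 a2. D (\<lambda>u v. \<psi> u * (\<Sum>e\<in>E. f e (S a2 \<star> S (S v)) * f k (a1 \<star> e))) (k \<star> x)) a)"
    by (simp add: D_sum sum_distrib_left)
  also have "\<dots> = (\<Sum>k\<in>E. D (\<lambda>a1 a2. D (\<lambda>u v. \<psi> u * f k ((a1 \<star> S a2) \<star> S (S v))) (k \<star> x)) a)"
  proof (intro sum.cong refl D_cong_sub a)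
    fix k a1 a2 u v assume k: "k \<in> E" and [simp]: "a1 \<in> A" "a2 \<in> A" "u \<in> A" "v \<in> A"
    have "(\<Sum>e\<in>E. f e (S a2 \<star> S (S v)) * f k (a1 \<star> e)) = f k (a1 \<star> (S a2 \<star> S (S v)))"
      by (rule expand[where \<beta>="\<lambda>t. f k (a1 \<star> t)"]) (use k in \<open>(intro I)?; simp\<close>)+
    then show "\<psi> u * (\<Sum>e\<in>E. f e (S a2 \<star> S (S v)) * f k (a1 \<star> e)) = \<psi> u * f k ((a1 \<star> S a2) \<star> S (S v))"
      by (simp add: B.m_assoc)
  qed (use x in simp_all)
  also have "\<dots> = (\<Sum>k\<in>E. eps a * D (\<lambda>u v. \<psi> u * f k (\<one>\<^bsub>B\<^esub> \<star> S (S v))) (k \<star> x))"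
  proof (intro sum.cong refl)
    fix k assume k: "k \<in> E"
    show "D (\<lambda>a1 a2. D (\<lambda>u v. \<psi> u * f k ((a1 \<star> S a2) \<star> S (S v))) (k \<star> x)) a =
        eps a * D (\<lambda>u v. \<psi> u * f k (\<one>\<^bsub>B\<^esub> \<star> S (S v))) (k \<star> x)"
      by (rule antipode_right[where \<psi>="\<lambda>t. D (\<lambda>u v. \<psi> u * f k (t \<star> S (S v))) (k \<star> x)"])
        (use k x a in \<open>(intro I)?; simp\<close>)+
  qed
  also have "\<dots> = (\<Sum>k\<in>E. eps a * D (\<lambda>u v. \<psi> u * f k (S (S v))) (k \<star> x))"
    by (intro sum.cong refl arg_cong2[where f="(*)"] D_cong) (use x in simp_all)
  also have "\<dots> = eps a * Q \<psi> x"
    by (simp add: Q_def sum_distrib_left)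
  finally show ?thesis .
qed

text \<open>The Hopf module \<open>A\<close> is generated by integrals: with \<open>\<Lambda>\<^sub>j\<close> the projection of \<open>j x\<close>, it says that
  \<open>x = \<Sum> (\<Lambda>\<^sub>j)\<^sub>1 f\<^sub>j(S((\<Lambda>\<^sub>j)\<^sub>2))\<close>.\<close>

lemma sum_Q:
  assumes \<psi>: "lin \<psi>" and x: "x \<in> A"
  shows "(\<Sum>j\<in>E. Q (D (\<lambda>u w. \<psi> u * f j (S w))) (j \<star> x)) = \<psi> x"
proof -
  note I = lin_intros lin_comp[OF \<psi>] lin_comp[OF lin_f]
  have "(\<Sum>j\<in>E. Q (D (\<lambda>u w. \<psi> u * f j (S w))) (j \<star> x)) =
     (\<Sum>j\<in>E. \<Sum>e\<in>E. D (\<lambda>t v. D (\<lambda>u w. \<psi> u * f j (S w)) t * f e (S (S v))) ((e \<star> j) \<star> x))"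
    unfolding Q_def using x by (intro sum.cong refl) (simp add: B.m_assoc)
  also have "\<dots> = (\<Sum>j\<in>E. \<Sum>e\<in>E. \<Sum>k\<in>E. f k (e \<star> j) *
      D (\<lambda>t v. D (\<lambda>u w. \<psi> u * f j (S w)) t * f e (S (S v))) (k \<star> x))"
  proof (intro sum.cong refl)
    fix j e assume je: "j \<in> E" "e \<in> E"
    show "D (\<lambda>t v. D (\<lambda>u w. \<psi> u * f j (S w)) t * f e (S (S v))) ((e \<star> j) \<star> x) =
       (\<Sum>k\<in>E. f k (e \<star> j) * D (\<lambda>t v. D (\<lambda>u w. \<psi> u * f j (S w)) t * f e (S (S v))) (k \<star> x))"
      by (rule expand[where \<beta>="\<lambda>y. D (\<lambda>t v. D (\<lambda>u w. \<psi> u * f j (S w)) t * f e (S (S v))) (y \<star> x)", symmetric])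
        (use je x in \<open>(intro I)?; simp\<close>)+
  qed
  also have "\<dots> = (\<Sum>j\<in>E. \<Sum>k\<in>E. \<Sum>e\<in>E. f k (e \<star> j) *
      D (\<lambda>t v. D (\<lambda>u w. \<psi> u * f j (S w)) t * f e (S (S v))) (k \<star> x))"
    by (rule sum.cong[OF refl], rule sum.swap)
  also have "\<dots> = (\<Sum>k\<in>E. \<Sum>j\<in>E. \<Sum>e\<in>E. f k (e \<star> j) *
      D (\<lambda>t v. D (\<lambda>u w. \<psi> u * f j (S w)) t * f e (S (S v))) (k \<star> x))"
    by (rule sum.swap)
  also have "\<dots> = (\<Sum>k\<in>E. D (\<lambda>t v. D (\<lambda>u w. \<psi> u * (\<Sum>j\<in>E. f j (S w) * (\<Sum>e\<in>E. f e (S (S v)) * f k (e \<star> j)))) t) (k \<star> x))"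
    by (simp add: D_sum D_const_mult[symmetric] D_mult_const[symmetric] sum_distrib_left mult_ac)
  also have "\<dots> = (\<Sum>k\<in>E. D (\<lambda>t v. D (\<lambda>u w. \<psi> u * f k (S (w \<star> S v))) t) (k \<star> x))"
  proof (intro sum.cong refl D_cong_sub)
    fix k t v u w assume k: "k \<in> E" and [simp]: "t \<in> A" "v \<in> A" "u \<in> A" "w \<in> A"
    have "(\<Sum>e\<in>E. f e (S (S v)) * f k (e \<star> j)) = f k (S (S v) \<star> j)" if "j \<in> E" for j
      by (rule expand[where \<beta>="\<lambda>t. f k (t \<star> j)"]) (use k that in \<open>(intro I)?; simp\<close>)+
    then have "(\<Sum>j\<in>E. f j (S w) * (\<Sum>e\<in>E. f e (S (S v)) * f k (e \<star> j))) =
        (\<Sum>j\<in>E. f j (S w) * f k (S (S v) \<star> j))" by simp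
    also have "\<dots> = f k (S (S v) \<star> S w)"
      by (rule expand[where \<beta>="\<lambda>t. f k (S (S v) \<star> t)"]) (use k in \<open>(intro I)?; simp\<close>)+
    finally show "\<psi> u * (\<Sum>j\<in>E. f j (S w) * (\<Sum>e\<in>E. f e (S (S v)) * f k (e \<star> j))) = \<psi> u * f k (S (w \<star> S v))"
      by (simp add: antipode_mult)
  qed (use x in simp_all)
  also have "\<dots> = (\<Sum>k\<in>E. D (\<lambda>u t. D (\<lambda>w v. \<psi> u * f k (S (w \<star> S v))) t) (k \<star> x))"
    by (intro sum.cong refl coassoc) (use x in \<open>(intro I)?; simp\<close>)+
  also have "\<dots> = (\<Sum>k\<in>E. D (\<lambda>u t. eps t * (\<psi> u * f k \<one>\<^bsub>B\<^esub>)) (k \<star> x))"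
  proof (intro sum.cong refl D_cong)
    fix k u t assume k: "k \<in> E" and [simp]: "u \<in> carrier B" "t \<in> carrier B"
    have "D (\<lambda>w v. f k (S (w \<star> S v))) t = eps t * f k (S \<one>\<^bsub>B\<^esub>)"
      by (rule antipode_right[where \<psi>="\<lambda>z. f k (S z)"]) (use k in \<open>(intro I)?; simp\<close>)+
    then show "D (\<lambda>w v. \<psi> u * f k (S (w \<star> S v))) t = eps t * (\<psi> u * f k \<one>\<^bsub>B\<^esub>)"
      by (simp add: D_const_mult mult.left_commute)
  qed (use x in simp_all)
  also have "\<dots> = (\<Sum>k\<in>E. \<psi> (k \<star> x) * f k \<one>\<^bsub>B\<^esub>)"
    by (intro sum.cong refl counit_right[where \<psi>="\<lambda>u. \<psi> u * f _ \<one>\<^bsub>B\<^esub>"]) (use x in \<open>(intro I)?; simp\<close>)+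
  also have "\<dots> = (\<Sum>k\<in>E. f k \<one>\<^bsub>B\<^esub> * \<psi> (k \<star> x))"
    by (simp add: mult.commute)
  also have "\<dots> = \<psi> (\<one>\<^bsub>B\<^esub> \<star> x)"
    by (rule expand[where \<beta>="\<lambda>t. \<psi> (t \<star> x)"]) (use x in \<open>(intro I)?; simp\<close>)+
  finally show ?thesis using x by simp
qed

end

context hopf_calculus
begin

lemma DB_closed:
  assumes "b \<in> carrier B" "\<And>x y. x \<in> carrier B \<Longrightarrow> y \<in> carrier B \<Longrightarrow> h x y \<in> carrier B"
  shows "DB h b \<in> carrier B"
  unfolding DB_def using cop_closed[OF assms(1)] assms(2) by (intro M.msum_closed) auto

lemma lin_DB:
  assumes "lin \<psi>" "b \<in> carrier B" "\<And>x y. x \<in> carrier B \<Longrightarrow> y \<in> carrier B \<Longrightarrow> h x y \<in> carrier B"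
  shows "\<psi> (DB h b) = D (\<lambda>x y. \<psi> (h x y)) b"
proof -
  have "\<psi> (DB h b) = (\<Sum>x\<leftarrow>map (\<lambda>(x, y). h x y) (cop b). \<psi> x)"
    unfolding DB_def using cop_closed[OF assms(2)] assms(3) by (intro lin_msum assms(1)) auto
  then show ?thesis by (simp add: D_def o_def case_prod_unfold)
qed

lemma D_diff: "D (\<lambda>x y. \<beta> x y - \<gamma> x y) b = D \<beta> b - D \<gamma> b"
  using D_add[of "\<lambda>x y. \<beta> x y - \<gamma> x y" \<gamma> b] by simp

definition lin_to_R :: "('b \<Rightarrow> 'r) \<Rightarrow> bool" where
  "lin_to_R \<phi> \<longleftrightarrow> \<phi> \<in> carrier B \<rightarrow> carrier R \<and>
     (\<forall>x\<in>carrier B. \<forall>y\<in>carrier B. \<phi> (x \<oplus>\<^bsub>B\<^esub> y) = \<phi> x \<oplus> \<phi> y) \<and>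
     (\<forall>r\<in>carrier R. \<forall>x\<in>carrier B. \<phi> (r \<odot>\<^bsub>B\<^esub> x) = r \<otimes> \<phi> x)"

lemma lin_to_R_closed: "lin_to_R \<phi> \<Longrightarrow> x \<in> carrier B \<Longrightarrow> \<phi> x \<in> carrier R"
  by (auto simp: lin_to_R_def)

lemma lin_to_R_lin: "lin_to_R \<phi> \<Longrightarrow> lin (\<lambda>x. \<iota> (\<phi> x))"
  by (auto simp: lin_to_R_def lin_def emb_add emb_mult Pi_iff)

lemma lin_to_R_zero: "lin_to_R \<phi> \<Longrightarrow> \<phi> \<zero>\<^bsub>B\<^esub> = \<zero>"
  using lin_zero[OF lin_to_R_lin] emb_inj by (simp add: lin_to_R_closed)

end

section \<open>The opposite Hopf algebra\<close>

text \<open>Reversing both the multiplication and the comultiplication keeps the antipode and exchanges left and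
  right integrals.\<close>

definition opp :: "('r, 'b, 'y) module_scheme \<Rightarrow> ('r, 'b, 'y) module_scheme" where
  "opp B = B\<lparr>monoid.mult := \<lambda>x y. y \<otimes>\<^bsub>B\<^esub> x\<rparr>"

lemma opp_simps [simp]:
  "carrier (opp B) = carrier B" "add (opp B) = add B" "zero (opp B) = zero B" "one (opp B) = one B"
  "smult (opp B) = smult B" "monoid.mult (opp B) x y = y \<otimes>\<^bsub>B\<^esub> x" "opp (opp B) = B"
  by (simp_all add: opp_def)

context hopf_calculus
begin

abbreviation cop' where "cop' b \<equiv> map prod.swap (cop b)"

lemma torsion_free_module_opp: "torsion_free_module R (opp B) \<iota>"
proof -
  have eq: "add_monoid (opp B) = add_monoid B" by simp
  have "abelian_group (opp B)"
    using M.abelian_group_axioms unfolding abelian_group_def abelian_monoid_def abelian_group_axioms_def eq .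
  then have "module R (opp B)"
    using R.is_cring
    by (intro moduleI) (simp_all add: smult_l_distr smult_r_distr smult_assoc1)
  then show ?thesis
    using torsion_free fraction_embedding_axioms
    by (simp add: torsion_free_module_def torsion_free_module_axioms_def torsion_free_def)
qed

lemma ring_opp: "ring (opp B)"
proof -
  interpret opp: torsion_free_module R "opp B" \<iota> by (rule torsion_free_module_opp)
  show ?thesis
    by (intro ringI opp.M.abelian_group_axioms monoidI) (simp_all add: B.m_assoc B.l_distr B.r_distr)
qed

lemma coproduct_data_opp: "coproduct_data R (opp B) \<iota>"
  by (intro coproduct_data.intro torsion_free_module_opp ring_opp)

lemma lin_opp: "torsion_free_module.lin R (opp B) \<iota> \<psi> \<longleftrightarrow> lin \<psi>"
  by (simp add: torsion_free_module.lin_def[OF torsion_free_module_opp] lin_def)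

lemma D_opp: "coproduct_data.D cop' \<beta> b = D (\<lambda>x y. \<beta> y x) b"
  by (simp add: coproduct_data.D_def[OF coproduct_data_opp] D_def case_prod_unfold o_def)

lemma bilin_opp: "coproduct_data.bilin R (opp B) \<iota> \<beta> \<longleftrightarrow> bilin (\<lambda>x y. \<beta> y x)"
  by (auto simp: coproduct_data.bilin_def[OF coproduct_data_opp] bilin_def lin_opp)

lemma trilin_opp: "coproduct_data.trilin R (opp B) \<iota> \<beta> \<longleftrightarrow> trilin (\<lambda>x y z. \<beta> z y x)"
  by (auto simp: coproduct_data.trilin_def[OF coproduct_data_opp] trilin_def lin_opp)

lemma linear_endo_opp: "coproduct_data.linear_endo R (opp B) f \<longleftrightarrow> linear_endo f"
  by (simp add: coproduct_data.linear_endo_def[OF coproduct_data_opp] linear_endo_def)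

lemma msum_opp: "msum (opp B) xs = msum B xs"
  by (simp add: msum_def)

lemma DB_opp: "coproduct_data.DB (opp B) cop' h b = DB (\<lambda>x y. h y x) b"
  by (simp add: coproduct_data.DB_def[OF coproduct_data_opp] DB_def msum_opp case_prod_unfold o_def)

lemma hopf_calculus_opp: "hopf_calculus R (opp B) \<iota> cop' \<epsilon> S"
proof (intro hopf_calculus.intro coproduct_data_opp hopf_calculus_axioms.intro,
    unfold D_opp lin_opp bilin_opp trilin_opp linear_endo_opp opp_simps)
  fix b x y assume b: "b \<in> carrier B" and "(x, y) \<in> set (cop' b)"
  then have "(y, x) \<in> set (cop b)" by auto
  then show "x \<in> carrier B \<and> y \<in> carrier B" using cop_closed[OF b] by blast
next
  fix \<beta> :: "'b \<Rightarrow> 'b \<Rightarrow> 'k" assume "bilin (\<lambda>x y. \<beta> y x)"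
  then show "lin (D (\<lambda>x y. \<beta> y x))" by (rule lin_D)
next
  fix \<gamma> :: "'b \<Rightarrow> 'b \<Rightarrow> 'b \<Rightarrow> 'k" and b assume "trilin (\<lambda>x y z. \<gamma> z y x)" "b \<in> carrier B"
  from coassoc[OF this, symmetric]
  show "D (\<lambda>z w. D (\<lambda>y x. \<gamma> x y z) w) b = D (\<lambda>w x. D (\<lambda>z y. \<gamma> x y z) w) b" .
next
  fix \<psi> b assume "lin \<psi>" "b \<in> carrier B"
  then show "D (\<lambda>y x. eps x * \<psi> y) b = \<psi> b" by (rule counit_right)
next
  fix \<psi> b assume "lin \<psi>" "b \<in> carrier B"
  then show "D (\<lambda>y x. eps y * \<psi> x) b = \<psi> b" by (rule counit_left)
next
  fix \<beta> :: "'b \<Rightarrow> 'b \<Rightarrow> 'k" and b c assume "bilin (\<lambda>x y. \<beta> y x)" "b \<in> carrier B" "c \<in> carrier B"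
  then show "D (\<lambda>x y. \<beta> y x) (c \<star> b) = D (\<lambda>y x. D (\<lambda>v u. \<beta> (u \<star> x) (v \<star> y)) c) b"
    using D_mult[of "\<lambda>x y. \<beta> y x" c b] by (subst D_swap)
next
  fix \<beta> :: "'b \<Rightarrow> 'b \<Rightarrow> 'k" assume "bilin (\<lambda>x y. \<beta> y x)"
  then show "D (\<lambda>x y. \<beta> y x) \<one>\<^bsub>B\<^esub> = \<beta> \<one>\<^bsub>B\<^esub> \<one>\<^bsub>B\<^esub>" by (rule D_one)
next
  fix \<psi> b assume "lin \<psi>" "b \<in> carrier B"
  then show "D (\<lambda>y x. \<psi> (y \<star> S x)) b = eps b * \<psi> \<one>\<^bsub>B\<^esub>" by (rule antipode_right)
next
  fix \<psi> b assume "lin \<psi>" "b \<in> carrier B"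
  then show "D (\<lambda>y x. \<psi> (S y \<star> x)) b = eps b * \<psi> \<one>\<^bsub>B\<^esub>" by (rule antipode_left)
qed (auto simp: lin_eps linear_endo_S0 counit_mult m_comm smult_mult_left smult_mult_right)

end

section \<open>Integrals of a finite Hopf subalgebra\<close>

locale finite_hopf_sub = hopf_sub R B \<iota> cop \<epsilon> S A
  for R :: "('r, 'x) ring_scheme" (structure) and B :: "('r, 'b, 'y) module_scheme" (structure)
    and \<iota> :: "'r \<Rightarrow> 'k :: comm_ring" and cop \<epsilon> S A +
  assumes A_generated: "\<exists>X. generated_by X A"
    and A_saturated: "\<lbrakk> r \<in> carrier R; r \<noteq> \<zero>; x \<in> carrier B; r \<odot>\<^bsub>B\<^esub> x \<in> A \<rbrakk> \<Longrightarrow> x \<in> A"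
begin

lemma A_msum: "set xs \<subseteq> A \<Longrightarrow> msum B xs \<in> A"
  by (rule msum_in) (auto intro: submodule_zero submodule_add A_submodule)

lemma A_sum_element:
  assumes "finite J" "\<And>j. j \<in> J \<Longrightarrow> \<exists>m\<in>A. \<forall>\<psi>. lin \<psi> \<longrightarrow> \<psi> m = c j \<psi>"
  shows "\<exists>m\<in>A. \<forall>\<psi>. lin \<psi> \<longrightarrow> \<psi> m = (\<Sum>j\<in>J. c j \<psi>)"
  using assms
proof (induction J rule: finite_induct)
  case empty
  then show ?case by (intro bexI[of _ "\<zero>\<^bsub>B\<^esub>"]) (auto simp: lin_zero submodule_zero A_submodule)
next
  case (insert j J)
  obtain m where m: "m \<in> A" "\<forall>\<psi>. lin \<psi> \<longrightarrow> \<psi> m = (\<Sum>j\<in>J. c j \<psi>)" using insert by auto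
  obtain n where n: "n \<in> A" "\<forall>\<psi>. lin \<psi> \<longrightarrow> \<psi> n = c j \<psi>" using insert.prems by auto
  show ?case
    using m n insert.hyps
    by (intro bexI[of _ "n \<oplus>\<^bsub>B\<^esub> m"]) (auto simp: lin_add submodule_add A_submodule)
qed

text \<open>\<open>F\<close> is a nonzero integral \<open>P (f j)\<close>. An element \<open>a\<close> with \<open>F a \<noteq> 0\<close> is written in terms of integrals \<open>\<Lambda>\<^sub>i\<close> as
  in \<open>sum_Q\<close>. Applying the integral \<open>F\<close> to this expression gives \<open>F a = \<Sum> F(\<Lambda>\<^sub>i) f\<^sub>i(1)\<close> up to a common
  denominator, so that \<open>F\<close> is nonzero on one of the \<open>\<Lambda>\<^sub>i\<close>.\<close>

theorem exists_dual_integrals: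
  obtains F \<Lambda> where "right_integral_on F" "left_integral_in \<Lambda>" "F \<Lambda> \<noteq> 0"
proof -
  obtain X where X: "generated_by X A" using A_generated by blast
  obtain E f where E: "finite E" "E \<subseteq> A" "\<And>e. e \<in> E \<Longrightarrow> lin (f e)"
    and dual: "\<And>\<beta> a. lin \<beta> \<Longrightarrow> a \<in> A \<Longrightarrow> \<beta> a = (\<Sum>e\<in>E. f e a * \<beta> e)"
    using dual_basis[OF X] by blast
  interpret hopf_sub_basis R B \<iota> cop \<epsilon> S A E f
    by unfold_locales (simp_all add: E dual[symmetric])
  have "\<iota> \<one> \<noteq> 0" using emb_inj[of \<one>] one_not_zero by auto
  then have "(\<Sum>j\<in>E. P (f j) (S j)) \<noteq> 0" by (simp add: sum_P)
  then obtain j where j: "j \<in> E" "P (f j) (S j) \<noteq> 0" by (meson sum.neutral)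
  define F where "F = P (f j)"
  have F: "right_integral_on F" unfolding F_def using E j by (intro right_integral_P) auto
  then have linF: "lin F" by (simp add: right_integral_on_def)
  obtain d where d: "d \<in> carrier R" "d \<noteq> \<zero>"
    and dfr: "\<And>e a. e \<in> E \<Longrightarrow> a \<in> A \<Longrightarrow> \<exists>r\<in>carrier R. \<iota> d * f e a = \<iota> r"
    using generated_common_denominator[where \<phi>=f, OF X E(1) E(3)] by blast
  from dfr have "\<forall>e\<in>E. \<forall>a\<in>A. \<exists>r. r \<in> carrier R \<and> \<iota> r = \<iota> d * f e a" by fastforce
  then obtain f' where f': "\<And>e a. e \<in> E \<Longrightarrow> a \<in> A \<Longrightarrow> f' e a \<in> carrier R"
    "\<And>e a. e \<in> E \<Longrightarrow> a \<in> A \<Longrightarrow> \<iota> (f' e a) = \<iota> d * f e a"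
    by metis
  have "\<exists>\<Lambda>\<in>A. \<forall>\<psi>. lin \<psi> \<longrightarrow> \<psi> \<Lambda> = (\<Sum>e\<in>E. \<iota> d * D (\<lambda>u v. \<psi> u * f e (S (S v))) (e \<star> x))"
    if x: "x \<in> A" for x
  proof (rule A_sum_element[OF E(1)])
    fix e assume e: "e \<in> E"
    let ?m = "DB (\<lambda>u v. f' e (S (S v)) \<odot>\<^bsub>B\<^esub> u) (e \<star> x)"
    have ex: "e \<star> x \<in> A" using e x by simp
    have "?m \<in> A"
      unfolding DB_def using A_cop[OF ex] f'(1)[OF e] submodule_smult[OF A_submodule]
      by (intro A_msum) auto
    moreover have "\<psi> ?m = \<iota> d * D (\<lambda>u v. \<psi> u * f e (S (S v))) (e \<star> x)" if \<psi>: "lin \<psi>" for \<psi>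
    proof -
      have "\<psi> ?m = (\<Sum>m\<leftarrow>map (\<lambda>(u, v). f' e (S (S v)) \<odot>\<^bsub>B\<^esub> u) (cop (e \<star> x)). \<psi> m)"
        unfolding DB_def using A_cop[OF ex] f'(1)[OF e] submodule_smult[OF A_submodule]
        by (intro lin_msum \<psi>) auto
      also have "\<dots> = D (\<lambda>u v. \<psi> (f' e (S (S v)) \<odot>\<^bsub>B\<^esub> u)) (e \<star> x)"
        by (simp add: D_def o_def case_prod_unfold)
      also have "\<dots> = D (\<lambda>u v. \<iota> d * (\<psi> u * f e (S (S v)))) (e \<star> x)"
        using f' e \<psi> by (intro D_cong_sub ex) (simp add: lin_smult ac_simps)
      finally show ?thesis by (simp add: D_const_mult)
    qed
    ultimately show "\<exists>m\<in>A. \<forall>\<psi>. lin \<psi> \<longrightarrow> \<psi> m = \<iota> d * D (\<lambda>u v. \<psi> u * f e (S (S v))) (e \<star> x)"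
      by blast
  qed
  then have "\<exists>\<Lambda>\<in>A. \<forall>\<psi>. lin \<psi> \<longrightarrow> \<psi> \<Lambda> = \<iota> d * Q \<psi> x" if "x \<in> A" for x
    using that by (simp add: Q_def sum_distrib_left)
  then obtain \<Lambda> where \<Lambda>: "\<And>x. x \<in> A \<Longrightarrow> \<Lambda> x \<in> A" "\<And>x \<psi>. x \<in> A \<Longrightarrow> lin \<psi> \<Longrightarrow> \<psi> (\<Lambda> x) = \<iota> d * Q \<psi> x"
    by metis
  have int: "left_integral_in (\<Lambda> x)" if x: "x \<in> A" for x
    unfolding left_integral_in_def
  proof (intro conjI ballI \<Lambda> x)
    fix a assume a: "a \<in> A"
    show "a \<star> \<Lambda> x = \<epsilon> a \<odot>\<^bsub>B\<^esub> \<Lambda> x"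
    proof (rule eq_by_functionals)
      fix \<psi> assume \<psi>: "lin \<psi>"
      have "\<psi> (a \<star> \<Lambda> x) = \<iota> d * Q (\<lambda>u. \<psi> (a \<star> u)) x"
        by (rule \<Lambda>(2)[OF x, where \<psi>="\<lambda>u. \<psi> (a \<star> u)"])
          (use a in \<open>(intro lin_intros lin_comp[OF \<psi>])?; simp\<close>)+
      also have "\<dots> = eps a * \<psi> (\<Lambda> x)"
        using \<psi> x a by (simp add: Q_left_invariant \<Lambda>(2) mult.left_commute)
      finally show "\<psi> (a \<star> \<Lambda> x) = \<psi> (\<epsilon> a \<odot>\<^bsub>B\<^esub> \<Lambda> x)"
        using \<psi> a x \<Lambda>(1) by (simp add: lin_smult)
    qed (use a x \<Lambda>(1) in simp_all)
  qed
  have "\<exists>i\<in>E. F (\<Lambda> (i \<star> S j)) \<noteq> 0"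
  proof (rule ccontr)
    assume neg: "\<not> (\<exists>i\<in>E. F (\<Lambda> (i \<star> S j)) \<noteq> 0)"
    have "\<iota> d * Q (D (\<lambda>u w. F u * f i (S w))) (i \<star> S j) = 0" if i: "i \<in> E" for i
    proof -
      have "\<iota> d * Q (D (\<lambda>u w. F u * f i (S w))) (i \<star> S j) = D (\<lambda>u w. F u * f i (S w)) (\<Lambda> (i \<star> S j))"
        by (rule \<Lambda>(2)[symmetric])
          (use i j in \<open>(intro lin_D lin_intros lin_comp[OF linF] lin_comp[OF lin_f])?; simp\<close>)+
      also have "\<dots> = F (\<Lambda> (i \<star> S j)) * f i (S \<one>\<^bsub>B\<^esub>)"
      proof -
        have "lin (\<lambda>w. f i (S w))"
          using i by ((intro lin_intros lin_comp[OF lin_f])?; simp)+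
        then show ?thesis
          using F \<Lambda>(1)[of "i \<star> S j"] i j unfolding right_integral_on_def by auto
      qed
      finally show ?thesis using neg i by simp
    qed
    then have "\<iota> d * F (S j) = 0"
      using sum_Q[OF linF, of "S j", symmetric] j by (simp add: sum_distrib_left)
    then have "F (S j) = 0"
      using emb_cancel[OF d] lin_value[OF linF] j by simp
    then show False using j by (simp add: F_def)
  qed
  then obtain i where "i \<in> E" "F (\<Lambda> (i \<star> S j)) \<noteq> 0" by blast
  then show ?thesis using that[OF F int[of "i \<star> S j"]] j by simp
qed

end

context finite_hopf_sub
begin

section \<open>Integrals on the algebra induce integrals on the quotient\<close>

lemma finite_hopf_sub_opp: "finite_hopf_sub R (opp B) \<iota> cop' \<epsilon> S A"
proof -
  have eq: "add_monoid (opp B) = add_monoid B" by simp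
  have sub: "submodule N R (opp B) \<longleftrightarrow> submodule N R B" for N
    unfolding submodule_def submodule_axioms_def eq opp_simps ..
  have gen: "torsion_free_module.generated_by R (opp B) X A \<longleftrightarrow> generated_by X A" for X
    unfolding torsion_free_module.generated_by_def[OF torsion_free_module_opp] generated_by_def sub opp_simps ..
  show ?thesis
  proof (intro finite_hopf_sub.intro hopf_sub.intro hopf_calculus_opp hopf_sub_axioms.intro
        finite_hopf_sub_axioms.intro, unfold opp_simps sub gen)
    fix a x y assume a: "a \<in> A" and "(x, y) \<in> set (cop' a)"
    then have "(y, x) \<in> set (cop a)" by auto
    then show "x \<in> A \<and> y \<in> A" using A_cop[OF a] by blast
  next
    fix r x assume "r \<in> carrier R" "r \<noteq> \<zero>" "x \<in> carrier B" "r \<odot>\<^bsub>B\<^esub> x \<in> A"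
    then show "x \<in> A" by (rule A_saturated)
  qed (use A_submodule A_generated in simp_all)
qed

lemma exists_dual_integrals_opp:
  obtains G \<Lambda> where "lin G" "\<And>h \<psi>. h \<in> A \<Longrightarrow> lin \<psi> \<Longrightarrow> D (\<lambda>x y. \<psi> x * G y) h = G h * \<psi> \<one>\<^bsub>B\<^esub>"
    "\<Lambda> \<in> A" "\<And>a. a \<in> A \<Longrightarrow> \<Lambda> \<star> a = \<epsilon> a \<odot>\<^bsub>B\<^esub> \<Lambda>" "G \<Lambda> \<noteq> 0"
proof -
  interpret opp: finite_hopf_sub R "opp B" \<iota> cop' \<epsilon> S A by (rule finite_hopf_sub_opp)
  obtain G \<Lambda> where *: "opp.right_integral_on G" "opp.left_integral_in \<Lambda>" "G \<Lambda> \<noteq> 0"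
    using opp.exists_dual_integrals by blast
  show ?thesis
  proof (rule that[of G \<Lambda>])
    show "lin G" using *(1) by (simp add: opp.right_integral_on_def lin_opp)
    show "D (\<lambda>x y. \<psi> x * G y) h = G h * \<psi> \<one>\<^bsub>B\<^esub>" if "h \<in> A" "lin \<psi>" for h \<psi>
      using *(1)[unfolded opp.right_integral_on_def lin_opp D_opp, THEN conjunct2, rule_format, OF that]
      by (simp add: mult.commute)
  qed (use * in \<open>auto simp: opp.left_integral_in_def\<close>)
qed

definition aug :: "'b set" where "aug = {a \<in> A. \<epsilon> a = \<zero>}"

lemma augD: "a \<in> aug \<Longrightarrow> a \<in> A" "a \<in> aug \<Longrightarrow> \<epsilon> a = \<zero>"
  by (auto simp: aug_def)

lemma augI:
  assumes "a \<in> A" "eps a = 0"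
  shows "a \<in> aug"
  using assms emb_inj[of "\<epsilon> a"] by (simp add: aug_def)

lemma aug_diff:
  assumes a: "a \<in> A"
  shows "a \<ominus>\<^bsub>B\<^esub> \<epsilon> a \<odot>\<^bsub>B\<^esub> \<one>\<^bsub>B\<^esub> \<in> aug"
proof (rule augI)
  show "a \<ominus>\<^bsub>B\<^esub> \<epsilon> a \<odot>\<^bsub>B\<^esub> \<one>\<^bsub>B\<^esub> \<in> A"
    using a by (intro submodule_minus[OF A_submodule] submodule_smult[OF A_submodule]) auto
  show "eps (a \<ominus>\<^bsub>B\<^esub> \<epsilon> a \<odot>\<^bsub>B\<^esub> \<one>\<^bsub>B\<^esub>) = 0"
    using a lin_minus[OF lin_eps, of a "\<epsilon> a \<odot>\<^bsub>B\<^esub> \<one>\<^bsub>B\<^esub>"] lin_smult[OF lin_eps, of "\<epsilon> a" "\<one>\<^bsub>B\<^esub>"]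
    by (simp add: mult.commute[of _ "\<iota> \<one>"])
qed

abbreviation I :: "'b set" where "I \<equiv> ideal_prod B (carrier B) aug"

lemma I_carrier: "i \<in> I \<Longrightarrow> i \<in> carrier B"
  by (induction rule: ideal_prod.induct) (auto dest: augD)

lemma I_add: "i \<in> I \<Longrightarrow> j \<in> I \<Longrightarrow> i \<oplus>\<^bsub>B\<^esub> j \<in> I"
  by (rule ideal_prod.sum)

lemma I_mult: "b \<in> carrier B \<Longrightarrow> a \<in> aug \<Longrightarrow> b \<star> a \<in> I"
  by (rule ideal_prod.prod)

lemma I_zero: "\<zero>\<^bsub>B\<^esub> \<in> I"
proof -
  have "\<zero>\<^bsub>B\<^esub> \<in> aug"
    by (rule augI) (auto simp: submodule_zero A_submodule lin_zero[OF lin_eps])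
  from I_mult[OF B.one_closed this] show ?thesis by simp
qed

lemma I_smult: "i \<in> I \<Longrightarrow> r \<in> carrier R \<Longrightarrow> r \<odot>\<^bsub>B\<^esub> i \<in> I"
proof (induction rule: ideal_prod.induct)
  case (prod b a)
  then have "r \<odot>\<^bsub>B\<^esub> (b \<star> a) = (r \<odot>\<^bsub>B\<^esub> b) \<star> a"
    using augD by (simp add: smult_mult_left)
  then show ?case using prod by (auto intro: ideal_prod.prod)
next
  case (sum i j)
  then show ?case by (auto simp: smult_r_distr I_carrier intro: ideal_prod.sum)
qed

lemma I_submodule: "submodule I R B"
  by (rule submodule_if_closed) (auto simp: I_zero I_add I_smult dest: I_carrier)

lemma I_msum: "set xs \<subseteq> I \<Longrightarrow> msum B xs \<in> I"
  by (rule msum_in) (auto simp: I_zero I_add)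

lemma DB_in_I:
  assumes "b \<in> carrier B" "\<And>x y. x \<in> carrier B \<Longrightarrow> y \<in> carrier B \<Longrightarrow> h x y \<in> I"
  shows "DB h b \<in> I"
  unfolding DB_def using cop_closed[OF assms(1)] assms(2) by (intro I_msum) auto

definition left_integral_on_algebra :: "('b \<Rightarrow> 'r) \<Rightarrow> bool" where
  "left_integral_on_algebra \<phi> \<longleftrightarrow> lin_to_R \<phi> \<and>
     (\<forall>b\<in>carrier B. DB (\<lambda>x y. \<phi> y \<odot>\<^bsub>B\<^esub> x) b = \<phi> b \<odot>\<^bsub>B\<^esub> \<one>\<^bsub>B\<^esub>)"

definition left_integral_on_quotient :: "('b \<Rightarrow> 'r) \<Rightarrow> bool" where
  "left_integral_on_quotient \<phi> \<longleftrightarrow> lin_to_R \<phi> \<and> (\<forall>i\<in>I. \<phi> i = \<zero>) \<and>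
     (\<forall>b\<in>carrier B. DB (\<lambda>x y. \<phi> y \<odot>\<^bsub>B\<^esub> x) b \<ominus>\<^bsub>B\<^esub> \<phi> b \<odot>\<^bsub>B\<^esub> \<one>\<^bsub>B\<^esub> \<in> I)"

text \<open>The identity \<open>\<Sum> c\<^sub>1 \<phi>(b c\<^sub>2) = \<Sum> S(b\<^sub>1) \<phi>(b\<^sub>2 c)\<close>: write the right-hand side as
  \<open>\<Sum> S(b\<^sub>1) (b\<^sub>2 c)\<^sub>1 \<phi>((b\<^sub>2 c)\<^sub>2)\<close> and contract \<open>S(b\<^sub>1) b\<^sub>2\<close>.\<close>

lemma integral_shift:
  assumes \<phi>: "lin \<phi>" "\<And>c \<psi>. c \<in> carrier B \<Longrightarrow> lin \<psi> \<Longrightarrow> D (\<lambda>x y. \<psi> x * \<phi> y) c = \<phi> c * \<psi> \<one>\<^bsub>B\<^esub>"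
    and \<psi>: "lin \<psi>" and b: "b \<in> carrier B" and c: "c \<in> carrier B"
  shows "D (\<lambda>u v. \<psi> u * \<phi> (b \<star> v)) c = D (\<lambda>x y. \<psi> (S x) * \<phi> (y \<star> c)) b"
proof -
  note J = lin_intros lin_comp[OF \<phi>(1)] lin_comp[OF \<psi>]
  have "D (\<lambda>x y. \<psi> (S x) * \<phi> (y \<star> c)) b = D (\<lambda>x z. D (\<lambda>p q. \<psi> (S x \<star> p) * \<phi> q) (z \<star> c)) b"
  proof (intro D_cong b)
    fix x z assume [simp]: "x \<in> carrier B" "z \<in> carrier B"
    have "D (\<lambda>p q. \<psi> (S x \<star> p) * \<phi> q) (z \<star> c) = \<phi> (z \<star> c) * \<psi> (S x \<star> \<one>\<^bsub>B\<^esub>)"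
      by (rule \<phi>(2)[where \<psi>="\<lambda>p. \<psi> (S x \<star> p)"]) ((intro J c)?; simp add: c)+
    then show "\<psi> (S x) * \<phi> (z \<star> c) = D (\<lambda>p q. \<psi> (S x \<star> p) * \<phi> q) (z \<star> c)"
      by (simp add: mult.commute)
  qed
  also have "\<dots> = D (\<lambda>x z. D (\<lambda>p q. D (\<lambda>u v. \<psi> (S x \<star> (p \<star> u)) * \<phi> (q \<star> v)) c) z) b"
    by (intro D_cong b D_mult) ((intro J)?; simp add: c)+
  also have "\<dots> = D (\<lambda>w q. D (\<lambda>x p. D (\<lambda>u v. \<psi> (S x \<star> (p \<star> u)) * \<phi> (q \<star> v)) c) w) b"
    by (rule coassoc[symmetric]) ((intro J b c)?; simp add: c)+
  also have "\<dots> = D (\<lambda>w q. eps w * D (\<lambda>u v. \<psi> u * \<phi> (q \<star> v)) c) b"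
  proof (intro D_cong b)
    fix w q assume [simp]: "w \<in> carrier B" "q \<in> carrier B"
    have "D (\<lambda>x p. D (\<lambda>u v. \<psi> (S x \<star> (p \<star> u)) * \<phi> (q \<star> v)) c) w =
        D (\<lambda>x p. D (\<lambda>u v. \<psi> ((S x \<star> p) \<star> u) * \<phi> (q \<star> v)) c) w"
      by (intro D_cong c) (simp_all add: B.m_assoc)
    also have "\<dots> = eps w * D (\<lambda>u v. \<psi> (\<one>\<^bsub>B\<^esub> \<star> u) * \<phi> (q \<star> v)) c"
      by (rule antipode_left[where \<psi>="\<lambda>t. D (\<lambda>u v. \<psi> (t \<star> u) * \<phi> (q \<star> v)) c"])
        ((intro J c)?; simp)+
    also have "D (\<lambda>u v. \<psi> (\<one>\<^bsub>B\<^esub> \<star> u) * \<phi> (q \<star> v)) c = D (\<lambda>u v. \<psi> u * \<phi> (q \<star> v)) c"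
      by (intro D_cong c) simp
    finally show "D (\<lambda>x p. D (\<lambda>u v. \<psi> (S x \<star> (p \<star> u)) * \<phi> (q \<star> v)) c) w =
        eps w * D (\<lambda>u v. \<psi> u * \<phi> (q \<star> v)) c" .
  qed
  also have "\<dots> = D (\<lambda>u v. \<psi> u * \<phi> (b \<star> v)) c"
    by (rule counit_left[where \<psi>="\<lambda>t. D (\<lambda>u v. \<psi> u * \<phi> (t \<star> v)) c"]) ((intro J b c)?; simp)+
  finally show ?thesis by simp
qed

text \<open>The map \<open>\<phi>' b = \<phi>(b \<Lambda>)\<close> vanishes on \<open>B A\<^sup>+\<close> because \<open>a \<Lambda> = 0\<close> for \<open>a \<in> A\<^sup>+\<close>. It is an integral modulo \<open>I\<close>
  because \<open>b\<^sub>1 \<Lambda>\<^sub>1\<close> is congruent to \<open>\<epsilon>(\<Lambda>\<^sub>1) b\<^sub>1\<close>. If it were zero, then \<open>\<Sum> \<Lambda>\<^sub>1 \<phi>(b \<Lambda>\<^sub>2) = 0\<close> by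
  \<open>integral_shift\<close>, and applying \<open>F\<close> would give \<open>F(\<Lambda>) \<phi>(b) = 0\<close>.\<close>

theorem left_integral_algebra_to_quotient:
  assumes \<phi>: "left_integral_on_algebra \<phi>" and nz: "\<exists>b\<in>carrier B. \<phi> b \<noteq> \<zero>"
  shows "\<exists>\<phi>'. left_integral_on_quotient \<phi>' \<and> (\<exists>b\<in>carrier B. \<phi>' b \<noteq> \<zero>)"
proof -
  obtain F \<Lambda> where F: "right_integral_on F" and \<Lambda>: "left_integral_in \<Lambda>" and F\<Lambda>: "F \<Lambda> \<noteq> 0"
    by (rule exists_dual_integrals)
  have linF: "lin F" using F by (simp add: right_integral_on_def)
  have \<Lambda>A: "\<Lambda> \<in> A" and \<Lambda>inv: "\<And>a. a \<in> A \<Longrightarrow> a \<star> \<Lambda> = \<epsilon> a \<odot>\<^bsub>B\<^esub> \<Lambda>"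
    using \<Lambda> by (auto simp: left_integral_in_def)
  have [simp]: "\<Lambda> \<in> carrier B" using \<Lambda>A by simp
  have r\<phi>: "lin_to_R \<phi>" using \<phi> by (simp add: left_integral_on_algebra_def)
  have [simp]: "\<phi> x \<in> carrier R" if "x \<in> carrier B" for x using lin_to_R_closed[OF r\<phi> that] .
  have lin\<phi>: "lin (\<lambda>x. \<iota> (\<phi> x))" by (rule lin_to_R_lin[OF r\<phi>])
  have int: "D (\<lambda>x y. \<psi> x * \<iota> (\<phi> y)) c = \<iota> (\<phi> c) * \<psi> \<one>\<^bsub>B\<^esub>" if c: "c \<in> carrier B" and \<psi>: "lin \<psi>" for c \<psi>
  proof -
    have "D (\<lambda>x y. \<psi> x * \<iota> (\<phi> y)) c = D (\<lambda>x y. \<psi> (\<phi> y \<odot>\<^bsub>B\<^esub> x)) c"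
      by (intro D_cong c) (simp add: lin_smult[OF \<psi>] mult.commute)
    also have "\<dots> = \<psi> (DB (\<lambda>x y. \<phi> y \<odot>\<^bsub>B\<^esub> x) c)"
      by (rule lin_DB[symmetric]) (use \<psi> c in auto)
    also have "\<dots> = \<psi> (\<phi> c \<odot>\<^bsub>B\<^esub> \<one>\<^bsub>B\<^esub>)" using \<phi> c by (simp add: left_integral_on_algebra_def)
    finally show ?thesis using c by (simp add: lin_smult[OF \<psi>])
  qed
  define \<phi>' where "\<phi>' b = \<phi> (b \<star> \<Lambda>)" for b
  have r\<phi>': "lin_to_R \<phi>'"
    using r\<phi> unfolding lin_to_R_def \<phi>'_def by (auto simp: Pi_iff B.l_distr smult_mult_left)
  have "\<phi>' i = \<zero>" if "i \<in> I" for i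
    using that
  proof (induction rule: ideal_prod.induct)
    case (prod b a)
    then have "(b \<star> a) \<star> \<Lambda> = b \<star> (\<epsilon> a \<odot>\<^bsub>B\<^esub> \<Lambda>)"
      using augD \<Lambda>inv[of a] by (simp add: B.m_assoc)
    also have "\<dots> = \<zero>\<^bsub>B\<^esub>" using prod augD by simp
    finally show ?case by (simp add: \<phi>'_def lin_to_R_zero[OF r\<phi>])
  next
    case (sum i j)
    then show ?case using r\<phi>' I_carrier by (simp add: lin_to_R_def)
  qed
  moreover have "DB (\<lambda>x y. \<phi>' y \<odot>\<^bsub>B\<^esub> x) b \<ominus>\<^bsub>B\<^esub> \<phi>' b \<odot>\<^bsub>B\<^esub> \<one>\<^bsub>B\<^esub> \<in> I" if b: "b \<in> carrier B" for b
  proof -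
    have [simp]: "\<phi>' x \<in> carrier R" if "x \<in> carrier B" for x using lin_to_R_closed[OF r\<phi>' that] .
    define Z where "Z = DB (\<lambda>x y. DB (\<lambda>u v. \<phi> (y \<star> v) \<odot>\<^bsub>B\<^esub> (x \<star> (\<epsilon> u \<odot>\<^bsub>B\<^esub> \<one>\<^bsub>B\<^esub> \<ominus>\<^bsub>B\<^esub> u))) \<Lambda>) b"
    have "Z \<in> I"
      unfolding Z_def
    proof (rule DB_in_I[OF b])
      fix x y assume xy: "x \<in> carrier B" "y \<in> carrier B"
      show "DB (\<lambda>u v. \<phi> (y \<star> v) \<odot>\<^bsub>B\<^esub> (x \<star> (\<epsilon> u \<odot>\<^bsub>B\<^esub> \<one>\<^bsub>B\<^esub> \<ominus>\<^bsub>B\<^esub> u))) \<Lambda> \<in> I"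
        unfolding DB_def
      proof (rule I_msum, clarsimp)
        fix u v assume "(u, v) \<in> set (cop \<Lambda>)"
        then have uv: "u \<in> A" "v \<in> A" using A_cop[OF \<Lambda>A] by auto
        have "u \<ominus>\<^bsub>B\<^esub> \<epsilon> u \<odot>\<^bsub>B\<^esub> \<one>\<^bsub>B\<^esub> \<in> aug" using aug_diff uv by blast
        then have "x \<star> (u \<ominus>\<^bsub>B\<^esub> \<epsilon> u \<odot>\<^bsub>B\<^esub> \<one>\<^bsub>B\<^esub>) \<in> I" using xy by (intro I_mult) auto
        then have "(\<ominus> \<one>) \<odot>\<^bsub>B\<^esub> (x \<star> (u \<ominus>\<^bsub>B\<^esub> \<epsilon> u \<odot>\<^bsub>B\<^esub> \<one>\<^bsub>B\<^esub>)) \<in> I" by (rule I_smult) simp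
        also have "(\<ominus> \<one>) \<odot>\<^bsub>B\<^esub> (x \<star> (u \<ominus>\<^bsub>B\<^esub> \<epsilon> u \<odot>\<^bsub>B\<^esub> \<one>\<^bsub>B\<^esub>)) = x \<star> (\<epsilon> u \<odot>\<^bsub>B\<^esub> \<one>\<^bsub>B\<^esub> \<ominus>\<^bsub>B\<^esub> u)"
          using uv xy by (simp add: smult_l_minus B.r_minus[symmetric] M.minus_eq M.minus_add M.a_comm)
        finally show "\<phi> (y \<star> v) \<odot>\<^bsub>B\<^esub> (x \<star> (\<epsilon> u \<odot>\<^bsub>B\<^esub> \<one>\<^bsub>B\<^esub> \<ominus>\<^bsub>B\<^esub> u)) \<in> I"
          using xy uv by (intro I_smult) auto
      qed
    qed
    also have "Z = DB (\<lambda>x y. \<phi>' y \<odot>\<^bsub>B\<^esub> x) b \<ominus>\<^bsub>B\<^esub> \<phi>' b \<odot>\<^bsub>B\<^esub> \<one>\<^bsub>B\<^esub>"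
    proof (rule eq_by_functionals)
      show "Z \<in> carrier B" using \<open>Z \<in> I\<close> I_carrier by blast
      show "DB (\<lambda>x y. \<phi>' y \<odot>\<^bsub>B\<^esub> x) b \<ominus>\<^bsub>B\<^esub> \<phi>' b \<odot>\<^bsub>B\<^esub> \<one>\<^bsub>B\<^esub> \<in> carrier B"
        using b by (intro M.minus_closed DB_closed) auto
      fix \<psi> assume \<psi>: "lin \<psi>"
      note J = lin_intros lin_comp[OF lin\<phi>] lin_comp[OF \<psi>] lin_comp[OF lin_eps]
      have "\<psi> Z = D (\<lambda>x y. D (\<lambda>u v. \<iota> (\<phi> (y \<star> v)) * (eps u * \<psi> x - \<psi> (x \<star> u))) \<Lambda>) b"
      proof -
        have "\<psi> Z = D (\<lambda>x y. \<psi> (DB (\<lambda>u v. \<phi> (y \<star> v) \<odot>\<^bsub>B\<^esub> (x \<star> (\<epsilon> u \<odot>\<^bsub>B\<^esub> \<one>\<^bsub>B\<^esub> \<ominus>\<^bsub>B\<^esub> u))) \<Lambda>)) b"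
          unfolding Z_def using b by (intro lin_DB \<psi> DB_closed) auto
        also have "\<dots> = D (\<lambda>x y. D (\<lambda>u v. \<psi> (\<phi> (y \<star> v) \<odot>\<^bsub>B\<^esub> (x \<star> (\<epsilon> u \<odot>\<^bsub>B\<^esub> \<one>\<^bsub>B\<^esub> \<ominus>\<^bsub>B\<^esub> u)))) \<Lambda>) b"
          using b by (intro D_cong lin_DB \<psi>) auto
        also have "\<dots> = D (\<lambda>x y. D (\<lambda>u v. \<iota> (\<phi> (y \<star> v)) * (eps u * \<psi> x - \<psi> (x \<star> u))) \<Lambda>) b"
        proof (intro D_cong b)
          fix x y u v assume [simp]: "x \<in> carrier B" "y \<in> carrier B" "u \<in> carrier B" "v \<in> carrier B"
          have "lin (\<lambda>t. \<psi> (x \<star> t))" by ((intro J)?; simp)+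
          from lin_minus[OF this, of "\<epsilon> u \<odot>\<^bsub>B\<^esub> \<one>\<^bsub>B\<^esub>" u]
          show "\<psi> (\<phi> (y \<star> v) \<odot>\<^bsub>B\<^esub> (x \<star> (\<epsilon> u \<odot>\<^bsub>B\<^esub> \<one>\<^bsub>B\<^esub> \<ominus>\<^bsub>B\<^esub> u))) = \<iota> (\<phi> (y \<star> v)) * (eps u * \<psi> x - \<psi> (x \<star> u))"
            by (simp add: lin_smult[OF \<psi>] smult_mult_right)
        qed simp
        finally show ?thesis .
      qed
      also have "\<dots> = D (\<lambda>x y. D (\<lambda>u v. eps u * (\<iota> (\<phi> (y \<star> v)) * \<psi> x)) \<Lambda>) b - D (\<lambda>x y. D (\<lambda>u v. \<psi> (x \<star> u) * \<iota> (\<phi> (y \<star> v))) \<Lambda>) b"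
        unfolding D_diff[symmetric] by (simp add: right_diff_distrib mult_ac)
      also have "D (\<lambda>x y. D (\<lambda>u v. \<psi> (x \<star> u) * \<iota> (\<phi> (y \<star> v))) \<Lambda>) b = D (\<lambda>x y. \<psi> x * \<iota> (\<phi> y)) (b \<star> \<Lambda>)"
        by (rule D_mult[symmetric]) ((intro J b)?; simp)+
      also have "\<dots> = \<iota> (\<phi>' b) * \<psi> \<one>\<^bsub>B\<^esub>"
        unfolding \<phi>'_def using b by (intro int \<psi>) simp
      also have "D (\<lambda>x y. D (\<lambda>u v. eps u * (\<iota> (\<phi> (y \<star> v)) * \<psi> x)) \<Lambda>) b = D (\<lambda>x y. \<iota> (\<phi>' y) * \<psi> x) b"
      proof (intro D_cong b)
        fix x y assume [simp]: "x \<in> carrier B" "y \<in> carrier B"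
        show "D (\<lambda>u v. eps u * (\<iota> (\<phi> (y \<star> v)) * \<psi> x)) \<Lambda> = \<iota> (\<phi>' y) * \<psi> x"
          unfolding \<phi>'_def
          by (rule counit_left[where \<psi>="\<lambda>t. \<iota> (\<phi> (y \<star> t)) * \<psi> x"]) ((intro J)?; simp)+
      qed
      also have "\<dots> = \<psi> (DB (\<lambda>x y. \<phi>' y \<odot>\<^bsub>B\<^esub> x) b)"
        using b \<psi> by (subst lin_DB) (auto simp: lin_smult intro!: D_cong)
      finally show "\<psi> Z = \<psi> (DB (\<lambda>x y. \<phi>' y \<odot>\<^bsub>B\<^esub> x) b \<ominus>\<^bsub>B\<^esub> \<phi>' b \<odot>\<^bsub>B\<^esub> \<one>\<^bsub>B\<^esub>)"
        using b lin_minus[OF \<psi>, of "DB (\<lambda>x y. \<phi>' y \<odot>\<^bsub>B\<^esub> x) b" "\<phi>' b \<odot>\<^bsub>B\<^esub> \<one>\<^bsub>B\<^esub>"]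
        by (simp add: lin_smult[OF \<psi>] DB_closed)
    qed
    finally show ?thesis .
  qed
  ultimately have "left_integral_on_quotient \<phi>'"
    using r\<phi>' by (simp add: left_integral_on_quotient_def)
  moreover have "\<exists>b\<in>carrier B. \<phi>' b \<noteq> \<zero>"
  proof (rule ccontr)
    assume "\<not> (\<exists>b\<in>carrier B. \<phi>' b \<noteq> \<zero>)"
    then have z: "\<And>b. b \<in> carrier B \<Longrightarrow> \<phi> (b \<star> \<Lambda>) = \<zero>" by (auto simp: \<phi>'_def)
    obtain b where b: "b \<in> carrier B" "\<phi> b \<noteq> \<zero>" using nz by blast
    have "D (\<lambda>u v. F u * \<iota> (\<phi> (b \<star> v))) \<Lambda> = D (\<lambda>x y. F (S x) * \<iota> (\<phi> (y \<star> \<Lambda>))) b"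
      by (rule integral_shift[OF lin\<phi> int linF b(1)]) auto
    also have "\<dots> = D (\<lambda>x y. 0) b" by (intro D_cong b) (simp add: z)
    finally have "D (\<lambda>u v. F u * \<iota> (\<phi> (b \<star> v))) \<Lambda> = 0" by (simp add: D_zero)
    moreover have "lin (\<lambda>v. \<iota> (\<phi> (b \<star> v)))"
      using b by ((intro lin_intros lin_comp[OF lin\<phi>])?; simp)+
    ultimately have "F \<Lambda> * \<iota> (\<phi> b) = 0"
      using F \<Lambda>A b(1) by (simp add: right_integral_on_def)
    then have "\<iota> (\<phi> b) = 0"
      using b lin_value[OF linF] F\<Lambda> by (intro value_cancel[of "F \<Lambda>" "\<iota> (\<phi> b)"]) auto
    then show False using emb_inj b by simp
  qed
  ultimately show ?thesis by blast
qed

end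

section \<open>Integrals on the quotient induce integrals on the algebra\<close>

locale normal_hopf_sub = finite_hopf_sub R B \<iota> cop \<epsilon> S A
  for R :: "('r, 'x) ring_scheme" (structure) and B :: "('r, 'b, 'y) module_scheme" (structure)
    and \<iota> :: "'r \<Rightarrow> 'k :: comm_ring" and cop \<epsilon> S A +
  assumes normal_left: "\<lbrakk> a \<in> A; b \<in> carrier B \<rbrakk> \<Longrightarrow> DB (\<lambda>x y. x \<star> a \<star> S y) b \<in> A"
    and normal_right: "\<lbrakk> a \<in> A; b \<in> carrier B \<rbrakk> \<Longrightarrow> DB (\<lambda>x y. S x \<star> a \<star> y) b \<in> A"
begin

text \<open>\<open>b a = \<Sum> (b\<^sub>1 a S(b\<^sub>2)) b\<^sub>3\<close>, and by normality \<open>\<Sum> b\<^sub>1 a S(b\<^sub>2)\<close> lies in \<open>A\<close>; its counit is \<open>\<epsilon>(b) \<epsilon>(a) = 0\<close>.\<close>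

lemma ideal_subset_opp: "I \<subseteq> ideal_prod (opp B) (carrier B) aug"
proof
  fix i assume "i \<in> I"
  then show "i \<in> ideal_prod (opp B) (carrier B) aug"
  proof (induction rule: ideal_prod.induct)
    case (prod b a)
    then have b [simp]: "b \<in> carrier B" and a: "a \<in> aug" "a \<in> A" by (auto dest: augD)
    then have aB [simp]: "a \<in> carrier B" by simp
    define N where "N x = DB (\<lambda>p q. p \<star> a \<star> S q) x" for x
    have NA: "N x \<in> A" if "x \<in> carrier B" for x
      unfolding N_def using a that by (intro normal_left)
    have N_lin: "\<psi> (N x) = D (\<lambda>p q. \<psi> (p \<star> a \<star> S q)) x" if "x \<in> carrier B" "lin \<psi>" for x \<psi>
      unfolding N_def by (rule lin_DB) (use that in auto)
    have Naug: "N x \<in> aug" if x: "x \<in> carrier B" for x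
    proof (rule augI[OF NA[OF x]])
      have "eps (N x) = D (\<lambda>p q. eps (p \<star> a \<star> S q)) x" by (rule N_lin[OF x lin_eps])
      also have "\<dots> = D (\<lambda>p q. 0) x"
        by (intro D_cong x) (simp add: eps_mult augD(2)[OF a(1)])
      finally show "eps (N x) = 0" by (simp add: D_zero)
    qed
    have "b \<star> a = DB (\<lambda>x y. N x \<star> y) b"
    proof (rule eq_by_functionals)
      show "DB (\<lambda>x y. N x \<star> y) b \<in> carrier B" using NA by (intro DB_closed) auto
      fix \<psi> assume \<psi>: "lin \<psi>"
      note J = lin_intros lin_comp[OF \<psi>]
      have "\<psi> (DB (\<lambda>x y. N x \<star> y) b) = D (\<lambda>x y. \<psi> (N x \<star> y)) b"
        by (rule lin_DB[OF \<psi>]) (use NA in auto)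
      also have "\<dots> = D (\<lambda>x y. D (\<lambda>p q. \<psi> (p \<star> a \<star> S q \<star> y)) x) b"
      proof (intro D_cong b)
        fix x y assume [simp]: "x \<in> carrier B" "y \<in> carrier B"
        show "\<psi> (N x \<star> y) = D (\<lambda>p q. \<psi> (p \<star> a \<star> S q \<star> y)) x"
          by (rule N_lin[where \<psi>="\<lambda>t. \<psi> (t \<star> y)"]) ((intro J)?; simp)+
      qed
      also have "\<dots> = D (\<lambda>p z. D (\<lambda>q y. \<psi> (p \<star> a \<star> S q \<star> y)) z) b"
        by (rule coassoc) ((intro J)?; simp)+
      also have "\<dots> = D (\<lambda>p z. eps z * \<psi> (p \<star> a)) b"
      proof (intro D_cong b)
        fix p z assume [simp]: "p \<in> carrier B" "z \<in> carrier B"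
        have "D (\<lambda>q y. \<psi> (p \<star> a \<star> S q \<star> y)) z = D (\<lambda>q y. \<psi> (p \<star> a \<star> (S q \<star> y))) z"
          by (intro D_cong) (simp_all add: B.m_assoc)
        also have "\<dots> = eps z * \<psi> (p \<star> a \<star> \<one>\<^bsub>B\<^esub>)"
          by (rule antipode_left[where \<psi>="\<lambda>t. \<psi> (p \<star> a \<star> t)"]) ((intro J)?; simp)+
        finally show "D (\<lambda>q y. \<psi> (p \<star> a \<star> S q \<star> y)) z = eps z * \<psi> (p \<star> a)" by simp
      qed
      also have "\<dots> = \<psi> (b \<star> a)"
        by (rule counit_right[where \<psi>="\<lambda>t. \<psi> (t \<star> a)"]) ((intro J)?; simp)+
      finally show "\<psi> (b \<star> a) = \<psi> (DB (\<lambda>x y. N x \<star> y) b)" by simp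
    qed simp
    also have "DB (\<lambda>x y. N x \<star> y) b \<in> ideal_prod (opp B) (carrier B) aug"
      unfolding DB_def
    proof (rule msum_in, goal_cases)
      case 1
      have "\<zero>\<^bsub>B\<^esub> \<in> aug"
        by (rule augI) (auto simp: submodule_zero A_submodule lin_zero[OF lin_eps])
      from ideal_prod.prod[OF B.one_closed this, of "opp B"] show ?case by simp
    next
      case (2 x y)
      then show ?case using ideal_prod.sum[of x "opp B"] by simp
    next
      case 3
      have "N x \<star> y \<in> ideal_prod (opp B) (carrier B) aug" if "x \<in> carrier B" "y \<in> carrier B" for x y
        using ideal_prod.prod[of y "carrier B" "N x" aug "opp B"] that Naug by simp
      then show ?case using cop_closed[OF b] by auto
    qed
    finally show ?case .
  next
    case (sum i j)
    then show ?case using ideal_prod.sum[of i "opp B"] by simp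
  qed
qed

lemma normal_hopf_sub_opp: "normal_hopf_sub R (opp B) \<iota> cop' \<epsilon> S A"
proof (intro normal_hopf_sub.intro finite_hopf_sub_opp normal_hopf_sub_axioms.intro, unfold DB_opp opp_simps)
  fix a b assume a: "a \<in> A" and b: "b \<in> carrier B"
  have "map (\<lambda>(x, y). S x \<star> (a \<star> y)) (cop b) = map (\<lambda>(x, y). S x \<star> a \<star> y) (cop b)"
    using a cop_closed[OF b] by (auto simp: B.m_assoc)
  then show "DB (\<lambda>x y. S x \<star> (a \<star> y)) b \<in> A"
    using normal_right[OF a b] unfolding DB_def by (simp only:)
  have "map (\<lambda>(x, y). x \<star> (a \<star> S y)) (cop b) = map (\<lambda>(x, y). x \<star> a \<star> S y) (cop b)"
    using a cop_closed[OF b] by (auto simp: B.m_assoc)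
  then show "DB (\<lambda>x y. x \<star> (a \<star> S y)) b \<in> A"
    using normal_left[OF a b] unfolding DB_def by (simp only:)
qed

lemma ideal_opp: "ideal_prod (opp B) (carrier B) aug = I"
proof -
  interpret opp: normal_hopf_sub R "opp B" \<iota> cop' \<epsilon> S A by (rule normal_hopf_sub_opp)
  have "opp.aug = aug" by (simp add: opp.aug_def aug_def)
  then show ?thesis
    using opp.ideal_subset_opp ideal_subset_opp by simp
qed

lemma I_mult_right: "b \<in> carrier B \<Longrightarrow> a \<in> aug \<Longrightarrow> a \<star> b \<in> I"
  using ideal_prod.prod[of b "carrier B" a aug "opp B"] unfolding ideal_opp by simp

lemma I_induct [consumes 1, case_names prod sum]:
  assumes "i \<in> I" "\<And>a b. a \<in> aug \<Longrightarrow> b \<in> carrier B \<Longrightarrow> X (a \<star> b)"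
    "\<And>i j. i \<in> I \<Longrightarrow> X i \<Longrightarrow> j \<in> I \<Longrightarrow> X j \<Longrightarrow> X (i \<oplus>\<^bsub>B\<^esub> j)"
  shows "X i"
  using assms(1) unfolding ideal_opp[symmetric]
proof (induction rule: ideal_prod.induct)
  case (prod b a)
  then show ?case using assms(2) by simp
next
  case (sum i j)
  then show ?case using assms(3)[of i j] ideal_opp by simp
qed

text \<open>The identity \<open>\<Sum> a \<Lambda>\<^sub>1 \<otimes> S(\<Lambda>\<^sub>2) = \<Sum> \<Lambda>\<^sub>1 \<otimes> S(\<Lambda>\<^sub>2) a\<close>, obtained from \<open>a\<^sub>1 \<Lambda> = \<epsilon>(a\<^sub>1) \<Lambda>\<close>. It makes the map
  \<open>b \<mapsto> \<Sum> F(b \<Lambda>\<^sub>1) S(\<Lambda>\<^sub>2)\<close> right \<open>A\<close>-linear.\<close>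

lemma shift_antipode:
  assumes \<Lambda>A: "\<Lambda> \<in> A" and inv: "\<And>a. a \<in> A \<Longrightarrow> a \<star> \<Lambda> = \<epsilon> a \<odot>\<^bsub>B\<^esub> \<Lambda>"
    and \<gamma>: "bilin \<gamma>" and a: "a \<in> A"
  shows "D (\<lambda>l m. \<gamma> (a \<star> l) (S m)) \<Lambda> = D (\<lambda>l m. \<gamma> l (S m \<star> a)) \<Lambda>"
proof -
  note J = lin_intros bilin_comp_left[OF \<gamma>] bilin_comp_right[OF \<gamma>]
  have [simp]: "\<Lambda> \<in> carrier B" "a \<in> carrier B" using \<Lambda>A a by auto
  have "D (\<lambda>l m. \<gamma> l (S m \<star> a)) \<Lambda> = D (\<lambda>a1 a2. eps a1 * D (\<lambda>l m. \<gamma> l (S m \<star> a2)) \<Lambda>) a"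
    by (rule counit_left[where \<psi>="\<lambda>t. D (\<lambda>l m. \<gamma> l (S m \<star> t)) \<Lambda>", symmetric]) ((intro J)?; simp)+
  also have "\<dots> = D (\<lambda>a1 a2. D (\<lambda>l m. \<gamma> l (S m \<star> a2)) (a1 \<star> \<Lambda>)) a"
  proof (intro D_cong_sub a)
    fix a1 a2 assume [simp]: "a1 \<in> A" "a2 \<in> A"
    have "lin (D (\<lambda>l m. \<gamma> l (S m \<star> a2)))" by (rule lin_D) ((intro J)?; simp)+
    then show "eps a1 * D (\<lambda>l m. \<gamma> l (S m \<star> a2)) \<Lambda> = D (\<lambda>l m. \<gamma> l (S m \<star> a2)) (a1 \<star> \<Lambda>)"
      by (simp add: inv lin_smult)
  qed
  also have "\<dots> = D (\<lambda>a1 a2. D (\<lambda>p q. D (\<lambda>l m. \<gamma> (p \<star> l) (S (q \<star> m) \<star> a2)) \<Lambda>) a1) a"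
    by (intro D_cong D_mult) ((intro J)?; simp)+
  also have "\<dots> = D (\<lambda>p z. D (\<lambda>q a2. D (\<lambda>l m. \<gamma> (p \<star> l) (S (q \<star> m) \<star> a2)) \<Lambda>) z) a"
    by (rule coassoc) ((intro J)?; simp)+
  also have "\<dots> = D (\<lambda>p z. eps z * D (\<lambda>l m. \<gamma> (p \<star> l) (S m)) \<Lambda>) a"
  proof (intro D_cong)
    fix p z assume [simp]: "p \<in> carrier B" "z \<in> carrier B"
    have "D (\<lambda>q a2. D (\<lambda>l m. \<gamma> (p \<star> l) (S (q \<star> m) \<star> a2)) \<Lambda>) z =
        D (\<lambda>q a2. D (\<lambda>l m. \<gamma> (p \<star> l) (S m \<star> (S q \<star> a2))) \<Lambda>) z"
      by (intro D_cong) (simp_all add: antipode_mult B.m_assoc)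
    also have "\<dots> = eps z * D (\<lambda>l m. \<gamma> (p \<star> l) (S m \<star> \<one>\<^bsub>B\<^esub>)) \<Lambda>"
      by (rule antipode_left[where \<psi>="\<lambda>t. D (\<lambda>l m. \<gamma> (p \<star> l) (S m \<star> t)) \<Lambda>"]) ((intro J)?; simp)+
    also have "D (\<lambda>l m. \<gamma> (p \<star> l) (S m \<star> \<one>\<^bsub>B\<^esub>)) \<Lambda> = D (\<lambda>l m. \<gamma> (p \<star> l) (S m)) \<Lambda>"
      by (intro D_cong) simp_all
    finally show "D (\<lambda>q a2. D (\<lambda>l m. \<gamma> (p \<star> l) (S (q \<star> m) \<star> a2)) \<Lambda>) z =
        eps z * D (\<lambda>l m. \<gamma> (p \<star> l) (S m)) \<Lambda>" .
  qed simp
  also have "\<dots> = D (\<lambda>l m. \<gamma> (a \<star> l) (S m)) \<Lambda>"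
    by (rule counit_right[where \<psi>="\<lambda>t. D (\<lambda>l m. \<gamma> (t \<star> l) (S m)) \<Lambda>"]) ((intro J)?; simp)+
  finally show ?thesis by simp
qed

text \<open>Let \<open>p b = \<Sum> F(b \<Lambda>\<^sub>1) S(\<Lambda>\<^sub>2)\<close>, a right \<open>A\<close>-linear map from \<open>B\<close> to \<open>A \<otimes> K\<close> with \<open>p 1 = F(\<Lambda>)\<close>. By linearity,
  \<open>\<Sum> p(u S(c\<^sub>1)) c\<^sub>2\<close> vanishes for \<open>c \<in> A\<^sup>+ B = I\<close>. For a coinvariant \<open>x\<close> this gives
  \<open>p x = \<Sum> p(x\<^sub>1 S(x\<^sub>2)) x\<^sub>3 = F(\<Lambda>) x\<close>, so a multiple of \<open>x\<close> lies in \<open>A\<close>, and \<open>A\<close> is saturated. The form \<open>\<beta> u c\<close> in the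
  proof is \<open>\<Sum> p(u S(c\<^sub>1)) c\<^sub>2\<close> under a functional \<open>\<psi>\<close> that vanishes on \<open>A\<close>.\<close>

lemma coinvariants_in_subalgebra:
  assumes x: "x \<in> carrier B"
    and coinv: "\<And>\<beta>. bilin \<beta> \<Longrightarrow> (\<And>u i. u \<in> carrier B \<Longrightarrow> i \<in> I \<Longrightarrow> \<beta> u i = 0) \<Longrightarrow> D \<beta> x = \<beta> x \<one>\<^bsub>B\<^esub>"
  shows "x \<in> A"
proof (rule ccontr)
  assume xA: "x \<notin> A"
  obtain \<psi> where \<psi>: "lin \<psi>" "\<And>a. a \<in> A \<Longrightarrow> \<psi> a = 0" "\<psi> x = \<iota> \<one>"
    using functional_separating[OF A_submodule x] A_saturated[OF _ _ x] xA by metis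
  obtain F \<Lambda> where F: "right_integral_on F" and \<Lambda>: "left_integral_in \<Lambda>" and F\<Lambda>: "F \<Lambda> \<noteq> 0"
    by (rule exists_dual_integrals)
  have linF: "lin F" using F by (simp add: right_integral_on_def)
  have \<Lambda>A: "\<Lambda> \<in> A" and inv: "\<And>a. a \<in> A \<Longrightarrow> a \<star> \<Lambda> = \<epsilon> a \<odot>\<^bsub>B\<^esub> \<Lambda>"
    using \<Lambda> by (auto simp: left_integral_in_def)
  have [simp]: "\<Lambda> \<in> carrier B" "x \<in> carrier B" using \<Lambda>A x by auto
  note J = lin_intros lin_comp[OF linF] lin_comp[OF \<psi>(1)]
  define \<beta> where "\<beta> u c = D (\<lambda>c1 c2. D (\<lambda>l m. F (u \<star> S c1 \<star> l) * \<psi> (S m \<star> c2)) \<Lambda>) c" for u c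
  have bil: "bilin \<beta>" unfolding \<beta>_def by ((intro J)?; simp)+
  have van: "\<beta> u i = 0" if u [simp]: "u \<in> carrier B" and i: "i \<in> I" for u i
    using i
  proof (induction rule: I_induct)
    case (prod a c)
    then have a: "a \<in> A" "\<epsilon> a = \<zero>" and c [simp]: "c \<in> carrier B" by (auto dest: augD)
    have [simp]: "a \<in> carrier B" using a by simp
    have "\<beta> u (a \<star> c) = D (\<lambda>a1 a2. D (\<lambda>c1 c2. D (\<lambda>l m. F (u \<star> S (a1 \<star> c1) \<star> l) * \<psi> (S m \<star> (a2 \<star> c2))) \<Lambda>) c) a"
      unfolding \<beta>_def by (rule D_mult) ((intro J)?; simp)+
    also have "\<dots> = D (\<lambda>a1 a2. D (\<lambda>c1 c2. D (\<lambda>l m. F (u \<star> S c1 \<star> l) * \<psi> (S m \<star> ((S a1 \<star> a2) \<star> c2))) \<Lambda>) c) a"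
    proof (rule D_cong_sub[OF D_cong a(1)])
      fix a1 a2 c1 c2
      assume [simp]: "a1 \<in> A" "a2 \<in> A" "c1 \<in> carrier B" "c2 \<in> carrier B"
      let ?\<gamma> = "\<lambda>s t. F (u \<star> S c1 \<star> s) * \<psi> (t \<star> (a2 \<star> c2))"
      have "D (\<lambda>l m. F (u \<star> S (a1 \<star> c1) \<star> l) * \<psi> (S m \<star> (a2 \<star> c2))) \<Lambda> = D (\<lambda>l m. ?\<gamma> (S a1 \<star> l) (S m)) \<Lambda>"
        by (intro D_cong) (simp_all add: antipode_mult B.m_assoc)
      also have "\<dots> = D (\<lambda>l m. ?\<gamma> l (S m \<star> S a1)) \<Lambda>"
        by (rule shift_antipode[OF \<Lambda>A inv]) ((intro J)?; simp)+
      also have "\<dots> = D (\<lambda>l m. F (u \<star> S c1 \<star> l) * \<psi> (S m \<star> ((S a1 \<star> a2) \<star> c2))) \<Lambda>"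
        by (intro D_cong) (simp_all add: B.m_assoc)
      finally show "D (\<lambda>l m. F (u \<star> S (a1 \<star> c1) \<star> l) * \<psi> (S m \<star> (a2 \<star> c2))) \<Lambda> = \<dots>" .
    qed simp
    also have "\<dots> = eps a * D (\<lambda>c1 c2. D (\<lambda>l m. F (u \<star> S c1 \<star> l) * \<psi> (S m \<star> (\<one>\<^bsub>B\<^esub> \<star> c2))) \<Lambda>) c"
      by (rule antipode_left[where \<psi>="\<lambda>t. D (\<lambda>c1 c2. D (\<lambda>l m. F (u \<star> S c1 \<star> l) * \<psi> (S m \<star> (t \<star> c2))) \<Lambda>) c"])
        ((intro J)?; simp)+
    finally show ?case by (simp add: a)
  next
    case (sum i j)
    have "lin (\<beta> u)" using bil by (simp add: bilin_def)
    then show ?case using sum I_carrier by (simp add: lin_add)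
  qed
  have "D \<beta> x = \<beta> x \<one>\<^bsub>B\<^esub>" by (rule coinv[OF bil van])
  also have "\<dots> = D (\<lambda>l m. F (x \<star> S \<one>\<^bsub>B\<^esub> \<star> l) * \<psi> (S m \<star> \<one>\<^bsub>B\<^esub>)) \<Lambda>"
    unfolding \<beta>_def by (rule D_one) ((intro J)?; simp)+
  also have "\<dots> = D (\<lambda>l m. 0) \<Lambda>"
    by (intro D_cong_sub \<Lambda>A) (simp add: \<psi>(2))
  finally have 0: "D \<beta> x = 0" by (simp add: D_zero)
  have "D \<beta> x = D (\<lambda>w c2. D (\<lambda>u c1. D (\<lambda>l m. F (u \<star> S c1 \<star> l) * \<psi> (S m \<star> c2)) \<Lambda>) w) x"
    unfolding \<beta>_def by (rule coassoc[symmetric]) ((intro J)?; simp)+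
  also have "\<dots> = D (\<lambda>w c2. eps w * D (\<lambda>l m. F (\<one>\<^bsub>B\<^esub> \<star> l) * \<psi> (S m \<star> c2)) \<Lambda>) x"
  proof (intro D_cong x)
    fix w c2 assume [simp]: "w \<in> carrier B" "c2 \<in> carrier B"
    show "D (\<lambda>u c1. D (\<lambda>l m. F (u \<star> S c1 \<star> l) * \<psi> (S m \<star> c2)) \<Lambda>) w =
        eps w * D (\<lambda>l m. F (\<one>\<^bsub>B\<^esub> \<star> l) * \<psi> (S m \<star> c2)) \<Lambda>"
      by (rule antipode_right[where \<psi>="\<lambda>t. D (\<lambda>l m. F (t \<star> l) * \<psi> (S m \<star> c2)) \<Lambda>"]) ((intro J)?; simp)+
  qed
  also have "\<dots> = D (\<lambda>l m. F (\<one>\<^bsub>B\<^esub> \<star> l) * \<psi> (S m \<star> x)) \<Lambda>"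
    by (rule counit_left[where \<psi>="\<lambda>t. D (\<lambda>l m. F (\<one>\<^bsub>B\<^esub> \<star> l) * \<psi> (S m \<star> t)) \<Lambda>"]) ((intro J)?; simp)+
  also have "\<dots> = D (\<lambda>l m. F l * \<psi> (S m \<star> x)) \<Lambda>"
    by (intro D_cong) simp_all
  also have "\<dots> = F \<Lambda> * \<psi> (S \<one>\<^bsub>B\<^esub> \<star> x)"
  proof -
    have "lin (\<lambda>m. \<psi> (S m \<star> x))" by ((intro J)?; simp)+
    then show ?thesis using F \<Lambda>A unfolding right_integral_on_def by blast
  qed
  also have "\<dots> = F \<Lambda>"
    using \<psi>(3) lin_value[OF linF, of \<Lambda>] by (simp add: mult.commute)
  finally show False using 0 F\<Lambda> by simp
qed

text \<open>\<open>E b = \<Sum> b\<^sub>1 \<phi>(b\<^sub>2)\<close> is coinvariant, hence in \<open>A\<close>, and \<open>\<Delta>(E b) = \<Sum> b\<^sub>1 \<otimes> E(b\<^sub>2)\<close>. So \<open>G \<circ> E\<close> is a left integral on \<open>B\<close>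
  for a left integral \<open>G\<close> on \<open>A\<close>, after clearing a denominator. With a right integral \<open>\<Lambda>\<close> in \<open>A\<close> such that
  \<open>G(\<Lambda>) \<noteq> 0\<close>, one has \<open>E(\<Lambda> b) = \<Lambda> E(b) = \<epsilon>(E b) \<Lambda> = \<phi>(b) \<Lambda>\<close>, so that \<open>G \<circ> E\<close> is not zero.\<close>

theorem left_integral_quotient_to_algebra:
  assumes \<phi>: "left_integral_on_quotient \<phi>" and nz: "\<exists>b\<in>carrier B. \<phi> b \<noteq> \<zero>"
  shows "\<exists>\<phi>'. left_integral_on_algebra \<phi>' \<and> (\<exists>b\<in>carrier B. \<phi>' b \<noteq> \<zero>)"
proof -
  have r\<phi>: "lin_to_R \<phi>" and \<phi>I: "\<And>i. i \<in> I \<Longrightarrow> \<phi> i = \<zero>"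
    and int: "\<And>b. b \<in> carrier B \<Longrightarrow> DB (\<lambda>x y. \<phi> y \<odot>\<^bsub>B\<^esub> x) b \<ominus>\<^bsub>B\<^esub> \<phi> b \<odot>\<^bsub>B\<^esub> \<one>\<^bsub>B\<^esub> \<in> I"
    using \<phi> by (auto simp: left_integral_on_quotient_def)
  have [simp]: "\<phi> x \<in> carrier R" if "x \<in> carrier B" for x using lin_to_R_closed[OF r\<phi> that] .
  have lin\<phi>: "lin (\<lambda>x. \<iota> (\<phi> x))" by (rule lin_to_R_lin[OF r\<phi>])
  define E where "E b = DB (\<lambda>x y. \<phi> y \<odot>\<^bsub>B\<^esub> x) b" for b
  have E_closed [simp]: "E b \<in> carrier B" if "b \<in> carrier B" for b
    unfolding E_def using that by (intro DB_closed) auto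
  have E_lin: "\<psi> (E b) = D (\<lambda>x y. \<psi> x * \<iota> (\<phi> y)) b" if "lin \<psi>" "b \<in> carrier B" for \<psi> b
  proof -
    have "\<psi> (E b) = D (\<lambda>x y. \<psi> (\<phi> y \<odot>\<^bsub>B\<^esub> x)) b"
      unfolding E_def by (rule lin_DB) (use that in auto)
    also have "\<dots> = D (\<lambda>x y. \<psi> x * \<iota> (\<phi> y)) b"
      by (intro D_cong that) (simp add: lin_smult[OF that(1)] mult.commute)
    finally show ?thesis .
  qed
  have EA: "E b \<in> A" if b: "b \<in> carrier B" for b
  proof (rule coinvariants_in_subalgebra[OF E_closed[OF b]])
    fix \<beta> assume \<beta>: "bilin \<beta>" and van: "\<And>u i. u \<in> carrier B \<Longrightarrow> i \<in> I \<Longrightarrow> \<beta> u i = 0"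
    note J = lin_intros bilin_comp_left[OF \<beta>] bilin_comp_right[OF \<beta>] lin_comp[OF lin\<phi>]
    have "D \<beta> (E b) = D (\<lambda>w y. D \<beta> w * \<iota> (\<phi> y)) b" by (rule E_lin[OF lin_D[OF \<beta>] b])
    also have "\<dots> = D (\<lambda>w y. D (\<lambda>u v. \<beta> u v * \<iota> (\<phi> y)) w) b" by (simp add: D_mult_const)
    also have "\<dots> = D (\<lambda>u w. D (\<lambda>v y. \<beta> u v * \<iota> (\<phi> y)) w) b"
      by (rule coassoc) ((intro J b)?; simp)+
    also have "\<dots> = D (\<lambda>u w. \<beta> u \<one>\<^bsub>B\<^esub> * \<iota> (\<phi> w)) b"
    proof (intro D_cong b)
      fix u w assume [simp]: "u \<in> carrier B" "w \<in> carrier B"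
      have lu: "lin (\<beta> u)" using \<beta> by (simp add: bilin_def)
      have "D (\<lambda>v y. \<beta> u v * \<iota> (\<phi> y)) w = \<beta> u (E w)" by (rule E_lin[OF lu, symmetric]) simp
      also have "\<dots> = \<beta> u (\<phi> w \<odot>\<^bsub>B\<^esub> \<one>\<^bsub>B\<^esub>)"
        using van[of u, OF _ int[of w]] lin_minus[OF lu, of "E w" "\<phi> w \<odot>\<^bsub>B\<^esub> \<one>\<^bsub>B\<^esub>"]
        by (simp add: E_def[symmetric])
      finally show "D (\<lambda>v y. \<beta> u v * \<iota> (\<phi> y)) w = \<beta> u \<one>\<^bsub>B\<^esub> * \<iota> (\<phi> w)"
        using lin_smult[OF lu, of "\<phi> w" "\<one>\<^bsub>B\<^esub>"] by (simp add: mult.commute)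
    qed
    also have "\<dots> = \<beta> (E b) \<one>\<^bsub>B\<^esub>"
      by (rule E_lin[where \<psi>="\<lambda>u. \<beta> u \<one>\<^bsub>B\<^esub>", symmetric]) (use \<beta> b in \<open>simp_all add: bilin_def\<close>)
    finally show "D \<beta> (E b) = \<beta> (E b) \<one>\<^bsub>B\<^esub>" .
  qed
  obtain G \<Lambda> where linG: "lin G"
    and G: "\<And>h \<psi>. h \<in> A \<Longrightarrow> lin \<psi> \<Longrightarrow> D (\<lambda>x y. \<psi> x * G y) h = G h * \<psi> \<one>\<^bsub>B\<^esub>"
    and \<Lambda>A: "\<Lambda> \<in> A" and inv: "\<And>a. a \<in> A \<Longrightarrow> \<Lambda> \<star> a = \<epsilon> a \<odot>\<^bsub>B\<^esub> \<Lambda>" and G\<Lambda>: "G \<Lambda> \<noteq> 0"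
    by (rule exists_dual_integrals_opp) blast
  have [simp]: "\<Lambda> \<in> carrier B" using \<Lambda>A by simp
  obtain X where X: "generated_by X A" using A_generated by blast
  obtain d where d: "d \<in> carrier R" "d \<noteq> \<zero>"
    and dG: "\<And>i a. i \<in> {()} \<Longrightarrow> a \<in> A \<Longrightarrow> \<exists>r\<in>carrier R. \<iota> d * G a = \<iota> r"
    using generated_common_denominator[where J="{()}" and \<phi>="\<lambda>_. G", OF X _ linG] by blast
  have "\<forall>b\<in>carrier B. \<exists>r. r \<in> carrier R \<and> \<iota> r = \<iota> d * G (E b)"
    using dG[of "()"] EA by (metis singletonI)
  then obtain \<phi>' where \<phi>': "\<And>b. b \<in> carrier B \<Longrightarrow> \<phi>' b \<in> carrier R"
    "\<And>b. b \<in> carrier B \<Longrightarrow> \<iota> (\<phi>' b) = \<iota> d * G (E b)"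
    by metis
  have linGE: "lin (\<lambda>b. \<iota> d * G (E b))"
  proof -
    have "lin (\<lambda>b. D (\<lambda>x y. G x * \<iota> (\<phi> y)) b)"
      by ((intro lin_intros lin_comp[OF linG] lin_comp[OF lin\<phi>])?; simp)+
    then have "lin (\<lambda>b. G (E b))" by (simp add: lin_def E_lin[OF linG])
    then show ?thesis by (rule lin_const_mult)
  qed
  have "lin_to_R \<phi>'"
    unfolding lin_to_R_def
  proof (intro conjI ballI funcsetI \<phi>'(1))
    fix x y assume xy: "x \<in> carrier B" "y \<in> carrier B"
    show "\<phi>' (x \<oplus>\<^bsub>B\<^esub> y) = \<phi>' x \<oplus> \<phi>' y"
      using lin_add[OF linGE xy] xy by (intro emb_eqD) (simp_all add: \<phi>' emb_add)
  next
    fix r x assume rx: "r \<in> carrier R" "x \<in> carrier B"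
    show "\<phi>' (r \<odot>\<^bsub>B\<^esub> x) = r \<otimes> \<phi>' x"
      using lin_smult[OF linGE rx] rx by (intro emb_eqD) (simp_all add: \<phi>' emb_mult)
  qed
  moreover have "DB (\<lambda>x y. \<phi>' y \<odot>\<^bsub>B\<^esub> x) b = \<phi>' b \<odot>\<^bsub>B\<^esub> \<one>\<^bsub>B\<^esub>" if b: "b \<in> carrier B" for b
  proof (rule eq_by_functionals)
    show "DB (\<lambda>x y. \<phi>' y \<odot>\<^bsub>B\<^esub> x) b \<in> carrier B" using b \<phi>' by (intro DB_closed) auto
    show "\<phi>' b \<odot>\<^bsub>B\<^esub> \<one>\<^bsub>B\<^esub> \<in> carrier B" using b \<phi>' by simp
    fix \<psi> assume \<psi>: "lin \<psi>"
    note J = lin_intros lin_comp[OF linG] lin_comp[OF \<psi>] lin_comp[OF lin\<phi>]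
    have "\<psi> (DB (\<lambda>x y. \<phi>' y \<odot>\<^bsub>B\<^esub> x) b) = D (\<lambda>x y. \<psi> (\<phi>' y \<odot>\<^bsub>B\<^esub> x)) b"
      by (rule lin_DB[OF \<psi> b]) (simp add: \<phi>')
    also have "\<dots> = D (\<lambda>x y. \<iota> d * D (\<lambda>p q. \<psi> x * G p * \<iota> (\<phi> q)) y) b"
    proof (intro D_cong b)
      fix x y assume [simp]: "x \<in> carrier B" "y \<in> carrier B"
      have "\<psi> (\<phi>' y \<odot>\<^bsub>B\<^esub> x) = \<iota> d * (\<psi> x * G (E y))"
        by (simp add: lin_smult[OF \<psi>] \<phi>' mult_ac)
      also have "\<psi> x * G (E y) = D (\<lambda>p q. \<psi> x * G p * \<iota> (\<phi> q)) y"
        by (simp add: E_lin[OF linG] D_const_mult mult.assoc)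
      finally show "\<psi> (\<phi>' y \<odot>\<^bsub>B\<^esub> x) = \<iota> d * D (\<lambda>p q. \<psi> x * G p * \<iota> (\<phi> q)) y" .
    qed
    also have "\<dots> = \<iota> d * D (\<lambda>x y. D (\<lambda>p q. \<psi> x * G p * \<iota> (\<phi> q)) y) b"
      by (rule D_const_mult)
    also have "D (\<lambda>x y. D (\<lambda>p q. \<psi> x * G p * \<iota> (\<phi> q)) y) b = D (\<lambda>w q. D (\<lambda>x p. \<psi> x * G p * \<iota> (\<phi> q)) w) b"
      by (rule coassoc[symmetric]) ((intro J b)?; simp)+
    also have "\<dots> = D (\<lambda>w q. D (\<lambda>x p. \<psi> x * G p) w * \<iota> (\<phi> q)) b"
      by (simp add: D_mult_const)
    also have "\<dots> = D (\<lambda>x p. \<psi> x * G p) (E b)"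
      by (rule E_lin[symmetric]) ((intro lin_D J b)?; simp)+
    also have "\<dots> = G (E b) * \<psi> \<one>\<^bsub>B\<^esub>" by (rule G[OF EA[OF b] \<psi>])
    also have "\<iota> d * (G (E b) * \<psi> \<one>\<^bsub>B\<^esub>) = \<psi> (\<phi>' b \<odot>\<^bsub>B\<^esub> \<one>\<^bsub>B\<^esub>)"
      using b by (simp add: lin_smult[OF \<psi>] \<phi>' mult.assoc)
    finally show "\<psi> (DB (\<lambda>x y. \<phi>' y \<odot>\<^bsub>B\<^esub> x) b) = \<psi> (\<phi>' b \<odot>\<^bsub>B\<^esub> \<one>\<^bsub>B\<^esub>)" .
  qed
  ultimately have "left_integral_on_algebra \<phi>'" by (simp add: left_integral_on_algebra_def)
  moreover have "\<exists>b\<in>carrier B. \<phi>' b \<noteq> \<zero>"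
  proof -
    obtain b where b [simp]: "b \<in> carrier B" and \<phi>b: "\<phi> b \<noteq> \<zero>" using nz by blast
    have "E (\<Lambda> \<star> b) = \<Lambda> \<star> E b"
    proof (rule eq_by_functionals)
      fix \<psi> assume \<psi>: "lin \<psi>"
      note J = lin_intros lin_comp[OF \<psi>] lin_comp[OF lin\<phi>]
      have "\<psi> (E (\<Lambda> \<star> b)) = D (\<lambda>x y. \<psi> x * \<iota> (\<phi> y)) (\<Lambda> \<star> b)" by (rule E_lin[OF \<psi>]) simp
      also have "\<dots> = D (\<lambda>p q. D (\<lambda>x y. \<psi> (p \<star> x) * \<iota> (\<phi> (q \<star> y))) b) \<Lambda>"
        by (rule D_mult) ((intro J)?; simp)+
      also have "\<dots> = D (\<lambda>p q. eps q * D (\<lambda>x y. \<psi> (p \<star> x) * \<iota> (\<phi> y)) b) \<Lambda>"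
      proof (intro D_cong_sub \<Lambda>A)
        fix p q assume [simp]: "p \<in> A" "q \<in> A"
        have "\<iota> (\<phi> (q \<star> y)) = eps q * \<iota> (\<phi> y)" if [simp]: "y \<in> carrier B" for y
        proof -
          have "(q \<ominus>\<^bsub>B\<^esub> \<epsilon> q \<odot>\<^bsub>B\<^esub> \<one>\<^bsub>B\<^esub>) \<star> y \<in> I" by (intro I_mult_right aug_diff) auto
          then have "\<iota> (\<phi> ((q \<ominus>\<^bsub>B\<^esub> \<epsilon> q \<odot>\<^bsub>B\<^esub> \<one>\<^bsub>B\<^esub>) \<star> y)) = 0" by (simp add: \<phi>I)
          moreover have "lin (\<lambda>t. \<iota> (\<phi> (t \<star> y)))" by ((intro J)?; simp)+
          from lin_minus[OF this, of q "\<epsilon> q \<odot>\<^bsub>B\<^esub> \<one>\<^bsub>B\<^esub>"] lin_smult[OF this, of "\<epsilon> q" "\<one>\<^bsub>B\<^esub>"]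
          have "\<iota> (\<phi> ((q \<ominus>\<^bsub>B\<^esub> \<epsilon> q \<odot>\<^bsub>B\<^esub> \<one>\<^bsub>B\<^esub>) \<star> y)) = \<iota> (\<phi> (q \<star> y)) - eps q * \<iota> (\<phi> y)"
            by simp
          ultimately show ?thesis by simp
        qed
        then have "D (\<lambda>x y. \<psi> (p \<star> x) * \<iota> (\<phi> (q \<star> y))) b = D (\<lambda>x y. eps q * (\<psi> (p \<star> x) * \<iota> (\<phi> y))) b"
          by (intro D_cong) (simp_all add: mult.left_commute)
        then show "D (\<lambda>x y. \<psi> (p \<star> x) * \<iota> (\<phi> (q \<star> y))) b = eps q * D (\<lambda>x y. \<psi> (p \<star> x) * \<iota> (\<phi> y)) b"
          by (simp add: D_const_mult)
      qed
      also have "\<dots> = D (\<lambda>x y. \<psi> (\<Lambda> \<star> x) * \<iota> (\<phi> y)) b"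
        by (rule counit_right[where \<psi>="\<lambda>t. D (\<lambda>x y. \<psi> (t \<star> x) * \<iota> (\<phi> y)) b"]) ((intro J)?; simp)+
      also have "\<dots> = \<psi> (\<Lambda> \<star> E b)"
        by (rule E_lin[where \<psi>="\<lambda>t. \<psi> (\<Lambda> \<star> t)", symmetric]) ((intro J)?; simp)+
      finally show "\<psi> (E (\<Lambda> \<star> b)) = \<psi> (\<Lambda> \<star> E b)" .
    qed simp_all
    also have "\<dots> = \<epsilon> (E b) \<odot>\<^bsub>B\<^esub> \<Lambda>" by (rule inv[OF EA]) simp
    finally have "G (E (\<Lambda> \<star> b)) = eps (E b) * G \<Lambda>"
      using lin_smult[OF linG, of "\<epsilon> (E b)" \<Lambda>] by simp
    also have "eps (E b) = \<iota> (\<phi> b)"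
      using E_lin[OF lin_eps b] counit_left[OF lin\<phi> b] by (rule trans)
    finally have GE: "G (E (\<Lambda> \<star> b)) = \<iota> (\<phi> b) * G \<Lambda>" .
    have "\<phi>' (\<Lambda> \<star> b) \<noteq> \<zero>"
    proof
      assume zero: "\<phi>' (\<Lambda> \<star> b) = \<zero>"
      have "\<iota> (d \<otimes> \<phi> b) * G \<Lambda> = \<iota> d * (\<iota> (\<phi> b) * G \<Lambda>)"
        using d by (simp add: emb_mult mult.assoc)
      also have "\<dots> = \<iota> (\<phi>' (\<Lambda> \<star> b))"
        by (simp add: \<phi>'(2) GE)
      finally have "\<iota> (d \<otimes> \<phi> b) * G \<Lambda> = 0" using zero by simp
      moreover have "d \<otimes> \<phi> b \<in> carrier R" "d \<otimes> \<phi> b \<noteq> \<zero>"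
        using d \<phi>b by (simp_all add: integral_iff)
      ultimately have "G \<Lambda> = 0"
        using lin_value[OF linG \<open>\<Lambda> \<in> carrier B\<close>] emb_cancel by blast
      then show False using G\<Lambda> by simp
    qed
    then show ?thesis by (intro bexI[of _ "\<Lambda> \<star> b"]) auto
  qed
  ultimately show ?thesis by (intro exI[of _ \<phi>'] conjI)
qed

theorem left_integral_iff:
  "(\<exists>\<phi>. left_integral_on_algebra \<phi> \<and> (\<exists>b\<in>carrier B. \<phi> b \<noteq> \<zero>)) \<longleftrightarrow>
   (\<exists>\<phi>. left_integral_on_quotient \<phi> \<and> (\<exists>b\<in>carrier B. \<phi> b \<noteq> \<zero>))"
  by (rule iffI; elim exE conjE; rule left_integral_algebra_to_quotient left_integral_quotient_to_algebra; assumption)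

definition right_integral_on_algebra :: "('b \<Rightarrow> 'r) \<Rightarrow> bool" where
  "right_integral_on_algebra \<phi> \<longleftrightarrow> lin_to_R \<phi> \<and>
     (\<forall>b\<in>carrier B. DB (\<lambda>x y. \<phi> x \<odot>\<^bsub>B\<^esub> y) b = \<phi> b \<odot>\<^bsub>B\<^esub> \<one>\<^bsub>B\<^esub>)"

definition right_integral_on_quotient :: "('b \<Rightarrow> 'r) \<Rightarrow> bool" where
  "right_integral_on_quotient \<phi> \<longleftrightarrow> lin_to_R \<phi> \<and> (\<forall>i\<in>I. \<phi> i = \<zero>) \<and>
     (\<forall>b\<in>carrier B. DB (\<lambda>x y. \<phi> x \<odot>\<^bsub>B\<^esub> y) b \<ominus>\<^bsub>B\<^esub> \<phi> b \<odot>\<^bsub>B\<^esub> \<one>\<^bsub>B\<^esub> \<in> I)"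

theorem right_integral_iff:
  "(\<exists>\<phi>. right_integral_on_algebra \<phi> \<and> (\<exists>b\<in>carrier B. \<phi> b \<noteq> \<zero>)) \<longleftrightarrow>
   (\<exists>\<phi>. right_integral_on_quotient \<phi> \<and> (\<exists>b\<in>carrier B. \<phi> b \<noteq> \<zero>))"
proof -
  interpret opp: normal_hopf_sub R "opp B" \<iota> cop' \<epsilon> S A by (rule normal_hopf_sub_opp)
  have minus: "x \<ominus>\<^bsub>opp B\<^esub> y = x \<ominus>\<^bsub>B\<^esub> y" for x y
    by (simp add: a_minus_def a_inv_def)
  have lin_to_R: "opp.lin_to_R \<phi> \<longleftrightarrow> lin_to_R \<phi>" for \<phi>
    unfolding opp.lin_to_R_def lin_to_R_def by simp
  have "opp.left_integral_on_algebra \<phi> \<longleftrightarrow> right_integral_on_algebra \<phi>" for \<phi>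
    unfolding opp.left_integral_on_algebra_def right_integral_on_algebra_def DB_opp lin_to_R by simp
  moreover have "opp.left_integral_on_quotient \<phi> \<longleftrightarrow> right_integral_on_quotient \<phi>" for \<phi>
    unfolding opp.left_integral_on_quotient_def right_integral_on_quotient_def DB_opp lin_to_R opp_simps ideal_opp minus ..
  ultimately show ?thesis using opp.left_integral_iff by (simp only: opp_simps)
qed

end

section \<open>Modules\<close>

lemma (in abelian_monoid) msum_append:
  "set xs \<subseteq> carrier G \<Longrightarrow> set ys \<subseteq> carrier G \<Longrightarrow> msum G (xs @ ys) = msum G xs \<oplus> msum G ys"
  by (induction xs) (auto simp: a_assoc)

lemma (in abelian_monoid) msum_add:
  assumes "f \<in> set xs \<rightarrow> carrier G" "g \<in> set xs \<rightarrow> carrier G"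
  shows "msum G (map (\<lambda>x. f x \<oplus> g x) xs) = msum G (map f xs) \<oplus> msum G (map g xs)"
  using assms
proof (induction xs)
  case (Cons x xs)
  have c: "f x \<in> carrier G" "g x \<in> carrier G" "msum G (map f xs) \<in> carrier G" "msum G (map g xs) \<in> carrier G"
    using Cons.prems by (auto intro!: msum_closed)
  then show ?case using Cons by (simp add: a_ac)
qed simp

lemma (in module) msum_smult:
  assumes "r \<in> carrier R" "f \<in> set xs \<rightarrow> carrier M"
  shows "msum M (map (\<lambda>x. r \<odot>\<^bsub>M\<^esub> f x) xs) = r \<odot>\<^bsub>M\<^esub> msum M (map f xs)"
  using assms(2)
proof (induction xs)
  case (Cons x xs)
  have c: "f x \<in> carrier M" "msum M (map f xs) \<in> carrier M"
    using Cons.prems by (auto intro!: M.msum_closed)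
  then show ?case using Cons assms(1) by (simp add: smult_r_distr)
qed (use assms(1) in simp)

lemma (in module) module_span_submodule:
  assumes "X \<subseteq> carrier M"
  shows "submodule (module_span R M X) R M"
proof (rule submodule_if_closed)
  show "module_span R M X \<subseteq> carrier M"
    using carrier_is_submodule assms unfolding module_span_def by blast
  show "\<zero>\<^bsub>M\<^esub> \<in> module_span R M X"
    unfolding module_span_def using subgroup.one_closed[OF submodule.axioms(1)] by fastforce
qed (auto simp: module_span_def submoduleE)

lemma module_span_superset: "X \<subseteq> module_span R M X"
  by (auto simp: module_span_def)

lemma module_span_least: "submodule N R M \<Longrightarrow> X \<subseteq> N \<Longrightarrow> module_span R M X \<subseteq> N"
  by (auto simp: module_span_def)

lemma abelian_group_cong:
  assumes "abelian_group M" "carrier M' = carrier M" "add M' = add M" "zero M' = zero M"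
  shows "abelian_group M'"
proof -
  interpret M: abelian_group M by fact
  have "\<exists>y\<in>carrier M. y \<oplus>\<^bsub>M\<^esub> x = \<zero>\<^bsub>M\<^esub>" if "x \<in> carrier M" for x
    using that M.l_neg by blast
  then show ?thesis
    by (intro abelian_groupI) (simp_all add: assms M.a_ac)
qed

lemma module_cong:
  assumes "module R M" "carrier M' = carrier M" "add M' = add M" "zero M' = zero M" "smult M' = smult M"
  shows "module R M'"
proof -
  interpret module R M by fact
  have "abelian_group M'"
    by (rule abelian_group_cong[OF M.abelian_group_axioms assms(2-4)])
  then show ?thesis
    using R.is_cring assms by (intro moduleI) (simp_all add: smult_l_distr smult_r_distr smult_assoc1)
qed

locale module_homomorphism = M: module R M + N: module R N
  for R :: "('r, 'x) ring_scheme" (structure) and M :: "('r, 'm, 'y) module_scheme"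
    and N :: "('r, 'n, 'z) module_scheme" +
  fixes h assumes hom: "h \<in> module_hom R M N"
begin

lemma closed [simp]: "x \<in> carrier M \<Longrightarrow> h x \<in> carrier N"
  and add: "x \<in> carrier M \<Longrightarrow> y \<in> carrier M \<Longrightarrow> h (x \<oplus>\<^bsub>M\<^esub> y) = h x \<oplus>\<^bsub>N\<^esub> h y"
  and smult: "r \<in> carrier R \<Longrightarrow> x \<in> carrier M \<Longrightarrow> h (r \<odot>\<^bsub>M\<^esub> x) = r \<odot>\<^bsub>N\<^esub> h x"
  using hom by (auto simp: module_hom_def)

lemma zero: "h \<zero>\<^bsub>M\<^esub> = \<zero>\<^bsub>N\<^esub>"
  using smult[of \<zero> "\<zero>\<^bsub>M\<^esub>"] by simp

lemma uminus:
  assumes "x \<in> carrier M"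
  shows "h (\<ominus>\<^bsub>M\<^esub> x) = \<ominus>\<^bsub>N\<^esub> h x"
  using smult[of "\<ominus> \<one>" x] M.smult_l_minus[of \<one> x] N.smult_l_minus[of \<one> "h x"] assms by simp

lemma minus: "x \<in> carrier M \<Longrightarrow> y \<in> carrier M \<Longrightarrow> h (x \<ominus>\<^bsub>M\<^esub> y) = h x \<ominus>\<^bsub>N\<^esub> h y"
  by (simp add: a_minus_def add uminus)

lemma msum: "set xs \<subseteq> carrier M \<Longrightarrow> h (msum M xs) = msum N (map h xs)"
  by (induction xs) (auto simp: zero add)

lemma kernel_submodule: "submodule {x \<in> carrier M. h x = \<zero>\<^bsub>N\<^esub>} R M"
  by (rule M.submodule_if_closed) (auto simp: zero add smult)

end

lemma module_homomorphismI:
  "module R M \<Longrightarrow> module R N \<Longrightarrow> h \<in> module_hom R M N \<Longrightarrow> module_homomorphism R M N h"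
  by (simp add: module_homomorphism_def module_homomorphism_axioms_def)

lemma module_hom_comp:
  "f \<in> module_hom R M N \<Longrightarrow> g \<in> module_hom R N P \<Longrightarrow> (\<lambda>x. g (f x)) \<in> module_hom R M P"
  by (auto simp: module_hom_def Pi_iff)

section \<open>Quotient modules\<close>

locale quotient_module = module R M + submodule N R M
  for R :: "('r, 'x) ring_scheme" (structure) and M :: "('r, 'm, 'y) module_scheme" (structure) and N
begin

lemma N_abelian_subgroup: "abelian_subgroup N M"
  by (intro abelian_subgroupI3 additive_subgroup.intro submodule.axioms(1)[of N R M] submodule_axioms M.abelian_group_axioms)

sublocale N: abelian_subgroup N M by (rule N_abelian_subgroup)

lemma quot_simps:
  "carrier (quot_module M N) = a_rcosets\<^bsub>M\<^esub> N" "add (quot_module M N) = set_add M"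
  "zero (quot_module M N) = N" "one (quot_module M N) = N +>\<^bsub>M\<^esub> \<one>\<^bsub>M\<^esub>"
  "smult (quot_module M N) = (\<lambda>r X. the_elem ((\<lambda>x. N +>\<^bsub>M\<^esub> (r \<odot>\<^bsub>M\<^esub> x)) ` X))"
  by (simp_all add: quot_module_def ring.defs module.defs FactRing_def)

lemma coset_eq_iff:
  assumes "x \<in> carrier M" "y \<in> carrier M"
  shows "N +>\<^bsub>M\<^esub> x = N +>\<^bsub>M\<^esub> y \<longleftrightarrow> x \<ominus>\<^bsub>M\<^esub> y \<in> N"
proof -
  have "N +>\<^bsub>M\<^esub> x = N +>\<^bsub>M\<^esub> y \<longleftrightarrow> x \<in> N +>\<^bsub>M\<^esub> y"
    using N.a_repr_independence'[OF _ assms(2), of x] N.a_repr_independenceD[OF assms(1), of y] by auto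
  then show ?thesis
    using N.a_rcos_module[OF assms(2,1)] by (simp add: a_minus_def)
qed

lemma coset_carrier: "x \<in> carrier M \<Longrightarrow> N +>\<^bsub>M\<^esub> x \<in> carrier (quot_module M N)"
  by (auto simp: quot_simps A_RCOSETS_def')

lemma coset_cases:
  assumes "X \<in> carrier (quot_module M N)"
  obtains x where "x \<in> carrier M" "X = N +>\<^bsub>M\<^esub> x"
  using assms by (auto simp: quot_simps A_RCOSETS_def')

lemma coset_the_elem:
  assumes "x \<in> carrier M"
    and "\<And>y. y \<in> carrier M \<Longrightarrow> y \<ominus>\<^bsub>M\<^esub> x \<in> N \<Longrightarrow> g y = g x"
  shows "the_elem (g ` (N +>\<^bsub>M\<^esub> x)) = g x"
proof -
  have "g ` (N +>\<^bsub>M\<^esub> x) = {g x}"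
  proof safe
    fix y assume y: "y \<in> N +>\<^bsub>M\<^esub> x"
    have yM: "y \<in> carrier M" using N.a_elemrcos_carrier[OF assms(1) y] .
    have "N +>\<^bsub>M\<^esub> y = N +>\<^bsub>M\<^esub> x" using N.a_repr_independence'[OF y assms(1)] by simp
    then show "g y = g x" using coset_eq_iff[OF yM assms(1)] assms(2)[OF yM] by simp
  next
    show "g x \<in> g ` (N +>\<^bsub>M\<^esub> x)" using N.a_rcos_self[OF assms(1)] by blast
  qed
  then show ?thesis by simp
qed

lemma coset_add: "x \<in> carrier M \<Longrightarrow> y \<in> carrier M \<Longrightarrow>
    (N +>\<^bsub>M\<^esub> x) \<oplus>\<^bsub>quot_module M N\<^esub> (N +>\<^bsub>M\<^esub> y) = N +>\<^bsub>M\<^esub> (x \<oplus>\<^bsub>M\<^esub> y)"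
  by (simp add: quot_simps N.a_rcos_sum)

lemma coset_smult:
  assumes "r \<in> carrier R" "x \<in> carrier M"
  shows "r \<odot>\<^bsub>quot_module M N\<^esub> (N +>\<^bsub>M\<^esub> x) = N +>\<^bsub>M\<^esub> (r \<odot>\<^bsub>M\<^esub> x)"
  unfolding quot_simps
proof (rule coset_the_elem)
  fix y assume y: "y \<in> carrier M" "y \<ominus>\<^bsub>M\<^esub> x \<in> N"
  have "r \<odot>\<^bsub>M\<^esub> (y \<ominus>\<^bsub>M\<^esub> x) \<in> N" using assms y by (intro smult_closed)
  also have "r \<odot>\<^bsub>M\<^esub> (y \<ominus>\<^bsub>M\<^esub> x) = r \<odot>\<^bsub>M\<^esub> y \<ominus>\<^bsub>M\<^esub> r \<odot>\<^bsub>M\<^esub> x"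
    using assms y by (simp add: a_minus_def smult_r_distr smult_r_minus)
  finally show "N +>\<^bsub>M\<^esub> (r \<odot>\<^bsub>M\<^esub> y) = N +>\<^bsub>M\<^esub> (r \<odot>\<^bsub>M\<^esub> x)"
    using assms y by (subst coset_eq_iff) auto
qed (rule assms)

lemma quot_is_module: "module R (quot_module M N)"
proof (rule moduleI)
  have "abelian_group (M Quot N)"
    by (rule comm_group_abelian_groupI)
      (simp add: FactRing_def N.a_factorgroup_is_comm_group[unfolded A_FactGroup_def'])
  then show "abelian_group (quot_module M N)"
    by (rule abelian_group_cong) (simp_all add: quot_simps FactRing_def)
  show "cring R" by (rule R.is_cring)
  fix a b X Y assume a: "a \<in> carrier R" and b: "b \<in> carrier R"
    and X: "X \<in> carrier (quot_module M N)" and Y: "Y \<in> carrier (quot_module M N)"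
  obtain x y where [simp]: "x \<in> carrier M" "y \<in> carrier M" and XY: "X = N +>\<^bsub>M\<^esub> x" "Y = N +>\<^bsub>M\<^esub> y"
    using X Y coset_cases by metis
  note simps = XY coset_add coset_smult coset_carrier
  show "a \<odot>\<^bsub>quot_module M N\<^esub> X \<in> carrier (quot_module M N)" using a by (simp add: simps)
  show "(a \<oplus> b) \<odot>\<^bsub>quot_module M N\<^esub> X = a \<odot>\<^bsub>quot_module M N\<^esub> X \<oplus>\<^bsub>quot_module M N\<^esub> b \<odot>\<^bsub>quot_module M N\<^esub> X"
    using a b by (simp add: simps smult_l_distr)
  show "a \<odot>\<^bsub>quot_module M N\<^esub> (X \<oplus>\<^bsub>quot_module M N\<^esub> Y) =
      a \<odot>\<^bsub>quot_module M N\<^esub> X \<oplus>\<^bsub>quot_module M N\<^esub> a \<odot>\<^bsub>quot_module M N\<^esub> Y"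
    using a by (simp add: simps smult_r_distr)
  show "a \<otimes> b \<odot>\<^bsub>quot_module M N\<^esub> X = a \<odot>\<^bsub>quot_module M N\<^esub> (b \<odot>\<^bsub>quot_module M N\<^esub> X)"
    using a b by (simp add: simps smult_assoc1)
next
  fix X assume "X \<in> carrier (quot_module M N)"
  then obtain x where [simp]: "x \<in> carrier M" and X: "X = N +>\<^bsub>M\<^esub> x" by (rule coset_cases)
  show "\<one> \<odot>\<^bsub>quot_module M N\<^esub> X = X" by (simp add: X coset_smult)
qed

lemma coset_hom: "(\<lambda>x. N +>\<^bsub>M\<^esub> x) \<in> module_hom R M (quot_module M N)"
  by (auto simp: module_hom_def coset_carrier coset_add coset_smult)

end

lemma quotient_moduleI: "module R M \<Longrightarrow> submodule N R M \<Longrightarrow> quotient_module R M N"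
  by (simp add: quotient_module_def)

section \<open>Free modules\<close>

context domain
begin

lemma free_module_simps:
  "f \<in> carrier (free_module R S) \<longleftrightarrow> (\<forall>p. f p \<in> carrier R) \<and> finite {p. f p \<noteq> \<zero>} \<and> {p. f p \<noteq> \<zero>} \<subseteq> S"
  "add (free_module R S) = (\<lambda>f g p. f p \<oplus> g p)" "zero (free_module R S) = (\<lambda>_. \<zero>)"
  "smult (free_module R S) = (\<lambda>r f p. r \<otimes> f p)"
  by (auto simp: free_module_def)

lemma free_module_is_module: "module R (free_module R S)"
proof (rule moduleI)
  have add: "(\<lambda>p. f p \<oplus> g p) \<in> carrier (free_module R S)"
    if f: "f \<in> carrier (free_module R S)" and g: "g \<in> carrier (free_module R S)" for f g
  proof -
    have "{p. f p \<oplus> g p \<noteq> \<zero>} \<subseteq> {p. f p \<noteq> \<zero>} \<union> {p. g p \<noteq> \<zero>}" by auto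
    then show ?thesis
      using f g unfolding free_module_simps by (auto intro: finite_subset)
  qed
  have smul: "(\<lambda>p. r \<otimes> f p) \<in> carrier (free_module R S)"
    if r: "r \<in> carrier R" and f: "f \<in> carrier (free_module R S)" for r f
  proof -
    have "{p. r \<otimes> f p \<noteq> \<zero>} \<subseteq> {p. f p \<noteq> \<zero>}" using r by auto
    then show ?thesis
      using r f unfolding free_module_simps by (auto intro: finite_subset)
  qed
  show "abelian_group (free_module R S)"
  proof (rule abelian_groupI)
    fix f assume f: "f \<in> carrier (free_module R S)"
    show "\<exists>g\<in>carrier (free_module R S). g \<oplus>\<^bsub>free_module R S\<^esub> f = \<zero>\<^bsub>free_module R S\<^esub>"
    proof (rule bexI[of _ "\<lambda>p. \<ominus> \<one> \<otimes> f p"])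
      show "(\<lambda>p. \<ominus> \<one> \<otimes> f p) \<oplus>\<^bsub>free_module R S\<^esub> f = \<zero>\<^bsub>free_module R S\<^esub>"
        using f by (auto simp: free_module_simps l_minus l_neg)
      show "(\<lambda>p. \<ominus> \<one> \<otimes> f p) \<in> carrier (free_module R S)" by (rule smul[OF _ f]) simp
    qed
  qed (use add in \<open>auto simp: free_module_simps a_ac\<close>)
  show "r \<odot>\<^bsub>free_module R S\<^esub> f \<in> carrier (free_module R S)"
    if "r \<in> carrier R" "f \<in> carrier (free_module R S)" for r f
    using smul[OF that] by (simp add: free_module_simps(4))
qed (use is_cring in \<open>auto simp: free_module_simps l_distr r_distr m_assoc\<close>)

lemma free_gen_closed [simp]: "p \<in> S \<Longrightarrow> free_gen R p \<in> carrier (free_module R S)"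
  by (auto simp: free_module_simps free_gen_def)

lemma free_module_generated:
  assumes W: "submodule W R (free_module R S)" and gen: "\<And>p. p \<in> S \<Longrightarrow> free_gen R p \<in> W"
    and f: "f \<in> carrier (free_module R S)"
  shows "f \<in> W"
proof -
  interpret F: module R "free_module R S" by (rule free_module_is_module)
  have "f \<in> W" if "finite T" "f \<in> carrier (free_module R S)" "{p. f p \<noteq> \<zero>} = T" for T f
    using that
  proof (induction T arbitrary: f rule: finite_induct)
    case empty
    then have "f = \<zero>\<^bsub>free_module R S\<^esub>" by (auto simp: free_module_simps)
    then show ?case using subgroup.one_closed[OF submodule.axioms(1)[OF W]] by simp
  next
    case (insert p T)
    define g where "g = (\<lambda>q. if q = p then \<zero> else f q)"
    have supp: "{q. g q \<noteq> \<zero>} = T" using insert by (auto simp: g_def)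
    have g: "g \<in> carrier (free_module R S)"
      using insert.prems insert.hyps(1) supp unfolding free_module_simps by (auto simp: g_def)
    have p: "p \<in> S" "f p \<in> carrier R" using insert.prems unfolding free_module_simps by auto
    have "f = (f p \<odot>\<^bsub>free_module R S\<^esub> free_gen R p) \<oplus>\<^bsub>free_module R S\<^esub> g"
      using insert.prems by (auto simp: free_module_simps g_def free_gen_def)
    moreover have "(f p \<odot>\<^bsub>free_module R S\<^esub> free_gen R p) \<oplus>\<^bsub>free_module R S\<^esub> g \<in> W"
      using F.submoduleE(4,5)[OF W] p gen insert.IH[OF g supp] by auto
    ultimately show ?case by simp
  qed
  from this[OF _ f refl] show ?thesis using f by (simp add: free_module_simps)
qed

definition free_lift :: "('a, 'p, 'y) module_scheme \<Rightarrow> ('q \<Rightarrow> 'p) \<Rightarrow> ('q \<Rightarrow> 'a) \<Rightarrow> 'p" where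
  "free_lift P b f = (\<Oplus>\<^bsub>P\<^esub>p\<in>{p. f p \<noteq> \<zero>}. f p \<odot>\<^bsub>P\<^esub> b p)"

lemma free_lift_superset:
  assumes P: "module R P" and b: "b \<in> S \<rightarrow> carrier P" and f: "f \<in> carrier (free_module R S)"
    and T: "finite T" "{p. f p \<noteq> \<zero>} \<subseteq> T" "T \<subseteq> S"
  shows "free_lift P b f = (\<Oplus>\<^bsub>P\<^esub>p\<in>T. f p \<odot>\<^bsub>P\<^esub> b p)"
proof -
  interpret P: module R P by fact
  have fc: "\<And>p. f p \<in> carrier R" using f by (simp add: free_module_simps)
  show ?thesis
    unfolding free_lift_def
    by (rule P.M.add.finprod_mono_neutral_cong_left) (use b T fc in \<open>auto simp: Pi_iff\<close>)
qed

lemma free_lift_hom: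
  assumes P: "module R P" and b: "b \<in> S \<rightarrow> carrier P"
  shows "free_lift P b \<in> module_hom R (free_module R S) P"
proof -
  interpret P: module R P by fact
  interpret F: module R "free_module R S" by (rule free_module_is_module)
  have bc: "\<And>p. p \<in> S \<Longrightarrow> b p \<in> carrier P" using b by auto
  show ?thesis
    unfolding module_hom_def
  proof (intro CollectI conjI ballI funcsetI)
    fix f assume f: "f \<in> carrier (free_module R S)"
    then show "free_lift P b f \<in> carrier P"
      unfolding free_lift_def using bc by (intro P.M.finsum_closed) (auto simp: free_module_simps)
  next
    fix f g assume f: "f \<in> carrier (free_module R S)" and g: "g \<in> carrier (free_module R S)"
    let ?T = "{p. f p \<noteq> \<zero>} \<union> {p. g p \<noteq> \<zero>}"
    have T: "finite ?T" "?T \<subseteq> S" using f g by (auto simp: free_module_simps)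
    have fg: "f \<oplus>\<^bsub>free_module R S\<^esub> g \<in> carrier (free_module R S)" using f g by simp
    have fc: "\<And>p. f p \<in> carrier R" "\<And>p. g p \<in> carrier R" using f g by (auto simp: free_module_simps)
    have "free_lift P b (f \<oplus>\<^bsub>free_module R S\<^esub> g) = (\<Oplus>\<^bsub>P\<^esub>p\<in>?T. (f \<oplus>\<^bsub>free_module R S\<^esub> g) p \<odot>\<^bsub>P\<^esub> b p)"
      by (rule free_lift_superset[OF P b fg T(1) _ T(2)]) (auto simp: free_module_simps)
    also have "\<dots> = (\<Oplus>\<^bsub>P\<^esub>p\<in>?T. f p \<odot>\<^bsub>P\<^esub> b p \<oplus>\<^bsub>P\<^esub> g p \<odot>\<^bsub>P\<^esub> b p)"
      using T bc fc by (intro P.M.finsum_cong') (auto simp: free_module_simps P.smult_l_distr subset_eq)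
    also have "\<dots> = (\<Oplus>\<^bsub>P\<^esub>p\<in>?T. f p \<odot>\<^bsub>P\<^esub> b p) \<oplus>\<^bsub>P\<^esub> (\<Oplus>\<^bsub>P\<^esub>p\<in>?T. g p \<odot>\<^bsub>P\<^esub> b p)"
      using T bc fc by (intro P.M.finsum_addf) (auto simp: subset_eq)
    also have "\<dots> = free_lift P b f \<oplus>\<^bsub>P\<^esub> free_lift P b g"
      using free_lift_superset[OF P b f T(1) _ T(2)] free_lift_superset[OF P b g T(1) _ T(2)] by simp
    finally show "free_lift P b (f \<oplus>\<^bsub>free_module R S\<^esub> g) = free_lift P b f \<oplus>\<^bsub>P\<^esub> free_lift P b g" .
  next
    fix r f assume r: "r \<in> carrier R" and f: "f \<in> carrier (free_module R S)"
    let ?T = "{p. f p \<noteq> \<zero>}"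
    have T: "finite ?T" "?T \<subseteq> S" using f by (auto simp: free_module_simps)
    have rf: "r \<odot>\<^bsub>free_module R S\<^esub> f \<in> carrier (free_module R S)" using r f by simp
    have fc: "\<And>p. f p \<in> carrier R" using f by (auto simp: free_module_simps)
    have "free_lift P b (r \<odot>\<^bsub>free_module R S\<^esub> f) = (\<Oplus>\<^bsub>P\<^esub>p\<in>?T. (r \<odot>\<^bsub>free_module R S\<^esub> f) p \<odot>\<^bsub>P\<^esub> b p)"
      using r by (intro free_lift_superset[OF P b rf T(1) _ T(2)]) (auto simp: free_module_simps)
    also have "\<dots> = (\<Oplus>\<^bsub>P\<^esub>p\<in>?T. r \<odot>\<^bsub>P\<^esub> (f p \<odot>\<^bsub>P\<^esub> b p))"
      using T bc fc r by (intro P.M.finsum_cong') (auto simp: free_module_simps P.smult_assoc1 subset_eq)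
    also have "\<dots> = r \<odot>\<^bsub>P\<^esub> free_lift P b f"
      unfolding free_lift_def using T bc fc r by (intro P.finsum_smult_ldistr[symmetric]) (auto simp: subset_eq)
    finally show "free_lift P b (r \<odot>\<^bsub>free_module R S\<^esub> f) = r \<odot>\<^bsub>P\<^esub> free_lift P b f" .
  qed
qed

lemma free_lift_gen:
  assumes P: "module R P" and b: "b p \<in> carrier P"
  shows "free_lift P b (free_gen R p) = b p"
proof -
  interpret P: module R P by fact
  have "{q. free_gen R p q \<noteq> \<zero>} = {p}" by (auto simp: free_gen_def)
  then show ?thesis
    unfolding free_lift_def using b by (simp add: free_gen_def P.M.finsum_insert)
qed

end

section \<open>Tensor products\<close>

definition bilinear ::
  "('r, 'x) ring_scheme \<Rightarrow> ('r, 'm, 'y) module_scheme \<Rightarrow> ('r, 'n, 'z) module_scheme \<Rightarrow>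
   ('r, 'p, 'w) module_scheme \<Rightarrow> ('m \<Rightarrow> 'n \<Rightarrow> 'p) \<Rightarrow> bool" where
  "bilinear R M N P \<gamma> \<longleftrightarrow> (\<forall>m\<in>carrier M. (\<lambda>n. \<gamma> m n) \<in> module_hom R N P) \<and>
     (\<forall>n\<in>carrier N. (\<lambda>m. \<gamma> m n) \<in> module_hom R M P)"

lemma bilinearI:
  assumes "\<And>m n. m \<in> carrier M \<Longrightarrow> n \<in> carrier N \<Longrightarrow> \<gamma> m n \<in> carrier P"
    "\<And>m m' n. m \<in> carrier M \<Longrightarrow> m' \<in> carrier M \<Longrightarrow> n \<in> carrier N \<Longrightarrow> \<gamma> (m \<oplus>\<^bsub>M\<^esub> m') n = \<gamma> m n \<oplus>\<^bsub>P\<^esub> \<gamma> m' n"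
    "\<And>m n n'. m \<in> carrier M \<Longrightarrow> n \<in> carrier N \<Longrightarrow> n' \<in> carrier N \<Longrightarrow> \<gamma> m (n \<oplus>\<^bsub>N\<^esub> n') = \<gamma> m n \<oplus>\<^bsub>P\<^esub> \<gamma> m n'"
    "\<And>r m n. r \<in> carrier R \<Longrightarrow> m \<in> carrier M \<Longrightarrow> n \<in> carrier N \<Longrightarrow> \<gamma> (r \<odot>\<^bsub>M\<^esub> m) n = r \<odot>\<^bsub>P\<^esub> \<gamma> m n"
    "\<And>r m n. r \<in> carrier R \<Longrightarrow> m \<in> carrier M \<Longrightarrow> n \<in> carrier N \<Longrightarrow> \<gamma> m (r \<odot>\<^bsub>N\<^esub> n) = r \<odot>\<^bsub>P\<^esub> \<gamma> m n"
  shows "bilinear R M N P \<gamma>"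
  using assms by (simp add: bilinear_def module_hom_def)

lemma bilinearD:
  assumes "bilinear R M N P \<gamma>"
  shows "\<And>m n. m \<in> carrier M \<Longrightarrow> n \<in> carrier N \<Longrightarrow> \<gamma> m n \<in> carrier P"
    "\<And>m m' n. m \<in> carrier M \<Longrightarrow> m' \<in> carrier M \<Longrightarrow> n \<in> carrier N \<Longrightarrow> \<gamma> (m \<oplus>\<^bsub>M\<^esub> m') n = \<gamma> m n \<oplus>\<^bsub>P\<^esub> \<gamma> m' n"
    "\<And>m n n'. m \<in> carrier M \<Longrightarrow> n \<in> carrier N \<Longrightarrow> n' \<in> carrier N \<Longrightarrow> \<gamma> m (n \<oplus>\<^bsub>N\<^esub> n') = \<gamma> m n \<oplus>\<^bsub>P\<^esub> \<gamma> m n'"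
    "\<And>r m n. r \<in> carrier R \<Longrightarrow> m \<in> carrier M \<Longrightarrow> n \<in> carrier N \<Longrightarrow> \<gamma> (r \<odot>\<^bsub>M\<^esub> m) n = r \<odot>\<^bsub>P\<^esub> \<gamma> m n"
    "\<And>r m n. r \<in> carrier R \<Longrightarrow> m \<in> carrier M \<Longrightarrow> n \<in> carrier N \<Longrightarrow> \<gamma> m (r \<odot>\<^bsub>N\<^esub> n) = r \<odot>\<^bsub>P\<^esub> \<gamma> m n"
  using assms by (simp_all add: bilinear_def module_hom_def Pi_iff)

lemma tensor_simps [simp]:
  "carrier (tensor R M N) = carrier (tensor_space R M N)" "add (tensor R M N) = add (tensor_space R M N)"
  "zero (tensor R M N) = zero (tensor_space R M N)" "smult (tensor R M N) = smult (tensor_space R M N)"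
  by (simp_all add: tensor_def)

locale tensor_pair = domain R + M: module R M + N: module R N
  for R :: "('r, 'x) ring_scheme" (structure) and M :: "('r, 'm, 'y) module_scheme"
    and N :: "('r, 'n, 'z) module_scheme"
begin

abbreviation F where "F \<equiv> tensor_free R M N"
abbreviation e where "e m n \<equiv> free_gen R (m, n)"

sublocale F: module R F by (rule free_module_is_module)

definition rel_gens where "rel_gens =
     {e (m \<oplus>\<^bsub>M\<^esub> m') n \<ominus>\<^bsub>F\<^esub> (e m n \<oplus>\<^bsub>F\<^esub> e m' n) | m m' n.
         m \<in> carrier M \<and> m' \<in> carrier M \<and> n \<in> carrier N} \<union>
      {e m (n \<oplus>\<^bsub>N\<^esub> n') \<ominus>\<^bsub>F\<^esub> (e m n \<oplus>\<^bsub>F\<^esub> e m n') | m n n'.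
         m \<in> carrier M \<and> n \<in> carrier N \<and> n' \<in> carrier N} \<union>
      {e (r \<odot>\<^bsub>M\<^esub> m) n \<ominus>\<^bsub>F\<^esub> r \<odot>\<^bsub>F\<^esub> e m n | r m n.
         r \<in> carrier R \<and> m \<in> carrier M \<and> n \<in> carrier N} \<union>
      {e m (r \<odot>\<^bsub>N\<^esub> n) \<ominus>\<^bsub>F\<^esub> r \<odot>\<^bsub>F\<^esub> e m n | r m n.
         r \<in> carrier R \<and> m \<in> carrier M \<and> n \<in> carrier N}"

lemma tensor_rels_eq: "tensor_rels R M N = module_span R F rel_gens"
  by (simp add: tensor_rels_def rel_gens_def Let_def)

lemma e_closed [simp]: "m \<in> carrier M \<Longrightarrow> n \<in> carrier N \<Longrightarrow> e m n \<in> carrier F"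
  by (rule free_gen_closed) simp

lemma rel_gens_closed: "rel_gens \<subseteq> carrier F"
  unfolding rel_gens_def by auto

sublocale Q: quotient_module R F "tensor_rels R M N"
  by (rule quotient_moduleI[OF F.module_axioms]) (simp add: tensor_rels_eq F.module_span_submodule rel_gens_closed)

lemma tensor_space_module: "module R (tensor_space R M N)"
  unfolding tensor_space_def by (rule Q.quot_is_module)

lemma tensor_module: "module R (tensor R M N)"
  by (rule module_cong[OF tensor_space_module]) simp_all

sublocale T: module R "tensor R M N" by (rule tensor_module)

lemma pure_closed [simp]:
  "m \<in> carrier M \<Longrightarrow> n \<in> carrier N \<Longrightarrow> pure_tensor R M N m n \<in> carrier (tensor_space R M N)"
  unfolding pure_tensor_def tensor_space_def by (rule Q.coset_carrier) simp

lemma pure_bilinear: "bilinear R M N (tensor R M N) (pure_tensor R M N)"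
proof (rule bilinearI)
  have rel: "rel_gens \<subseteq> tensor_rels R M N"
    by (simp add: tensor_rels_eq module_span_superset)
  fix m n assume m: "m \<in> carrier M" and n: "n \<in> carrier N"
  show "pure_tensor R M N m n \<in> carrier (tensor R M N)" using m n by simp
  {
    fix m' assume m': "m' \<in> carrier M"
    have "e (m \<oplus>\<^bsub>M\<^esub> m') n \<ominus>\<^bsub>F\<^esub> (e m n \<oplus>\<^bsub>F\<^esub> e m' n) \<in> tensor_rels R M N"
      by (rule subsetD[OF rel]) (use m m' n in \<open>unfold rel_gens_def, blast\<close>)
    then show "pure_tensor R M N (m \<oplus>\<^bsub>M\<^esub> m') n = pure_tensor R M N m n \<oplus>\<^bsub>tensor R M N\<^esub> pure_tensor R M N m' n"
      using m m' n by (simp add: pure_tensor_def tensor_space_def Q.coset_add Q.coset_eq_iff)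
  }
  {
    fix n' assume n': "n' \<in> carrier N"
    have "e m (n \<oplus>\<^bsub>N\<^esub> n') \<ominus>\<^bsub>F\<^esub> (e m n \<oplus>\<^bsub>F\<^esub> e m n') \<in> tensor_rels R M N"
      by (rule subsetD[OF rel]) (use m n' n in \<open>unfold rel_gens_def, blast\<close>)
    then show "pure_tensor R M N m (n \<oplus>\<^bsub>N\<^esub> n') = pure_tensor R M N m n \<oplus>\<^bsub>tensor R M N\<^esub> pure_tensor R M N m n'"
      using m n' n by (simp add: pure_tensor_def tensor_space_def Q.coset_add Q.coset_eq_iff)
  }
  fix r assume r: "r \<in> carrier R"
  have "e (r \<odot>\<^bsub>M\<^esub> m) n \<ominus>\<^bsub>F\<^esub> r \<odot>\<^bsub>F\<^esub> e m n \<in> tensor_rels R M N"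
    by (rule subsetD[OF rel]) (use m n r in \<open>unfold rel_gens_def, blast\<close>)
  then show "pure_tensor R M N (r \<odot>\<^bsub>M\<^esub> m) n = r \<odot>\<^bsub>tensor R M N\<^esub> pure_tensor R M N m n"
    using m n r by (simp add: pure_tensor_def tensor_space_def Q.coset_smult Q.coset_eq_iff)
  have "e m (r \<odot>\<^bsub>N\<^esub> n) \<ominus>\<^bsub>F\<^esub> r \<odot>\<^bsub>F\<^esub> e m n \<in> tensor_rels R M N"
    by (rule subsetD[OF rel]) (use m n r in \<open>unfold rel_gens_def, blast\<close>)
  then show "pure_tensor R M N m (r \<odot>\<^bsub>N\<^esub> n) = r \<odot>\<^bsub>tensor R M N\<^esub> pure_tensor R M N m n"
    using m n r by (simp add: pure_tensor_def tensor_space_def Q.coset_smult Q.coset_eq_iff)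
qed

lemma lift_vanishes:
  assumes P: "module R P" and \<gamma>: "bilinear R M N P \<gamma>" and f: "f \<in> tensor_rels R M N"
  shows "free_lift P (\<lambda>p. \<gamma> (fst p) (snd p)) f = \<zero>\<^bsub>P\<^esub>"
proof -
  interpret P: module R P by fact
  let ?h = "free_lift P (\<lambda>p. \<gamma> (fst p) (snd p))"
  have hom: "?h \<in> module_hom R F P"
    by (rule free_lift_hom[OF P]) (use bilinearD(1)[OF \<gamma>] in auto)
  interpret h: module_homomorphism R F P ?h
    by (intro module_homomorphismI F.module_axioms P hom)
  have gen: "?h (e m n) = \<gamma> m n" if "m \<in> carrier M" "n \<in> carrier N" for m n
    using free_lift_gen[OF P, of "\<lambda>p. \<gamma> (fst p) (snd p)" "(m, n)"] bilinearD(1)[OF \<gamma>] that by simp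
  have "rel_gens \<subseteq> {x \<in> carrier F. ?h x = \<zero>\<^bsub>P\<^esub>}"
  proof
    fix x assume x: "x \<in> rel_gens"
    then have xF: "x \<in> carrier F" using rel_gens_closed by blast
    have self: "y \<ominus>\<^bsub>P\<^esub> y = \<zero>\<^bsub>P\<^esub>" if "y \<in> carrier P" for y
      using that by (simp add: a_minus_def P.M.r_neg)
    from x have "?h x = \<zero>\<^bsub>P\<^esub>"
      unfolding rel_gens_def
      by (elim UnE CollectE exE conjE)
        (simp_all add: h.minus h.add h.smult gen bilinearD[OF \<gamma>] self)
    then show "x \<in> {x \<in> carrier F. ?h x = \<zero>\<^bsub>P\<^esub>}" using xF by simp
  qed
  then have "tensor_rels R M N \<subseteq> {x \<in> carrier F. ?h x = \<zero>\<^bsub>P\<^esub>}"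
    unfolding tensor_rels_eq by (rule module_span_least[OF h.kernel_submodule])
  then show ?thesis using f by blast
qed

lemma lift_coset:
  assumes P: "module R P" and \<gamma>: "bilinear R M N P \<gamma>" and f: "f \<in> carrier F"
  shows "tensor_lift R P \<gamma> (tensor_rels R M N +>\<^bsub>F\<^esub> f) = free_lift P (\<lambda>p. \<gamma> (fst p) (snd p)) f"
proof -
  interpret P: module R P by fact
  let ?h = "free_lift P (\<lambda>p. \<gamma> (fst p) (snd p))"
  have hom: "?h \<in> module_hom R F P"
    by (rule free_lift_hom[OF P]) (use bilinearD(1)[OF \<gamma>] in auto)
  interpret h: module_homomorphism R F P ?h
    by (intro module_homomorphismI F.module_axioms P hom)
  have "tensor_lift R P \<gamma> (tensor_rels R M N +>\<^bsub>F\<^esub> f) = the_elem (?h ` (tensor_rels R M N +>\<^bsub>F\<^esub> f))"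
    by (simp add: tensor_lift_def free_lift_def)
  also have "\<dots> = ?h f"
  proof (rule Q.coset_the_elem[OF f])
    fix g assume g: "g \<in> carrier F" "g \<ominus>\<^bsub>F\<^esub> f \<in> tensor_rels R M N"
    have "g = (g \<ominus>\<^bsub>F\<^esub> f) \<oplus>\<^bsub>F\<^esub> f"
      using g(1) f by (simp add: a_minus_def F.M.a_assoc F.M.l_neg)
    then have "?h g = ?h (g \<ominus>\<^bsub>F\<^esub> f) \<oplus>\<^bsub>P\<^esub> ?h f"
      using g(1) f h.add[of "g \<ominus>\<^bsub>F\<^esub> f" f] by simp
    then show "?h g = ?h f" using lift_vanishes[OF P \<gamma> g(2)] f by simp
  qed
  finally show ?thesis .
qed

lemma lift_hom:
  assumes P: "module R P" and \<gamma>: "bilinear R M N P \<gamma>"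
  shows "tensor_lift R P \<gamma> \<in> module_hom R (tensor R M N) P"
proof -
  let ?h = "free_lift P (\<lambda>p. \<gamma> (fst p) (snd p))"
  have hom: "?h \<in> module_hom R F P"
    by (rule free_lift_hom[OF P]) (use bilinearD(1)[OF \<gamma>] in auto)
  have c: "\<exists>f\<in>carrier F. t = tensor_rels R M N +>\<^bsub>F\<^esub> f" if "t \<in> carrier (tensor R M N)" for t
    using that Q.coset_cases[of t] by (auto simp: tensor_space_def)
  show ?thesis
    unfolding module_hom_def
  proof (intro CollectI conjI ballI funcsetI)
    fix t assume "t \<in> carrier (tensor R M N)"
    then obtain f where "f \<in> carrier F" "t = tensor_rels R M N +>\<^bsub>F\<^esub> f" using c by blast
    then show "tensor_lift R P \<gamma> t \<in> carrier P" using hom by (auto simp: lift_coset[OF P \<gamma>] module_hom_def)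
  next
    fix t u assume "t \<in> carrier (tensor R M N)" "u \<in> carrier (tensor R M N)"
    then obtain f g where "f \<in> carrier F" "t = tensor_rels R M N +>\<^bsub>F\<^esub> f"
      "g \<in> carrier F" "u = tensor_rels R M N +>\<^bsub>F\<^esub> g" using c by blast
    then show "tensor_lift R P \<gamma> (t \<oplus>\<^bsub>tensor R M N\<^esub> u) = tensor_lift R P \<gamma> t \<oplus>\<^bsub>P\<^esub> tensor_lift R P \<gamma> u"
      using hom by (simp add: tensor_space_def Q.coset_add lift_coset[OF P \<gamma>] module_hom_def)
  next
    fix r t assume "r \<in> carrier R" "t \<in> carrier (tensor R M N)"
    moreover then obtain f where "f \<in> carrier F" "t = tensor_rels R M N +>\<^bsub>F\<^esub> f" using c by blast
    ultimately show "tensor_lift R P \<gamma> (r \<odot>\<^bsub>tensor R M N\<^esub> t) = r \<odot>\<^bsub>P\<^esub> tensor_lift R P \<gamma> t"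
      using hom by (simp add: tensor_space_def Q.coset_smult lift_coset[OF P \<gamma>] module_hom_def)
  qed
qed

lemma lift_pure:
  assumes P: "module R P" and \<gamma>: "bilinear R M N P \<gamma>" and mn: "m \<in> carrier M" "n \<in> carrier N"
  shows "tensor_lift R P \<gamma> (pure_tensor R M N m n) = \<gamma> m n"
  using free_lift_gen[OF P, of "\<lambda>p. \<gamma> (fst p) (snd p)" "(m, n)"] bilinearD(1)[OF \<gamma> mn] mn
  by (simp add: pure_tensor_def lift_coset[OF P \<gamma>])

lemma tensor_generated:
  assumes W: "submodule W R (tensor R M N)"
    and pure: "\<And>m n. m \<in> carrier M \<Longrightarrow> n \<in> carrier N \<Longrightarrow> pure_tensor R M N m n \<in> W"
  shows "carrier (tensor R M N) \<subseteq> W"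
proof
  fix t assume "t \<in> carrier (tensor R M N)"
  then obtain f where f: "f \<in> carrier F" "t = tensor_rels R M N +>\<^bsub>F\<^esub> f"
    using Q.coset_cases[of t] by (auto simp: tensor_space_def)
  let ?W = "{f \<in> carrier F. tensor_rels R M N +>\<^bsub>F\<^esub> f \<in> W}"
  interpret q: module_homomorphism R F "quot_module F (tensor_rels R M N)" "\<lambda>f. tensor_rels R M N +>\<^bsub>F\<^esub> f"
    by (intro module_homomorphismI F.module_axioms Q.quot_is_module Q.coset_hom)
  have Wc: "\<And>x y. x \<in> W \<Longrightarrow> y \<in> W \<Longrightarrow> x \<oplus>\<^bsub>quot_module F (tensor_rels R M N)\<^esub> y \<in> W"
    "\<And>r x. r \<in> carrier R \<Longrightarrow> x \<in> W \<Longrightarrow> r \<odot>\<^bsub>quot_module F (tensor_rels R M N)\<^esub> x \<in> W"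
    "\<zero>\<^bsub>quot_module F (tensor_rels R M N)\<^esub> \<in> W"
    using T.submoduleE(4,5)[OF W] subgroup.one_closed[OF submodule.axioms(1)[OF W]]
    by (auto simp: tensor_space_def)
  have "submodule ?W R F"
    by (rule F.submodule_if_closed) (auto simp: q.add q.smult q.zero Wc)
  then have "f \<in> ?W"
    by (rule free_module_generated[OF _ _ f(1)]) (use pure in \<open>auto simp: pure_tensor_def\<close>)
  then show "t \<in> W" using f by simp
qed

text \<open>With \<open>N = M\<close> and \<open>A' = A\<close> this provides coproducts of elements of a Hopf subalgebra with all components in
  the subalgebra.\<close>

lemma span_pure_lists:
  assumes A: "submodule A R M" and t: "t \<in> module_span R (tensor R M N) {pure_tensor R M N a b | a b. a \<in> A \<and> b \<in> A'}"
    and A': "A' \<subseteq> carrier N"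
  shows "\<exists>xs. set xs \<subseteq> A \<times> A' \<and> t = msum (tensor R M N) (map (\<lambda>(x, y). pure_tensor R M N x y) xs)"
proof -
  have AM: "A \<subseteq> carrier M" using M.submoduleE(1)[OF A] .
  let ?m = "\<lambda>xs. msum (tensor R M N) (map (\<lambda>(x, y). pure_tensor R M N x y) xs)"
  let ?W = "{t. \<exists>xs. set xs \<subseteq> A \<times> A' \<and> t = ?m xs}"
  have c: "set (map (\<lambda>(x, y). pure_tensor R M N x y) xs) \<subseteq> carrier (tensor R M N)" if xs: "set xs \<subseteq> A \<times> A'" for xs
  proof -
    have "x \<in> carrier M \<and> y \<in> carrier N" if "(x, y) \<in> set xs" for x y
      using that xs AM A' by blast
    then show ?thesis by auto
  qed
  have "submodule ?W R (tensor R M N)"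
  proof (rule T.submodule_if_closed)
    show "?W \<subseteq> carrier (tensor R M N)" using T.M.msum_closed[OF c] by auto
    show "\<zero>\<^bsub>tensor R M N\<^esub> \<in> ?W" by (rule CollectI, rule exI[of _ "[]"]) simp
    fix t u assume "t \<in> ?W" "u \<in> ?W"
    then obtain xs ys where "set xs \<subseteq> A \<times> A'" "t = ?m xs" "set ys \<subseteq> A \<times> A'" "u = ?m ys" by blast
    then show "t \<oplus>\<^bsub>tensor R M N\<^esub> u \<in> ?W"
      using T.M.msum_append[OF c c, of xs ys] by (intro CollectI exI[of _ "xs @ ys"]) simp
  next
    fix r t assume r: "r \<in> carrier R" and "t \<in> ?W"
    then obtain xs where xs: "set xs \<subseteq> A \<times> A'" "t = ?m xs" by blast
    have "r \<odot>\<^bsub>tensor R M N\<^esub> t = msum (tensor R M N) (map (\<lambda>p. r \<odot>\<^bsub>tensor R M N\<^esub> (case p of (x, y) \<Rightarrow> pure_tensor R M N x y)) xs)"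
      unfolding xs(2) using c[OF xs(1)] r by (intro T.msum_smult[symmetric]) auto
    also have "map (\<lambda>p. r \<odot>\<^bsub>tensor R M N\<^esub> (case p of (x, y) \<Rightarrow> pure_tensor R M N x y)) xs =
        map (\<lambda>(x, y). pure_tensor R M N x y) (map (\<lambda>(x, y). (r \<odot>\<^bsub>M\<^esub> x, y)) xs)"
    proof -
      have "r \<odot>\<^bsub>tensor R M N\<^esub> pure_tensor R M N x y = pure_tensor R M N (r \<odot>\<^bsub>M\<^esub> x) y"
        if "(x, y) \<in> set xs" for x y
        using bilinearD(4)[OF pure_bilinear r, of x y] that xs(1) AM A' by auto
      then show ?thesis by (auto simp: case_prod_unfold)
    qed
    finally show "r \<odot>\<^bsub>tensor R M N\<^esub> t \<in> ?W"
      using xs(1) M.submoduleE(4)[OF A r]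
      by (intro CollectI exI[of _ "map (\<lambda>(x, y). (r \<odot>\<^bsub>M\<^esub> x, y)) xs"]) auto
  qed
  moreover have "{pure_tensor R M N a b | a b. a \<in> A \<and> b \<in> A'} \<subseteq> ?W"
  proof safe
    fix a b assume ab: "a \<in> A" "b \<in> A'"
    then have "pure_tensor R M N a b \<in> carrier (tensor R M N)" using AM A' by (simp add: subset_iff)
    then show "\<exists>xs. set xs \<subseteq> A \<times> A' \<and> pure_tensor R M N a b = ?m xs"
      using ab T.M.r_zero[of "pure_tensor R M N a b"] by (intro exI[of _ "[(a, b)]"]) simp
  qed
  ultimately show ?thesis using module_span_least[of ?W R "tensor R M N"] t by blast
qed

lemma tensor_lists:
  assumes "t \<in> carrier (tensor R M N)"
  shows "\<exists>xs. set xs \<subseteq> carrier M \<times> carrier N \<and> t = msum (tensor R M N) (map (\<lambda>(x, y). pure_tensor R M N x y) xs)"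
proof (rule span_pure_lists[OF M.carrier_is_submodule _ subset_refl])
  let ?X = "{pure_tensor R M N a b | a b. a \<in> carrier M \<and> b \<in> carrier N}"
  have "submodule (module_span R (tensor R M N) ?X) R (tensor R M N)"
    by (rule T.module_span_submodule) auto
  then have "carrier (tensor R M N) \<subseteq> module_span R (tensor R M N) ?X"
    by (rule tensor_generated) (use module_span_superset[of ?X R "tensor R M N"] in blast)
  then show "t \<in> module_span R (tensor R M N) ?X" using assms by blast
qed

lemma lift_msum:
  assumes P: "module R P" and \<gamma>: "bilinear R M N P \<gamma>" and xs: "set xs \<subseteq> carrier M \<times> carrier N"
  shows "tensor_lift R P \<gamma> (msum (tensor R M N) (map (\<lambda>(x, y). pure_tensor R M N x y) xs)) = msum P (map (\<lambda>(x, y). \<gamma> x y) xs)"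
proof -
  interpret h: module_homomorphism R "tensor R M N" P "tensor_lift R P \<gamma>"
    by (intro module_homomorphismI tensor_module P lift_hom \<gamma>)
  have "tensor_lift R P \<gamma> (msum (tensor R M N) (map (\<lambda>(x, y). pure_tensor R M N x y) xs)) =
      msum P (map (tensor_lift R P \<gamma>) (map (\<lambda>(x, y). pure_tensor R M N x y) xs))"
    using xs by (intro h.msum) auto
  also have "map (tensor_lift R P \<gamma>) (map (\<lambda>(x, y). pure_tensor R M N x y) xs) = map (\<lambda>(x, y). \<gamma> x y) xs"
    using xs by (auto simp: lift_pure[OF P \<gamma>])
  finally show ?thesis .
qed

text \<open>Nested lifts occur in the product of \<open>B \<otimes> B\<close> and in the associativity isomorphism; the inner lift has
  to be linear in the variables of the outer one.\<close>

lemma lift_parameter_hom: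
  assumes P: "module R P" and L: "module R L"
    and \<gamma>: "\<And>z. z \<in> carrier L \<Longrightarrow> bilinear R M N P (\<gamma> z)"
    and par: "\<And>m n. m \<in> carrier M \<Longrightarrow> n \<in> carrier N \<Longrightarrow> (\<lambda>z. \<gamma> z m n) \<in> module_hom R L P"
    and t: "t \<in> carrier (tensor R M N)"
  shows "(\<lambda>z. tensor_lift R P (\<gamma> z) t) \<in> module_hom R L P"
proof -
  interpret P: module R P by fact
  interpret L: module R L by fact
  obtain xs where xs: "set xs \<subseteq> carrier M \<times> carrier N"
    "t = msum (tensor R M N) (map (\<lambda>(x, y). pure_tensor R M N x y) xs)"
    using tensor_lists[OF t] by blast
  have eq: "tensor_lift R P (\<gamma> z) t = msum P (map (\<lambda>p. \<gamma> z (fst p) (snd p)) xs)" if "z \<in> carrier L" for z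
    unfolding xs(2) using lift_msum[OF P \<gamma>[OF that] xs(1)] by (simp add: case_prod_unfold)
  have cl: "(\<lambda>p. \<gamma> z (fst p) (snd p)) \<in> set xs \<rightarrow> carrier P" if "z \<in> carrier L" for z
    using bilinearD(1)[OF \<gamma>[OF that]] xs(1) by auto
  show ?thesis
    unfolding module_hom_def
  proof (intro CollectI conjI ballI funcsetI)
    fix z assume z: "z \<in> carrier L"
    show "tensor_lift R P (\<gamma> z) t \<in> carrier P"
      unfolding eq[OF z] using cl[OF z] by (intro P.M.msum_closed) auto
  next
    fix z w assume z: "z \<in> carrier L" and w: "w \<in> carrier L"
    have "map (\<lambda>p. \<gamma> (z \<oplus>\<^bsub>L\<^esub> w) (fst p) (snd p)) xs = map (\<lambda>p. \<gamma> z (fst p) (snd p) \<oplus>\<^bsub>P\<^esub> \<gamma> w (fst p) (snd p)) xs"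
      using par xs(1) z w by (auto simp: module_hom_def)
    then show "tensor_lift R P (\<gamma> (z \<oplus>\<^bsub>L\<^esub> w)) t = tensor_lift R P (\<gamma> z) t \<oplus>\<^bsub>P\<^esub> tensor_lift R P (\<gamma> w) t"
      using P.M.msum_add[OF cl[OF z] cl[OF w]] z w by (simp add: eq del: map_eq_conv)
  next
    fix r z assume r: "r \<in> carrier R" and z: "z \<in> carrier L"
    have "map (\<lambda>p. \<gamma> (r \<odot>\<^bsub>L\<^esub> z) (fst p) (snd p)) xs = map (\<lambda>p. r \<odot>\<^bsub>P\<^esub> \<gamma> z (fst p) (snd p)) xs"
      using par xs(1) z r by (auto simp: module_hom_def)
    then show "tensor_lift R P (\<gamma> (r \<odot>\<^bsub>L\<^esub> z)) t = r \<odot>\<^bsub>P\<^esub> tensor_lift R P (\<gamma> z) t"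
      using P.msum_smult[OF r cl[OF z]] z r by (simp add: eq del: map_eq_conv)
  qed
qed

end

lemma tensor_pairI: "domain R \<Longrightarrow> module R M \<Longrightarrow> module R N \<Longrightarrow> tensor_pair R M N"
  by (simp add: tensor_pair_def)

section \<open>Flat modules over a domain are torsion-free\<close>

text \<open>Multiplication by \<open>s \<noteq> 0\<close> is injective on \<open>R\<close>, hence on \<open>R \<otimes> M = M\<close>. The module \<open>R\<close> has to be
  copied into the type over which flatness quantifies.\<close>

lemma flat_torsion_free:
  fixes R :: "('r, 'x) ring_scheme" (structure) and M :: "('r, 'm, 'y) module_scheme"
  assumes R: "domain R" and flat: "flat_module R M"
  shows "torsion_free R M"
proof -
  interpret domain R by fact
  interpret M: module R M using flat by (simp add: flat_module_def)
  define j :: "'r \<Rightarrow> (nat \<Rightarrow> 'r) set" where "j r = {\<lambda>_. r}" for r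
  define k :: "(nat \<Rightarrow> 'r) set \<Rightarrow> 'r" where "k X = the_elem X 0" for X
  have kj [simp]: "k (j r) = r" for r by (simp add: j_def k_def)
  define N :: "('r, (nat \<Rightarrow> 'r) set) module" where
    "N = \<lparr>carrier = j ` carrier R, monoid.mult = undefined, one = undefined, zero = j \<zero>,
          add = (\<lambda>X Y. j (k X \<oplus> k Y)), smult = (\<lambda>r X. j (r \<otimes> k X))\<rparr>"
  have N_simps [simp]: "carrier N = j ` carrier R" "zero N = j \<zero>" "add N = (\<lambda>X Y. j (k X \<oplus> k Y))"
    "smult N = (\<lambda>r X. j (r \<otimes> k X))"
    by (simp_all add: N_def)
  have N: "module R N"
  proof (rule moduleI)
    show "abelian_group N"
    proof (rule abelian_groupI)
      fix X assume "X \<in> carrier N"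
      then obtain r where "r \<in> carrier R" "X = j r" by auto
      then show "\<exists>Y\<in>carrier N. Y \<oplus>\<^bsub>N\<^esub> X = \<zero>\<^bsub>N\<^esub>" by (auto simp: l_neg intro!: bexI[of _ "\<ominus> r"])
    qed (auto simp: a_ac)
  qed (auto simp: is_cring l_distr r_distr m_assoc)
  interpret NM: tensor_pair R N M by (intro tensor_pairI R N M.module_axioms)
  show ?thesis
    unfolding torsion_free_def
  proof (intro ballI impI)
    fix s x assume s: "s \<in> carrier R" and x: "x \<in> carrier M" and sx: "s \<odot>\<^bsub>M\<^esub> x = \<zero>\<^bsub>M\<^esub>"
    show "s = \<zero> \<or> x = \<zero>\<^bsub>M\<^esub>"
    proof (cases "s = \<zero>")
      assume s0: "s \<noteq> \<zero>"
      define f where "f X = j (s \<otimes> k X)" for X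
      have f: "f \<in> module_hom R N N"
        using s by (auto simp: module_hom_def f_def r_distr m_lcomm)
      moreover have "inj_on f (carrier N)"
      proof (rule inj_onI)
        fix X Y assume "X \<in> carrier N" "Y \<in> carrier N" and eq: "f X = f Y"
        then obtain r q where rq: "r \<in> carrier R" "X = j r" "q \<in> carrier R" "Y = j q" by auto
        have "k (f X) = k (f Y)" using eq by simp
        then show "X = Y" using rq s s0 m_lcancel[of s r q] by (simp add: f_def)
      qed
      ultimately have inj: "inj_on (tensor_map R N M f (\<lambda>x. x)) (carrier (tensor R N M))"
        using flat N by (simp add: flat_module_def)
      have bil: "bilinear R N M (tensor R N M) (\<lambda>m n. pure_tensor R N M (f m) n)"
        using bilinearD[OF NM.pure_bilinear] f
        by (intro bilinearI) (simp_all add: module_hom_def Pi_iff del: N_simps)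
      have map: "tensor_map R N M f (\<lambda>x. x) (pure_tensor R N M m n) = pure_tensor R N M (f m) n"
        if "m \<in> carrier N" "n \<in> carrier M" for m n
        unfolding tensor_map_def by (rule NM.lift_pure[OF NM.tensor_module bil that])
      have one: "j \<one> \<in> carrier N" by simp
      have fj: "f (j \<one>) = s \<odot>\<^bsub>N\<^esub> j \<one>" by (simp add: f_def)
      have "pure_tensor R N M (f (j \<one>)) x = pure_tensor R N M (j \<one>) (s \<odot>\<^bsub>M\<^esub> x)"
        unfolding fj using bilinearD(4,5)[OF NM.pure_bilinear s one x] by (simp only:)
      also have "\<dots> = pure_tensor R N M (f (j \<one>)) \<zero>\<^bsub>M\<^esub>"
        unfolding fj sx using bilinearD(4)[OF NM.pure_bilinear s one M.M.zero_closed]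
          bilinearD(5)[OF NM.pure_bilinear s one M.M.zero_closed] M.smult_r_null[OF s] by (simp only:)
      finally have "tensor_map R N M f (\<lambda>x. x) (pure_tensor R N M (j \<one>) x) =
          tensor_map R N M f (\<lambda>x. x) (pure_tensor R N M (j \<one>) \<zero>\<^bsub>M\<^esub>)"
        by (simp only: map[OF one x] map[OF one M.M.zero_closed])
      then have eq: "pure_tensor R N M (j \<one>) x = pure_tensor R N M (j \<one>) \<zero>\<^bsub>M\<^esub>"
        by (rule inj_onD[OF inj]) (simp_all only: tensor_simps NM.pure_closed[OF one x] NM.pure_closed[OF one M.M.zero_closed])
      have b2: "bilinear R N M M (\<lambda>X m. k X \<odot>\<^bsub>M\<^esub> m)"
        by (rule bilinearI)
          (auto simp: M.smult_l_distr M.smult_r_distr M.smult_assoc1[symmetric] m_comm)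
      have "x = \<zero>\<^bsub>M\<^esub>"
      proof -
        have "k (j \<one>) \<odot>\<^bsub>M\<^esub> x = k (j \<one>) \<odot>\<^bsub>M\<^esub> \<zero>\<^bsub>M\<^esub>"
          using NM.lift_pure[OF M.module_axioms b2 one x] NM.lift_pure[OF M.module_axioms b2 one M.M.zero_closed]
          unfolding eq by (rule subst)
        then show ?thesis using x by simp
      qed
      then show ?thesis ..
    qed simp
  qed
qed

section \<open>The Sweedler calculus of a Hopf algebra\<close>

text \<open>\<open>K\<close> as an \<open>R\<close>-module, so that \<open>K\<close>-valued bilinear forms factor through the tensor product.\<close>

definition values_module :: "('r, 'x) ring_scheme \<Rightarrow> ('r \<Rightarrow> 'k :: comm_ring) \<Rightarrow> ('r, 'k) module" where
  "values_module R \<iota> = \<lparr>carrier = {k. \<iota> \<one>\<^bsub>R\<^esub> * k = k}, monoid.mult = (*), one = \<iota> \<one>\<^bsub>R\<^esub>,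
     zero = 0, add = (+), smult = (\<lambda>r k. \<iota> r * k)\<rparr>"

lemma values_module_simps [simp]:
  "k \<in> carrier (values_module R \<iota>) \<longleftrightarrow> \<iota> \<one>\<^bsub>R\<^esub> * k = k" "zero (values_module R \<iota>) = 0"
  "add (values_module R \<iota>) = (+)" "smult (values_module R \<iota>) = (\<lambda>r k. \<iota> r * k)"
  by (simp_all add: values_module_def)

lemma (in fraction_embedding) values_module: "module R (values_module R \<iota>)"
proof (rule moduleI)
  show "abelian_group (values_module R \<iota>)"
  proof (rule abelian_groupI)
    fix k assume "k \<in> carrier (values_module R \<iota>)"
    then show "\<exists>l\<in>carrier (values_module R \<iota>). l \<oplus>\<^bsub>values_module R \<iota>\<^esub> k = \<zero>\<^bsub>values_module R \<iota>\<^esub>"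
      by (intro bexI[of _ "- k"]) simp_all
  qed (simp_all add: distrib_left algebra_simps)
qed (simp_all add: is_cring emb_add emb_mult mult.assoc[symmetric] distrib_left distrib_right)

lemma msum_values: "msum (values_module R \<iota>) xs = sum_list xs"
  by (induction xs) simp_all

lemma (in torsion_free_module) lin_iff_hom: "lin \<psi> \<longleftrightarrow> \<psi> \<in> module_hom R B (values_module R \<iota>)"
  using lin_value by (auto simp: lin_def module_hom_def)

locale hopf_with_lists = fraction_embedding R \<iota> + hopf_algebra R B
  for R :: "('r, 'x) ring_scheme" (structure) and B :: "('r, 'b, 'y) hopf_scheme" (structure)
    and \<iota> :: "'r \<Rightarrow> 'k :: comm_ring" +
  fixes cop :: "'b \<Rightarrow> ('b \<times> 'b) list"
  assumes torsion_free: "torsion_free R B"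
    and cop_carrier: "b \<in> carrier B \<Longrightarrow> set (cop b) \<subseteq> carrier B \<times> carrier B"
    and comult_cop: "b \<in> carrier B \<Longrightarrow>
      comult B b = msum (tensor R B B) (map (\<lambda>(x, y). pure_tensor R B B x y) (cop b))"
begin

abbreviation K where "K \<equiv> values_module R \<iota>"
abbreviation T where "T \<equiv> tensor R B B"

lemma domain_R: "domain R" ..

lemma module_B: "module R B" ..

sublocale BB: tensor_pair R B B
  by (intro tensor_pairI domain_R module_B)

sublocale BT: tensor_pair R B T
  by (intro tensor_pairI domain_R module_B BB.tensor_module)

sublocale TB: tensor_pair R T B
  by (intro tensor_pairI domain_R module_B BB.tensor_module)

sublocale CD: coproduct_data R B \<iota> cop "counit B" "antipode B"
  by (intro coproduct_data.intro torsion_free_module.intro torsion_free_module_axioms.intro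
      fraction_embedding_axioms module_B torsion_free B.ring_axioms)

lemma comult_closed: "b \<in> carrier B \<Longrightarrow> comult B b \<in> carrier T"
  using comult_linear by (auto simp: module_hom_def)

lemma comult_add: "b \<in> carrier B \<Longrightarrow> c \<in> carrier B \<Longrightarrow> comult B (b \<oplus>\<^bsub>B\<^esub> c) = comult B b \<oplus>\<^bsub>T\<^esub> comult B c"
  and comult_smult: "r \<in> carrier R \<Longrightarrow> b \<in> carrier B \<Longrightarrow> comult B (r \<odot>\<^bsub>B\<^esub> b) = r \<odot>\<^bsub>T\<^esub> comult B b"
  using comult_linear by (auto simp: module_hom_def)

lemma lift_comult:
  assumes "module R P" "bilinear R B B P \<gamma>" "b \<in> carrier B"
  shows "tensor_lift R P \<gamma> (comult B b) = msum P (map (\<lambda>(x, y). \<gamma> x y) (cop b))"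
  using BB.lift_msum[OF assms(1,2) cop_carrier[OF assms(3)]] comult_cop[OF assms(3)] by simp

lemma bilinear_values: "CD.bilin \<beta> \<Longrightarrow> bilinear R B B K \<beta>"
  unfolding CD.bilin_def bilinear_def CD.lin_iff_hom by simp

lemma D_lift: "CD.bilin \<beta> \<Longrightarrow> b \<in> carrier B \<Longrightarrow> CD.D \<beta> b = tensor_lift R K \<beta> (comult B b)"
  by (simp add: lift_comult[OF values_module bilinear_values] CD.D_def msum_values)

lemma DB_lift: "bilinear R B B B \<gamma> \<Longrightarrow> b \<in> carrier B \<Longrightarrow> CD.DB \<gamma> b = tensor_lift R B \<gamma> (comult B b)"
  by (simp add: lift_comult[OF module_B] CD.DB_def)

lemma counit_props: "b \<in> carrier B \<Longrightarrow> counit B b \<in> carrier R"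
    "b \<in> carrier B \<Longrightarrow> c \<in> carrier B \<Longrightarrow> counit B (b \<oplus>\<^bsub>B\<^esub> c) = counit B b \<oplus> counit B c"
    "r \<in> carrier R \<Longrightarrow> b \<in> carrier B \<Longrightarrow> counit B (r \<odot>\<^bsub>B\<^esub> b) = r \<otimes> counit B b"
    "b \<in> carrier B \<Longrightarrow> c \<in> carrier B \<Longrightarrow> counit B (b \<otimes>\<^bsub>B\<^esub> c) = counit B b \<otimes> counit B c"
    "counit B \<one>\<^bsub>B\<^esub> = \<one>"
  using counit_linear counit_mult by (auto simp: module_hom_def self_module_def ring_hom_def)

lemma antipode_props: "b \<in> carrier B \<Longrightarrow> antipode B b \<in> carrier B"
    "b \<in> carrier B \<Longrightarrow> c \<in> carrier B \<Longrightarrow> antipode B (b \<oplus>\<^bsub>B\<^esub> c) = antipode B b \<oplus>\<^bsub>B\<^esub> antipode B c"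
    "r \<in> carrier R \<Longrightarrow> b \<in> carrier B \<Longrightarrow> antipode B (r \<odot>\<^bsub>B\<^esub> b) = r \<odot>\<^bsub>B\<^esub> antipode B b"
  using antipode_linear by (auto simp: module_hom_def)

lemma lin_through_DB:
  assumes "CD.lin \<psi>" "\<And>x y. x \<in> carrier B \<Longrightarrow> y \<in> carrier B \<Longrightarrow> h x y \<in> carrier B" "b \<in> carrier B"
  shows "\<psi> (CD.DB h b) = CD.D (\<lambda>x y. \<psi> (h x y)) b"
proof -
  have "\<psi> (CD.DB h b) = (\<Sum>x\<leftarrow>map (\<lambda>(x, y). h x y) (cop b). \<psi> x)"
    unfolding CD.DB_def using cop_carrier[OF assms(3)] assms(2) by (intro CD.lin_msum assms(1)) auto
  then show ?thesis by (simp add: CD.D_def o_def case_prod_unfold)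
qed

text \<open>The product of \<open>B \<otimes> B\<close> is itself a nested lift, so multiplicativity of \<open>\<Delta>\<close> becomes a double sum.\<close>

lemma lift_comult_mult:
  assumes P: "module R P" and \<gamma>: "bilinear R B B P \<gamma>" and b: "b \<in> carrier B" and c: "c \<in> carrier B"
  shows "tensor_lift R P \<gamma> (comult B (b \<otimes>\<^bsub>B\<^esub> c)) =
    msum P (map (\<lambda>(x, y). msum P (map (\<lambda>(u, v). \<gamma> (x \<otimes>\<^bsub>B\<^esub> u) (y \<otimes>\<^bsub>B\<^esub> v)) (cop c))) (cop b))"
proof -
  let ?TS = "tensor_space R B B"
  have eqm: "msum ?TS xs = msum T xs" for xs by (simp add: msum_def)
  note pb = bilinearD[OF BB.pure_bilinear, unfolded tensor_simps]
  have bil1: "bilinear R B B ?TS (\<lambda>u v. pure_tensor R B B (x \<otimes>\<^bsub>B\<^esub> u) (y \<otimes>\<^bsub>B\<^esub> v))"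
    if "x \<in> carrier B" "y \<in> carrier B" for x y
    using that by (intro bilinearI) (simp_all add: pb B.r_distr smult_mult_right)
  have bil2: "bilinear R B B ?TS (\<lambda>x y. tensor_lift R ?TS (\<lambda>u v. pure_tensor R B B (x \<otimes>\<^bsub>B\<^esub> u) (y \<otimes>\<^bsub>B\<^esub> v)) (comult B c))"
    unfolding bilinear_def
  proof (intro conjI ballI)
    fix x assume x: "x \<in> carrier B"
    show "(\<lambda>y. tensor_lift R ?TS (\<lambda>u v. pure_tensor R B B (x \<otimes>\<^bsub>B\<^esub> u) (y \<otimes>\<^bsub>B\<^esub> v)) (comult B c)) \<in> module_hom R B ?TS"
      by (rule BB.lift_parameter_hom[OF BB.tensor_space_module module_B bil1 _ comult_closed[OF c]])
        (use x in \<open>simp_all add: module_hom_def pb B.l_distr smult_mult_left\<close>)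
    show "(\<lambda>y. tensor_lift R ?TS (\<lambda>u v. pure_tensor R B B (y \<otimes>\<^bsub>B\<^esub> u) (x \<otimes>\<^bsub>B\<^esub> v)) (comult B c)) \<in> module_hom R B ?TS"
      by (rule BB.lift_parameter_hom[OF BB.tensor_space_module module_B bil1 _ comult_closed[OF c]])
        (use x in \<open>simp_all add: module_hom_def pb B.l_distr smult_mult_left\<close>)
  qed
  let ?in = "\<lambda>x y. map (\<lambda>(u, v). pure_tensor R B B (x \<otimes>\<^bsub>B\<^esub> u) (y \<otimes>\<^bsub>B\<^esub> v)) (cop c)"
  have inT: "set (?in x y) \<subseteq> carrier T" if "x \<in> carrier B" "y \<in> carrier B" for x y
    using cop_carrier[OF c] that by auto
  interpret h: module_homomorphism R T P "tensor_lift R P \<gamma>"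
    by (intro module_homomorphismI BB.tensor_module P BB.lift_hom \<gamma>)
  have "comult B (b \<otimes>\<^bsub>B\<^esub> c) = comult B b \<otimes>\<^bsub>T\<^esub> comult B c"
    using comult_mult b c by (simp add: ring_hom_def)
  also have "\<dots> = tensor_lift R ?TS (\<lambda>x y. tensor_lift R ?TS (\<lambda>u v. pure_tensor R B B (x \<otimes>\<^bsub>B\<^esub> u) (y \<otimes>\<^bsub>B\<^esub> v)) (comult B c)) (comult B b)"
    by (simp add: tensor_def)
  also have "\<dots> = msum ?TS (map (\<lambda>(x, y). tensor_lift R ?TS (\<lambda>u v. pure_tensor R B B (x \<otimes>\<^bsub>B\<^esub> u) (y \<otimes>\<^bsub>B\<^esub> v)) (comult B c)) (cop b))"
    by (rule lift_comult[OF BB.tensor_space_module bil2 b])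
  also have "map (\<lambda>(x, y). tensor_lift R ?TS (\<lambda>u v. pure_tensor R B B (x \<otimes>\<^bsub>B\<^esub> u) (y \<otimes>\<^bsub>B\<^esub> v)) (comult B c)) (cop b) =
      map (\<lambda>(x, y). msum T (?in x y)) (cop b)"
    using cop_carrier[OF b] lift_comult[OF BB.tensor_space_module bil1 c] by (auto simp: eqm)
  finally have "tensor_lift R P \<gamma> (comult B (b \<otimes>\<^bsub>B\<^esub> c)) = tensor_lift R P \<gamma> (msum T (map (\<lambda>(x, y). msum T (?in x y)) (cop b)))"
    by (simp add: eqm)
  also have "\<dots> = msum P (map (tensor_lift R P \<gamma>) (map (\<lambda>(x, y). msum T (?in x y)) (cop b)))"
  proof (rule h.msum)
    have "msum T (?in x y) \<in> carrier T" if "(x, y) \<in> set (cop b)" for x y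
      using cop_carrier[OF b] that by (intro BB.T.M.msum_closed inT) auto
    then show "set (map (\<lambda>(x, y). msum T (?in x y)) (cop b)) \<subseteq> carrier T" by auto
  qed
  also have "map (tensor_lift R P \<gamma>) (map (\<lambda>(x, y). msum T (?in x y)) (cop b)) =
      map (\<lambda>(x, y). msum P (map (\<lambda>(u, v). \<gamma> (x \<otimes>\<^bsub>B\<^esub> u) (y \<otimes>\<^bsub>B\<^esub> v)) (cop c))) (cop b)"
  proof -
    have "tensor_lift R P \<gamma> (msum T (?in x y)) = msum P (map (\<lambda>(u, v). \<gamma> (x \<otimes>\<^bsub>B\<^esub> u) (y \<otimes>\<^bsub>B\<^esub> v)) (cop c))"
      if "(x, y) \<in> set (cop b)" for x y
    proof -
      have xy: "x \<in> carrier B" "y \<in> carrier B" using cop_carrier[OF b] that by auto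
      have "tensor_lift R P \<gamma> (msum T (?in x y)) = msum P (map (tensor_lift R P \<gamma>) (?in x y))"
        by (rule h.msum[OF inT[OF xy]])
      also have "map (tensor_lift R P \<gamma>) (?in x y) = map (\<lambda>(u, v). \<gamma> (x \<otimes>\<^bsub>B\<^esub> u) (y \<otimes>\<^bsub>B\<^esub> v)) (cop c)"
        using cop_carrier[OF c] xy by (auto simp: BB.lift_pure[OF P \<gamma>])
      finally show ?thesis .
    qed
    then show ?thesis by auto
  qed
  finally show ?thesis .
qed

lemma values_hom_lift:
  assumes "module R P" "bilinear R B B P \<gamma>" "g \<in> module_hom R P K" "b \<in> carrier B"
  shows "g (tensor_lift R P \<gamma> (comult B b)) = CD.D (\<lambda>x y. g (\<gamma> x y)) b"
proof -
  interpret g: module_homomorphism R P K g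
    by (intro module_homomorphismI assms values_module)
  have "set (map (\<lambda>(x, y). \<gamma> x y) (cop b)) \<subseteq> carrier P"
    using bilinearD(1)[OF assms(2)] cop_carrier[OF assms(4)] by auto
  then have "g (tensor_lift R P \<gamma> (comult B b)) = msum K (map g (map (\<lambda>(x, y). \<gamma> x y) (cop b)))"
    unfolding lift_comult[OF assms(1,2,4)] by (rule g.msum)
  then show ?thesis by (simp add: CD.D_def msum_values o_def case_prod_unfold)
qed

text \<open>A trilinear form induces a functional \<open>G\<close> on \<open>B \<otimes> (B \<otimes> B)\<close>, and \<open>G\<close> is applied to both sides of
  coassociativity.\<close>

lemma coassoc_functional:
  assumes \<gamma>: "CD.trilin \<gamma>" and b: "b \<in> carrier B"
  shows "CD.D (\<lambda>w z. CD.D (\<lambda>x y. \<gamma> x y z) w) b = CD.D (\<lambda>x w. CD.D (\<lambda>y z. \<gamma> x y z) w) b"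
proof -
  let ?BT = "tensor R B T"
  have bx: "bilinear R B B K (\<gamma> x)" if "x \<in> carrier B" for x
    using \<gamma> that by (intro bilinear_values) (simp add: CD.trilin_def CD.bilin_def)
  have bz: "bilinear R B B K (\<lambda>x y. \<gamma> x y z)" if "z \<in> carrier B" for z
    using \<gamma> that by (intro bilinear_values) (simp add: CD.trilin_def CD.bilin_def)
  have hx: "(\<lambda>x. \<gamma> x y z) \<in> module_hom R B K" if "y \<in> carrier B" "z \<in> carrier B" for y z
    using \<gamma> that by (simp add: CD.trilin_def CD.lin_iff_hom)
  have G2: "bilinear R B T K (\<lambda>x t. tensor_lift R K (\<gamma> x) t)"
    unfolding bilinear_def
    using BB.lift_hom[OF values_module bx] BB.lift_parameter_hom[OF values_module module_B bx hx] by auto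
  define G where "G = tensor_lift R K (\<lambda>x t. tensor_lift R K (\<gamma> x) t)"
  have G: "G \<in> module_hom R ?BT K"
    unfolding G_def by (rule BT.lift_hom[OF values_module G2])
  have G_pure: "G (pure_tensor R B T x t) = tensor_lift R K (\<gamma> x) t" if "x \<in> carrier B" "t \<in> carrier T" for x t
    unfolding G_def by (rule BT.lift_pure[OF values_module G2 that])
  note pb = bilinearD[OF BB.pure_bilinear] and pbT = bilinearD[OF BT.pure_bilinear]
  \<comment> \<open>The side \<open>(id \<otimes> \<Delta>) \<Delta>\<close>.\<close>
  have r: "bilinear R B B ?BT (\<lambda>x y. pure_tensor R B T x (comult B y))"
    by (rule bilinearI) (use pbT comult_closed in \<open>simp_all add: comult_add comult_smult\<close>)
  have "G (tensor_map R B T (\<lambda>y. y) (comult B) (comult B b)) =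
      CD.D (\<lambda>x w. G (pure_tensor R B T x (comult B w))) b"
    unfolding tensor_map_def by (rule values_hom_lift[OF BT.tensor_module r G b])
  also have "\<dots> = CD.D (\<lambda>x w. CD.D (\<lambda>y z. \<gamma> x y z) w) b"
  proof -
    have "G (pure_tensor R B T x (comult B w)) = CD.D (\<gamma> x) w" if "(x, w) \<in> set (cop b)" for x w
    proof -
      have xw: "x \<in> carrier B" "w \<in> carrier B" using cop_carrier[OF b] that by auto
      have "CD.bilin (\<gamma> x)" using \<gamma> xw(1) by (simp add: CD.trilin_def CD.bilin_def)
      then show ?thesis using xw by (simp add: G_pure[OF xw(1) comult_closed] D_lift)
    qed
    then show ?thesis unfolding CD.D_def[of _ b] by (intro arg_cong[where f=sum_list] map_cong) auto
  qed
  finally have right: "G (tensor_map R B T (\<lambda>y. y) (comult B) (comult B b)) = CD.D (\<lambda>x w. CD.D (\<lambda>y z. \<gamma> x y z) w) b" .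
  \<comment> \<open>The side \<open>(\<Delta> \<otimes> id) \<Delta>\<close>.\<close>
  have in1: "bilinear R B B ?BT (\<lambda>m n. pure_tensor R B T m (pure_tensor R B B n p))" if "p \<in> carrier B" for p
    by (rule bilinearI) (use pb pbT that in simp_all)
  have in2: "(\<lambda>p. pure_tensor R B T m (pure_tensor R B B n p)) \<in> module_hom R B ?BT"
    if "m \<in> carrier B" "n \<in> carrier B" for m n
    using pb pbT that by (auto simp: module_hom_def)
  let ?in = "\<lambda>t p. tensor_lift R ?BT (\<lambda>m n. pure_tensor R B T m (pure_tensor R B B n p)) t"
  have in3: "bilinear R T B ?BT ?in"
    unfolding bilinear_def
    using BB.lift_hom[OF BT.tensor_module in1] BB.lift_parameter_hom[OF BT.tensor_module module_B in1 in2] by auto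
  have as: "tensor_assoc R B B B \<in> module_hom R (tensor R T B) ?BT"
    unfolding tensor_assoc_def[abs_def] by (rule TB.lift_hom[OF BT.tensor_module in3])
  have l: "bilinear R B B (tensor R T B) (\<lambda>x y. pure_tensor R T B (comult B x) y)"
    by (rule bilinearI)
      (use bilinearD[OF TB.pure_bilinear] comult_closed in \<open>simp_all add: comult_add comult_smult\<close>)
  have "G (tensor_assoc R B B B (tensor_map R T B (comult B) (\<lambda>y. y) (comult B b))) =
      CD.D (\<lambda>w z. G (tensor_assoc R B B B (pure_tensor R T B (comult B w) z))) b"
    unfolding tensor_map_def
    by (rule values_hom_lift[where g="\<lambda>t. G (tensor_assoc R B B B t)", OF TB.tensor_module l module_hom_comp[OF as G] b])
  also have "\<dots> = CD.D (\<lambda>w z. CD.D (\<lambda>x y. \<gamma> x y z) w) b"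
  proof -
    have "G (tensor_assoc R B B B (pure_tensor R T B (comult B w) z)) = CD.D (\<lambda>x y. \<gamma> x y z) w"
      if "(w, z) \<in> set (cop b)" for w z
    proof -
      have wz: "w \<in> carrier B" "z \<in> carrier B" using cop_carrier[OF b] that by auto
      have "tensor_assoc R B B B (pure_tensor R T B (comult B w) z) = ?in (comult B w) z"
        unfolding tensor_assoc_def by (rule TB.lift_pure[OF BT.tensor_module in3 comult_closed[OF wz(1)] wz(2)])
      then have "G (tensor_assoc R B B B (pure_tensor R T B (comult B w) z)) =
          CD.D (\<lambda>m n. G (pure_tensor R B T m (pure_tensor R B B n z))) w"
        using values_hom_lift[OF BT.tensor_module in1[OF wz(2)] G wz(1)] by simp
      also have "\<dots> = CD.D (\<lambda>x y. \<gamma> x y z) w"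
      proof -
        have "G (pure_tensor R B T m (pure_tensor R B B n z)) = \<gamma> m n z" if "(m, n) \<in> set (cop w)" for m n
        proof -
          have mn: "m \<in> carrier B" "n \<in> carrier B" using cop_carrier[OF wz(1)] that by auto
          show ?thesis using mn wz by (simp add: G_pure BB.lift_pure[OF values_module bx])
        qed
        then show ?thesis unfolding CD.D_def by (intro arg_cong[where f=sum_list] map_cong) auto
      qed
      finally show ?thesis .
    qed
    then show ?thesis unfolding CD.D_def[of _ b] by (intro arg_cong[where f=sum_list] map_cong) auto
  qed
  finally show ?thesis using right coassoc[OF b] by simp
qed

lemma smult_left_commute:
  "a \<in> carrier R \<Longrightarrow> b \<in> carrier R \<Longrightarrow> x \<in> carrier B \<Longrightarrow> a \<odot>\<^bsub>B\<^esub> (b \<odot>\<^bsub>B\<^esub> x) = b \<odot>\<^bsub>B\<^esub> (a \<odot>\<^bsub>B\<^esub> x)"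
  by (simp add: smult_assoc1[symmetric] m_comm)

lemma hopf_calculus: "hopf_calculus R B \<iota> cop (counit B) (antipode B)"
proof (intro hopf_calculus.intro CD.coproduct_data_axioms hopf_calculus_axioms.intro)
  fix b x y assume "b \<in> carrier B" "(x, y) \<in> set (cop b)"
  then show "x \<in> carrier B \<and> y \<in> carrier B" using cop_carrier by blast
next
  fix \<beta> assume \<beta>: "CD.bilin \<beta>"
  interpret h: module_homomorphism R T K "tensor_lift R K \<beta>"
    by (intro module_homomorphismI BB.tensor_module values_module BB.lift_hom bilinear_values \<beta>)
  show "CD.lin (CD.D \<beta>)"
    by (rule CD.linI)
      (use h.add h.smult comult_closed in \<open>simp_all add: D_lift[OF \<beta>] comult_add comult_smult\<close>)
next
  fix \<gamma> b assume "CD.trilin \<gamma>" "b \<in> carrier B"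
  then show "CD.D (\<lambda>w z. CD.D (\<lambda>x y. \<gamma> x y z) w) b = CD.D (\<lambda>x w. CD.D (\<lambda>y z. \<gamma> x y z) w) b"
    by (rule coassoc_functional)
next
  fix \<psi> b assume \<psi>: "CD.lin \<psi>" and b: "b \<in> carrier B"
  have "bilinear R B B B (\<lambda>y z. counit B y \<odot>\<^bsub>B\<^esub> z)"
    by (rule bilinearI) (simp_all add: counit_props smult_l_distr smult_r_distr smult_assoc1 smult_left_commute)
  then have "CD.DB (\<lambda>y z. counit B y \<odot>\<^bsub>B\<^esub> z) b = b" using b by (simp add: DB_lift counit_left)
  then have "\<psi> b = \<psi> (CD.DB (\<lambda>y z. counit B y \<odot>\<^bsub>B\<^esub> z) b)" by simp
  also have "\<dots> = CD.D (\<lambda>y z. \<psi> (counit B y \<odot>\<^bsub>B\<^esub> z)) b"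
    by (rule lin_through_DB[OF \<psi> _ b]) (simp add: counit_props)
  also have "\<dots> = CD.D (\<lambda>x y. \<iota> (counit B x) * \<psi> y) b"
    unfolding CD.D_def using cop_carrier[OF b] \<psi>
    by (intro arg_cong[where f=sum_list] map_cong) (auto simp: CD.lin_smult counit_props)
  finally show "CD.D (\<lambda>x y. \<iota> (counit B x) * \<psi> y) b = \<psi> b" by simp
next
  fix \<psi> b assume \<psi>: "CD.lin \<psi>" and b: "b \<in> carrier B"
  have "bilinear R B B B (\<lambda>y z. counit B z \<odot>\<^bsub>B\<^esub> y)"
    by (rule bilinearI) (simp_all add: counit_props smult_l_distr smult_r_distr smult_assoc1 smult_left_commute)
  then have "CD.DB (\<lambda>y z. counit B z \<odot>\<^bsub>B\<^esub> y) b = b" using b by (simp add: DB_lift counit_right)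
  then have "\<psi> b = \<psi> (CD.DB (\<lambda>y z. counit B z \<odot>\<^bsub>B\<^esub> y) b)" by simp
  also have "\<dots> = CD.D (\<lambda>y z. \<psi> (counit B z \<odot>\<^bsub>B\<^esub> y)) b"
    by (rule lin_through_DB[OF \<psi> _ b]) (simp add: counit_props)
  also have "\<dots> = CD.D (\<lambda>x y. \<iota> (counit B y) * \<psi> x) b"
    unfolding CD.D_def using cop_carrier[OF b] \<psi>
    by (intro arg_cong[where f=sum_list] map_cong) (auto simp: CD.lin_smult counit_props)
  finally show "CD.D (\<lambda>x y. \<iota> (counit B y) * \<psi> x) b = \<psi> b" by simp
next
  fix \<beta> b c assume \<beta>: "CD.bilin \<beta>" and b: "b \<in> carrier B" and c: "c \<in> carrier B"
  show "CD.D \<beta> (b \<otimes>\<^bsub>B\<^esub> c) = CD.D (\<lambda>x y. CD.D (\<lambda>u v. \<beta> (x \<otimes>\<^bsub>B\<^esub> u) (y \<otimes>\<^bsub>B\<^esub> v)) c) b"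
    using b c lift_comult_mult[OF values_module bilinear_values[OF \<beta>] b c] D_lift[OF \<beta>, of "b \<otimes>\<^bsub>B\<^esub> c"]
    by (simp add: CD.D_def msum_values)
next
  fix \<beta> assume \<beta>: "CD.bilin \<beta>"
  have "comult B \<one>\<^bsub>B\<^esub> = pure_tensor R B B \<one>\<^bsub>B\<^esub> \<one>\<^bsub>B\<^esub>"
    using comult_mult by (simp add: ring_hom_def tensor_def)
  then show "CD.D \<beta> \<one>\<^bsub>B\<^esub> = \<beta> \<one>\<^bsub>B\<^esub> \<one>\<^bsub>B\<^esub>"
    by (simp add: D_lift[OF \<beta>] BB.lift_pure[OF values_module bilinear_values[OF \<beta>]])
next
  show "CD.lin (\<lambda>x. \<iota> (counit B x))"
    by (rule CD.linI) (simp_all add: counit_props emb_add emb_mult)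
next
  show "CD.linear_endo (antipode B)"
    by (simp add: CD.linear_endo_def antipode_props)
next
  fix \<psi> b assume \<psi>: "CD.lin \<psi>" and b: "b \<in> carrier B"
  have "bilinear R B B B (\<lambda>y z. antipode B y \<otimes>\<^bsub>B\<^esub> z)"
    by (rule bilinearI) (simp_all add: antipode_props B.l_distr B.r_distr smult_mult_left smult_mult_right)
  then have "CD.DB (\<lambda>y z. antipode B y \<otimes>\<^bsub>B\<^esub> z) b = counit B b \<odot>\<^bsub>B\<^esub> \<one>\<^bsub>B\<^esub>" using b by (simp add: DB_lift antipode_left)
  then show "CD.D (\<lambda>x y. \<psi> (antipode B x \<otimes>\<^bsub>B\<^esub> y)) b = \<iota> (counit B b) * \<psi> \<one>\<^bsub>B\<^esub>"
    using lin_through_DB[OF \<psi> _ b, of "\<lambda>y z. antipode B y \<otimes>\<^bsub>B\<^esub> z"] b \<psi>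
    by (simp add: antipode_props CD.lin_smult counit_props)
next
  fix \<psi> b assume \<psi>: "CD.lin \<psi>" and b: "b \<in> carrier B"
  have "bilinear R B B B (\<lambda>y z. y \<otimes>\<^bsub>B\<^esub> antipode B z)"
    by (rule bilinearI) (simp_all add: antipode_props B.l_distr B.r_distr smult_mult_left smult_mult_right)
  then have "CD.DB (\<lambda>y z. y \<otimes>\<^bsub>B\<^esub> antipode B z) b = counit B b \<odot>\<^bsub>B\<^esub> \<one>\<^bsub>B\<^esub>" using b by (simp add: DB_lift antipode_right)
  then show "CD.D (\<lambda>x y. \<psi> (x \<otimes>\<^bsub>B\<^esub> antipode B y)) b = \<iota> (counit B b) * \<psi> \<one>\<^bsub>B\<^esub>"
    using lin_through_DB[OF \<psi> _ b, of "\<lambda>y z. y \<otimes>\<^bsub>B\<^esub> antipode B z"] b \<psi>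
    by (simp add: antipode_props CD.lin_smult counit_props)
qed (simp_all add: counit_props smult_mult_left smult_mult_right)

end

context hopf_with_lists
begin

section \<open>Normal Hopf subalgebras\<close>

sublocale H: hopf_calculus R B \<iota> cop "counit B" "antipode B"
  by (rule hopf_calculus)

lemma lin_to_R_iff: "H.lin_to_R \<phi> \<longleftrightarrow> \<phi> \<in> module_hom R B (self_module R)"
  by (simp add: H.lin_to_R_def module_hom_def self_module_def)

lemma lin_to_RD:
  assumes "H.lin_to_R \<phi>"
  shows "b \<in> carrier B \<Longrightarrow> \<phi> b \<in> carrier R"
    "b \<in> carrier B \<Longrightarrow> c \<in> carrier B \<Longrightarrow> \<phi> (b \<oplus>\<^bsub>B\<^esub> c) = \<phi> b \<oplus> \<phi> c"
    "r \<in> carrier R \<Longrightarrow> b \<in> carrier B \<Longrightarrow> \<phi> (r \<odot>\<^bsub>B\<^esub> b) = r \<otimes> \<phi> b"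
  using assms by (auto simp: H.lin_to_R_def)

lemma bilinear_smult_left: "H.lin_to_R \<phi> \<Longrightarrow> bilinear R B B B (\<lambda>x y. \<phi> y \<odot>\<^bsub>B\<^esub> x)"
  and bilinear_smult_right: "H.lin_to_R \<phi> \<Longrightarrow> bilinear R B B B (\<lambda>x y. \<phi> x \<odot>\<^bsub>B\<^esub> y)"
  by (rule bilinearI, simp_all add: lin_to_RD smult_l_distr smult_r_distr smult_assoc1 smult_left_commute)+

end

locale normal_sub_with_lists = hopf_with_lists R B \<iota> cop
  for R :: "('r, 'x) ring_scheme" (structure) and B :: "('r, 'b, 'y) hopf_scheme" (structure)
    and \<iota> :: "'r \<Rightarrow> 'k :: comm_ring" and cop +
  fixes A :: "'b set"
  assumes normal: "normal_hopf_subalgebra A R B" and sat: "saturated A R B"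
    and fg: "finitely_generated_module R (B\<lparr>carrier := A\<rparr>)"
    and cop_A: "a \<in> A \<Longrightarrow> set (cop a) \<subseteq> A \<times> A"
begin

lemma A_sub: "submodule A R B" "subring A B" "\<And>a. a \<in> A \<Longrightarrow> antipode B a \<in> A"
  using normal by (auto simp: normal_hopf_subalgebra_def hopf_subalgebra_def)

lemma A_sat:
  assumes r: "r \<in> carrier R" "r \<noteq> \<zero>" and x: "x \<in> carrier B" "r \<odot>\<^bsub>B\<^esub> x \<in> A"
  shows "x \<in> A"
proof -
  interpret Q: quotient_module R B A
    by (intro quotient_moduleI module_B A_sub)
  have zero: "\<zero>\<^bsub>quot_module B A\<^esub> = A +>\<^bsub>B\<^esub> \<zero>\<^bsub>B\<^esub>"
    using Q.N.a_subset by (simp add: Q.quot_simps M.a_coset_add_zero)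
  have minus0: "y \<ominus>\<^bsub>B\<^esub> \<zero>\<^bsub>B\<^esub> = y" if "y \<in> carrier B" for y
    using that CD.submodule_minus M.r_zero by (simp add: a_minus_def)
  have "r \<odot>\<^bsub>quot_module B A\<^esub> (A +>\<^bsub>B\<^esub> x) = \<zero>\<^bsub>quot_module B A\<^esub>"
    unfolding zero using r x by (simp add: Q.coset_smult Q.coset_eq_iff minus0)
  then have "A +>\<^bsub>B\<^esub> x = \<zero>\<^bsub>quot_module B A\<^esub>"
    using sat r Q.coset_carrier[OF x(1)] unfolding saturated_def torsion_free_def by blast
  then show ?thesis
    unfolding zero using x by (simp add: Q.coset_eq_iff minus0)
qed

lemma normal_DB:
  assumes a: "a \<in> A" and b: "b \<in> carrier B"
  shows "CD.DB (\<lambda>x y. x \<otimes>\<^bsub>B\<^esub> a \<otimes>\<^bsub>B\<^esub> antipode B y) b \<in> A"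
    and "CD.DB (\<lambda>x y. antipode B x \<otimes>\<^bsub>B\<^esub> a \<otimes>\<^bsub>B\<^esub> y) b \<in> A"
proof -
  have [simp]: "a \<in> carrier B" using a submoduleE(1)[OF A_sub(1)] by auto
  have "bilinear R B B B (\<lambda>x y. x \<otimes>\<^bsub>B\<^esub> a \<otimes>\<^bsub>B\<^esub> antipode B y)"
    "bilinear R B B B (\<lambda>x y. antipode B x \<otimes>\<^bsub>B\<^esub> a \<otimes>\<^bsub>B\<^esub> y)"
    by (rule bilinearI, simp_all add: antipode_props B.l_distr B.r_distr smult_mult_left smult_mult_right)+
  then show "CD.DB (\<lambda>x y. x \<otimes>\<^bsub>B\<^esub> a \<otimes>\<^bsub>B\<^esub> antipode B y) b \<in> A"
    "CD.DB (\<lambda>x y. antipode B x \<otimes>\<^bsub>B\<^esub> a \<otimes>\<^bsub>B\<^esub> y) b \<in> A"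
    using normal a b by (simp_all add: DB_lift normal_hopf_subalgebra_def)
qed

sublocale A: normal_hopf_sub R B \<iota> cop "counit B" "antipode B" A
proof (intro normal_hopf_sub.intro finite_hopf_sub.intro hopf_sub.intro hopf_calculus hopf_sub_axioms.intro
    finite_hopf_sub_axioms.intro normal_hopf_sub_axioms.intro)
  show "submodule A R B" by (rule A_sub)
  show "\<one>\<^bsub>B\<^esub> \<in> A" using A_sub(2) by (rule subringE(3))
  show "a \<otimes>\<^bsub>B\<^esub> a' \<in> A" if "a \<in> A" "a' \<in> A" for a a'
    using A_sub(2) that by (rule subringE(6))
  show "antipode B a \<in> A" if "a \<in> A" for a using that by (rule A_sub)
  show "x \<in> A \<and> y \<in> A" if "a \<in> A" "(x, y) \<in> set (cop a)" for a x y
    using cop_A[OF that(1)] that(2) by blast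
  show "\<exists>X. CD.generated_by X A"
    by (rule CD.finitely_generated_generated_by[OF A_sub(1) fg]) (rule exI)
  show "x \<in> A" if "r \<in> carrier R" "r \<noteq> \<zero>" "x \<in> carrier B" "r \<odot>\<^bsub>B\<^esub> x \<in> A" for r x
    using that by (rule A_sat)
next
  fix a b assume ab: "a \<in> A" "b \<in> carrier B"
  show "CD.DB (\<lambda>x y. x \<otimes>\<^bsub>B\<^esub> a \<otimes>\<^bsub>B\<^esub> antipode B y) b \<in> A"
    by (rule normal_DB(1)[OF ab])
  show "CD.DB (\<lambda>x y. antipode B x \<otimes>\<^bsub>B\<^esub> a \<otimes>\<^bsub>B\<^esub> y) b \<in> A"
    by (rule normal_DB(2)[OF ab])
qed

lemma left_integral_B: "left_integral R B \<phi> \<longleftrightarrow> A.left_integral_on_algebra \<phi>"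
  unfolding left_integral_def A.left_integral_on_algebra_def lin_to_R_iff[symmetric]
  using DB_lift[OF bilinear_smult_left] by auto

lemma right_integral_B: "right_integral R B \<phi> \<longleftrightarrow> A.right_integral_on_algebra \<phi>"
  unfolding right_integral_def A.right_integral_on_algebra_def lin_to_R_iff[symmetric]
  using DB_lift[OF bilinear_smult_right] by auto

section \<open>The quotient Hopf algebra\<close>

lemma aug_eq: "augmentation_ideal A R B = A.aug"
  by (simp add: augmentation_ideal_def A.aug_def)

abbreviation Q where "Q \<equiv> quot_module B A.I"
abbreviation C where "C \<equiv> hopf_quotient_by R B A"
abbreviation \<pi> where "\<pi> \<equiv> \<lambda>x. A.I +>\<^bsub>B\<^esub> x"

sublocale QI: quotient_module R B A.I
  by (intro quotient_moduleI module_B A.I_submodule)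

lemma C_simps:
  "carrier C = carrier Q" "add C = add Q" "zero C = zero Q" "smult C = smult Q" "one C = \<pi> \<one>\<^bsub>B\<^esub>"
  "comult C X = the_elem ((\<lambda>x. tensor_map R Q Q \<pi> \<pi> (comult B x)) ` X)"
  by (simp_all add: hopf_quotient_by_def quot_hopf_def Let_def aug_eq module.defs hopf.defs QI.quot_simps)

lemma module_Q: "module R Q" by (rule QI.quot_is_module)

lemma module_C: "module R C"
  by (rule module_cong[OF module_Q]) (simp_all add: C_simps)

sublocale QQ: tensor_pair R Q Q
  by (intro tensor_pairI domain_R module_Q)

sublocale pi: module_homomorphism R B Q \<pi>
  by (intro module_homomorphismI module_B module_Q QI.coset_hom)

lemma pi_zero_iff: "x \<in> carrier B \<Longrightarrow> \<pi> x = \<zero>\<^bsub>Q\<^esub> \<longleftrightarrow> x \<in> A.I"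
  using QI.coset_eq_iff[of x "\<zero>\<^bsub>B\<^esub>"] pi.zero M.r_zero[of x] by (simp add: a_minus_def)

lemma pi_eqI: "x \<in> carrier B \<Longrightarrow> y \<in> carrier B \<Longrightarrow> x \<ominus>\<^bsub>B\<^esub> y \<in> A.I \<Longrightarrow> \<pi> x = \<pi> y"
  by (simp add: QI.coset_eq_iff)

lemma bilinear_pure_pi: "bilinear R B B (tensor R Q Q) (\<lambda>x y. pure_tensor R Q Q (\<pi> x) (\<pi> y))"
  by (rule bilinearI) (simp_all add: bilinearD[OF QQ.pure_bilinear] pi.add pi.smult del: tensor_simps)

lemma comult_pi_hom: "(\<lambda>x. tensor_map R Q Q \<pi> \<pi> (comult B x)) \<in> module_hom R B (tensor R Q Q)"
  unfolding tensor_map_def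
  by (rule module_hom_comp[OF comult_linear BB.lift_hom[OF QQ.tensor_module bilinear_pure_pi]])

text \<open>Modulo \<open>I\<close> in the first factor, \<open>\<Delta>(b a)\<close> is \<open>\<Sum> b\<^sub>1 \<otimes> b\<^sub>2 a\<close>, and \<open>b\<^sub>2 a \<in> I\<close> for \<open>a \<in> A\<^sup>+\<close>.\<close>

lemma comult_pi_vanishes:
  assumes "i \<in> A.I"
  shows "tensor_map R Q Q \<pi> \<pi> (comult B i) = \<zero>\<^bsub>tensor R Q Q\<^esub>"
  using assms
proof (induction rule: ideal_prod.induct)
  case (prod b a)
  then have b: "b \<in> carrier B" and a: "a \<in> A" "a \<in> carrier B" "a \<in> A.aug" by (auto dest: A.augD)
  let ?p = "pure_tensor R Q Q"
  let ?T = "tensor R Q Q"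
  have inner: "msum ?T (map (\<lambda>(u, v). ?p (\<pi> (x \<otimes>\<^bsub>B\<^esub> u)) (\<pi> (y \<otimes>\<^bsub>B\<^esub> v))) (cop a)) = \<zero>\<^bsub>?T\<^esub>"
    if x: "x \<in> carrier B" and y: "y \<in> carrier B" for x y
  proof -
    define g where "g v = ?p (\<pi> x) (\<pi> (y \<otimes>\<^bsub>B\<^esub> v))" for v
    have g: "g \<in> module_hom R B ?T"
      using x y by (simp add: module_hom_def g_def B.r_distr smult_mult_right pi.add pi.smult
          bilinearD[OF QQ.pure_bilinear] Pi_iff del: tensor_simps)
    interpret g: module_homomorphism R B ?T g by (intro module_homomorphismI module_B QQ.tensor_module g)
    have "?p (\<pi> (x \<otimes>\<^bsub>B\<^esub> u)) (\<pi> (y \<otimes>\<^bsub>B\<^esub> v)) = g (counit B u \<odot>\<^bsub>B\<^esub> v)" if uv: "(u, v) \<in> set (cop a)" for u v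
    proof -
      have u: "u \<in> A" "u \<in> carrier B" and v: "v \<in> carrier B"
        using cop_A[OF a(1)] uv A.A_carrier by auto
      have "x \<otimes>\<^bsub>B\<^esub> (u \<ominus>\<^bsub>B\<^esub> counit B u \<odot>\<^bsub>B\<^esub> \<one>\<^bsub>B\<^esub>) \<in> A.I"
        by (rule A.I_mult[OF x A.aug_diff[OF u(1)]])
      also have "x \<otimes>\<^bsub>B\<^esub> (u \<ominus>\<^bsub>B\<^esub> counit B u \<odot>\<^bsub>B\<^esub> \<one>\<^bsub>B\<^esub>) = x \<otimes>\<^bsub>B\<^esub> u \<ominus>\<^bsub>B\<^esub> counit B u \<odot>\<^bsub>B\<^esub> x"
        using x u by (simp add: a_minus_def B.r_distr B.r_minus smult_mult_right counit_props)
      finally have "\<pi> (x \<otimes>\<^bsub>B\<^esub> u) = \<pi> (counit B u \<odot>\<^bsub>B\<^esub> x)"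
        using x u by (intro pi_eqI) (simp_all add: counit_props)
      then have "?p (\<pi> (x \<otimes>\<^bsub>B\<^esub> u)) (\<pi> (y \<otimes>\<^bsub>B\<^esub> v)) = counit B u \<odot>\<^bsub>?T\<^esub> g v"
        using x y u v by (simp add: g_def pi.smult counit_props bilinearD(4)[OF QQ.pure_bilinear] del: tensor_simps)
      then show ?thesis using u v by (simp add: g.smult counit_props del: tensor_simps)
    qed
    then have "map (\<lambda>(u, v). ?p (\<pi> (x \<otimes>\<^bsub>B\<^esub> u)) (\<pi> (y \<otimes>\<^bsub>B\<^esub> v))) (cop a) = map g (map (\<lambda>(u, v). counit B u \<odot>\<^bsub>B\<^esub> v) (cop a))"
      by auto
    also have "msum ?T \<dots> = g (msum B (map (\<lambda>(u, v). counit B u \<odot>\<^bsub>B\<^esub> v) (cop a)))"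
      using cop_carrier[OF a(2)] by (intro g.msum[symmetric]) (auto simp: counit_props)
    also have "msum B (map (\<lambda>(u, v). counit B u \<odot>\<^bsub>B\<^esub> v) (cop a)) = a"
    proof -
      have "bilinear R B B B (\<lambda>u v. counit B u \<odot>\<^bsub>B\<^esub> v)"
        by (rule bilinearI) (simp_all add: counit_props smult_l_distr smult_r_distr smult_assoc1 smult_left_commute)
      from lift_comult[OF module_B this a(2)] show ?thesis using counit_left[OF a(2)] by simp
    qed
    also have "g a = \<zero>\<^bsub>?T\<^esub>"
    proof -
      have "\<pi> (y \<otimes>\<^bsub>B\<^esub> a) = \<zero> \<odot>\<^bsub>Q\<^esub> \<pi> \<one>\<^bsub>B\<^esub>"
        using A.I_mult[OF y a(3)] pi_zero_iff[of "y \<otimes>\<^bsub>B\<^esub> a"] y a(2) by simp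
      then show ?thesis
        using bilinearD(5)[OF QQ.pure_bilinear, of \<zero> "\<pi> x" "\<pi> \<one>\<^bsub>B\<^esub>"] x
          QQ.T.smult_l_null[of "?p (\<pi> x) (\<pi> \<one>\<^bsub>B\<^esub>)"] QQ.pure_closed[of "\<pi> x" "\<pi> \<one>\<^bsub>B\<^esub>"]
        by (simp add: g_def)
    qed
    finally show ?thesis .
  qed
  have "tensor_map R Q Q \<pi> \<pi> (comult B (b \<otimes>\<^bsub>B\<^esub> a)) = msum ?T (map (\<lambda>(x, y). msum ?T (map (\<lambda>(u, v). ?p (\<pi> (x \<otimes>\<^bsub>B\<^esub> u)) (\<pi> (y \<otimes>\<^bsub>B\<^esub> v))) (cop a))) (cop b))"
    unfolding tensor_map_def by (rule lift_comult_mult[OF QQ.tensor_module bilinear_pure_pi b a(2)])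
  also have "map (\<lambda>(x, y). msum ?T (map (\<lambda>(u, v). ?p (\<pi> (x \<otimes>\<^bsub>B\<^esub> u)) (\<pi> (y \<otimes>\<^bsub>B\<^esub> v))) (cop a))) (cop b) = map (\<lambda>_. \<zero>\<^bsub>?T\<^esub>) (cop b)"
    using inner cop_carrier[OF b] by auto
  also have "msum ?T (map (\<lambda>_. \<zero>\<^bsub>?T\<^esub>) xs) = \<zero>\<^bsub>?T\<^esub>" for xs :: "('b \<times> 'b) list"
    using QQ.T.M.l_zero[OF QQ.T.M.zero_closed] by (induction xs) simp_all
  finally show ?case .
next
  case (sum i j)
  interpret c: module_homomorphism R B "tensor R Q Q" "\<lambda>x. tensor_map R Q Q \<pi> \<pi> (comult B x)"
    by (intro module_homomorphismI module_B QQ.tensor_module comult_pi_hom)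
  show ?case
    using sum A.I_carrier QQ.T.M.l_zero[OF QQ.T.M.zero_closed] by (simp add: c.add del: tensor_simps)
qed

lemma comult_C:
  assumes b: "b \<in> carrier B"
  shows "comult C (\<pi> b) = tensor_map R Q Q \<pi> \<pi> (comult B b)"
  unfolding C_simps
proof (rule QI.coset_the_elem[OF b])
  fix y assume y: "y \<in> carrier B" "y \<ominus>\<^bsub>B\<^esub> b \<in> A.I"
  interpret c: module_homomorphism R B "tensor R Q Q" "\<lambda>x. tensor_map R Q Q \<pi> \<pi> (comult B x)"
    by (intro module_homomorphismI module_B QQ.tensor_module comult_pi_hom)
  have "y = (y \<ominus>\<^bsub>B\<^esub> b) \<oplus>\<^bsub>B\<^esub> b"
    using y(1) b by (simp add: a_minus_def M.a_assoc M.l_neg)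
  then have "tensor_map R Q Q \<pi> \<pi> (comult B y) =
      tensor_map R Q Q \<pi> \<pi> (comult B (y \<ominus>\<^bsub>B\<^esub> b)) \<oplus>\<^bsub>tensor R Q Q\<^esub> tensor_map R Q Q \<pi> \<pi> (comult B b)"
    using c.add[of "y \<ominus>\<^bsub>B\<^esub> b" b] y(1) b by simp
  then show "tensor_map R Q Q \<pi> \<pi> (comult B y) = tensor_map R Q Q \<pi> \<pi> (comult B b)"
    using comult_pi_vanishes[OF y(2)] c.closed[OF b] QQ.T.M.l_zero by simp
qed

lemma lift_C:
  assumes \<gamma>: "bilinear R Q Q C \<gamma>" and b: "b \<in> carrier B"
  shows "tensor_lift R C \<gamma> (comult C (\<pi> b)) = msum C (map (\<lambda>(x, y). \<gamma> (\<pi> x) (\<pi> y)) (cop b))"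
proof -
  have "comult C (\<pi> b) = msum (tensor R Q Q) (map (\<lambda>(x, y). pure_tensor R Q Q x y) (map (\<lambda>(x, y). (\<pi> x, \<pi> y)) (cop b)))"
    unfolding comult_C[OF b] tensor_map_def lift_comult[OF QQ.tensor_module bilinear_pure_pi b]
    by (simp add: o_def case_prod_unfold)
  note eq = this
  have sub: "set (map (\<lambda>(x, y). (\<pi> x, \<pi> y)) (cop b)) \<subseteq> carrier Q \<times> carrier Q"
    using cop_carrier[OF b] pi.closed by auto
  have "tensor_lift R C \<gamma> (comult C (\<pi> b)) = msum C (map (\<lambda>(x, y). \<gamma> x y) (map (\<lambda>(x, y). (\<pi> x, \<pi> y)) (cop b)))"
    unfolding eq by (rule QQ.lift_msum[OF module_C \<gamma> sub])
  then show ?thesis by (simp add: o_def case_prod_unfold)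
qed

lemma functional_C:
  assumes \<phi>: "\<phi> \<in> module_hom R C (self_module R)"
  shows "H.lin_to_R (\<lambda>b. \<phi> (\<pi> b))" "\<And>i. i \<in> A.I \<Longrightarrow> \<phi> (\<pi> i) = \<zero>"
proof -
  have p: "\<pi> \<in> module_hom R B C"
    using QI.coset_hom by (simp add: module_hom_def C_simps)
  show *: "H.lin_to_R (\<lambda>b. \<phi> (\<pi> b))"
    unfolding lin_to_R_iff by (rule module_hom_comp[OF p \<phi>])
  fix i assume i: "i \<in> A.I"
  have "\<pi> i = \<zero>\<^bsub>Q\<^esub>" using pi_zero_iff[OF A.I_carrier[OF i]] i by blast
  also have "\<dots> = \<pi> \<zero>\<^bsub>B\<^esub>" by (rule pi.zero[symmetric])
  finally show "\<phi> (\<pi> i) = \<zero>" using H.lin_to_R_zero[OF *] by (simp only:)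
qed

lemma functional_from_B:
  assumes \<phi>: "H.lin_to_R \<phi>" "\<And>i. i \<in> A.I \<Longrightarrow> \<phi> i = \<zero>"
  obtains \<phi>' where "\<phi>' \<in> module_hom R C (self_module R)" "\<And>b. b \<in> carrier B \<Longrightarrow> \<phi>' (\<pi> b) = \<phi> b"
proof -
  define \<phi>' where "\<phi>' X = the_elem (\<phi> ` X)" for X
  have eq: "\<phi>' (\<pi> b) = \<phi> b" if b: "b \<in> carrier B" for b
    unfolding \<phi>'_def
  proof (rule QI.coset_the_elem[OF b])
    fix y assume y: "y \<in> carrier B" "y \<ominus>\<^bsub>B\<^esub> b \<in> A.I"
    have "\<iota> (\<phi> y) - \<iota> (\<phi> b) = \<iota> (\<phi> (y \<ominus>\<^bsub>B\<^esub> b))"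
      using CD.lin_minus[OF H.lin_to_R_lin[OF \<phi>(1)] y(1) b] by simp
    also have "\<dots> = 0" by (simp add: \<phi>(2)[OF y(2)])
    finally show "\<phi> y = \<phi> b" using lin_to_RD(1)[OF \<phi>(1)] y(1) b by (intro emb_eqD) simp_all
  qed
  have c: "\<exists>b\<in>carrier B. X = \<pi> b" if "X \<in> carrier Q" for X using QI.coset_cases[OF that] by blast
  have "\<phi>' \<in> module_hom R C (self_module R)"
    unfolding module_hom_def
  proof (intro CollectI conjI ballI funcsetI; unfold C_simps)
    fix X assume "X \<in> carrier Q"
    then obtain b where "b \<in> carrier B" "X = \<pi> b" using c by blast
    then show "\<phi>' X \<in> carrier (self_module R)" using lin_to_RD(1)[OF \<phi>(1)] by (simp add: eq self_module_def)
  next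
    fix X Y assume "X \<in> carrier Q" "Y \<in> carrier Q"
    then obtain b c where "b \<in> carrier B" "X = \<pi> b" "c \<in> carrier B" "Y = \<pi> c" using c by blast
    then show "\<phi>' (X \<oplus>\<^bsub>Q\<^esub> Y) = \<phi>' X \<oplus>\<^bsub>self_module R\<^esub> \<phi>' Y"
      using lin_to_RD(2)[OF \<phi>(1)] by (simp add: QI.coset_add eq self_module_def)
  next
    fix r X assume "r \<in> carrier R" "X \<in> carrier Q"
    moreover then obtain b where "b \<in> carrier B" "X = \<pi> b" using c by blast
    ultimately show "\<phi>' (r \<odot>\<^bsub>Q\<^esub> X) = r \<odot>\<^bsub>self_module R\<^esub> \<phi>' X"
      using lin_to_RD(3)[OF \<phi>(1)] by (simp add: QI.coset_smult eq self_module_def)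
  qed
  then show ?thesis using that eq by blast
qed

lemma msum_pi:
  assumes h: "\<And>x y. x \<in> carrier B \<Longrightarrow> y \<in> carrier B \<Longrightarrow> h x y \<in> carrier B" and b: "b \<in> carrier B"
  shows "msum C (map (\<lambda>(x, y). \<pi> (h x y)) (cop b)) = \<pi> (CD.DB h b)"
proof -
  have "msum C xs = msum Q xs" for xs by (simp add: msum_def C_simps)
  moreover have "\<pi> (msum B (map (\<lambda>(x, y). h x y) (cop b))) = msum Q (map \<pi> (map (\<lambda>(x, y). h x y) (cop b)))"
    using cop_carrier[OF b] h by (intro pi.msum) auto
  moreover have "CD.DB h b = msum B (map (\<lambda>(x, y). h x y) (cop b))"
    by (simp add: CD.DB_def)
  ultimately show ?thesis by (simp add: o_def case_prod_unfold)
qed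

lemma functional_C_bilinear:
  assumes \<phi>: "\<phi> \<in> module_hom R C (self_module R)"
  shows "bilinear R Q Q C (\<lambda>x y. \<phi> y \<odot>\<^bsub>C\<^esub> x)" "bilinear R Q Q C (\<lambda>x y. \<phi> x \<odot>\<^bsub>C\<^esub> y)"
proof -
  have f: "\<And>X. X \<in> carrier Q \<Longrightarrow> \<phi> X \<in> carrier R"
    "\<And>X Y. X \<in> carrier Q \<Longrightarrow> Y \<in> carrier Q \<Longrightarrow> \<phi> (X \<oplus>\<^bsub>Q\<^esub> Y) = \<phi> X \<oplus> \<phi> Y"
    "\<And>r X. r \<in> carrier R \<Longrightarrow> X \<in> carrier Q \<Longrightarrow> \<phi> (r \<odot>\<^bsub>Q\<^esub> X) = r \<otimes> \<phi> X"
    using \<phi> by (auto simp: module_hom_def self_module_def C_simps)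
  have comm: "r \<odot>\<^bsub>Q\<^esub> (s \<odot>\<^bsub>Q\<^esub> X) = s \<odot>\<^bsub>Q\<^esub> (r \<odot>\<^bsub>Q\<^esub> X)" if "r \<in> carrier R" "s \<in> carrier R" "X \<in> carrier Q" for r s X
    using that by (simp add: QQ.M.smult_assoc1[symmetric] m_comm)
  show "bilinear R Q Q C (\<lambda>x y. \<phi> y \<odot>\<^bsub>C\<^esub> x)" "bilinear R Q Q C (\<lambda>x y. \<phi> x \<odot>\<^bsub>C\<^esub> y)"
    by (rule bilinearI, simp_all add: C_simps f QQ.M.smult_l_distr QQ.M.smult_r_distr QQ.M.smult_assoc1 comm)+
qed

text \<open>The integral condition on \<open>C\<close> is an equation in \<open>C\<close>, which may be lifted to a congruence modulo \<open>I\<close> in \<open>B\<close>.\<close>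

lemma integral_equation_C:
  assumes \<phi>: "\<phi> \<in> module_hom R C (self_module R)" and b: "b \<in> carrier B"
  shows "tensor_lift R C (\<lambda>x y. \<phi> y \<odot>\<^bsub>C\<^esub> x) (comult C (\<pi> b)) = \<phi> (\<pi> b) \<odot>\<^bsub>C\<^esub> \<one>\<^bsub>C\<^esub> \<longleftrightarrow>
      CD.DB (\<lambda>x y. \<phi> (\<pi> y) \<odot>\<^bsub>B\<^esub> x) b \<ominus>\<^bsub>B\<^esub> \<phi> (\<pi> b) \<odot>\<^bsub>B\<^esub> \<one>\<^bsub>B\<^esub> \<in> A.I"
    and "tensor_lift R C (\<lambda>x y. \<phi> x \<odot>\<^bsub>C\<^esub> y) (comult C (\<pi> b)) = \<phi> (\<pi> b) \<odot>\<^bsub>C\<^esub> \<one>\<^bsub>C\<^esub> \<longleftrightarrow>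
      CD.DB (\<lambda>x y. \<phi> (\<pi> x) \<odot>\<^bsub>B\<^esub> y) b \<ominus>\<^bsub>B\<^esub> \<phi> (\<pi> b) \<odot>\<^bsub>B\<^esub> \<one>\<^bsub>B\<^esub> \<in> A.I"
proof -
  have c: "\<phi> (\<pi> x) \<in> carrier R" if "x \<in> carrier B" for x
    using lin_to_RD(1)[OF functional_C(1)[OF \<phi>] that] .
  have one: "\<phi> (\<pi> b) \<odot>\<^bsub>C\<^esub> \<one>\<^bsub>C\<^esub> = \<pi> (\<phi> (\<pi> b) \<odot>\<^bsub>B\<^esub> \<one>\<^bsub>B\<^esub>)"
    using c[OF b] by (simp add: C_simps pi.smult)
  have "map (\<lambda>(x, y). \<phi> (\<pi> y) \<odot>\<^bsub>C\<^esub> \<pi> x) (cop b) = map (\<lambda>(x, y). \<pi> (\<phi> (\<pi> y) \<odot>\<^bsub>B\<^esub> x)) (cop b)"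
    using cop_carrier[OF b] c by (auto simp: C_simps pi.smult)
  then have "tensor_lift R C (\<lambda>x y. \<phi> y \<odot>\<^bsub>C\<^esub> x) (comult C (\<pi> b)) = \<pi> (CD.DB (\<lambda>x y. \<phi> (\<pi> y) \<odot>\<^bsub>B\<^esub> x) b)"
    unfolding lift_C[OF functional_C_bilinear(1)[OF \<phi>] b]
    using msum_pi[of "\<lambda>x y. \<phi> (\<pi> y) \<odot>\<^bsub>B\<^esub> x" b] c b by (simp del: map_eq_conv)
  then show "tensor_lift R C (\<lambda>x y. \<phi> y \<odot>\<^bsub>C\<^esub> x) (comult C (\<pi> b)) = \<phi> (\<pi> b) \<odot>\<^bsub>C\<^esub> \<one>\<^bsub>C\<^esub> \<longleftrightarrow>
      CD.DB (\<lambda>x y. \<phi> (\<pi> y) \<odot>\<^bsub>B\<^esub> x) b \<ominus>\<^bsub>B\<^esub> \<phi> (\<pi> b) \<odot>\<^bsub>B\<^esub> \<one>\<^bsub>B\<^esub> \<in> A.I"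
    unfolding one using b c by (simp add: QI.coset_eq_iff H.DB_closed)
  have "map (\<lambda>(x, y). \<phi> (\<pi> x) \<odot>\<^bsub>C\<^esub> \<pi> y) (cop b) = map (\<lambda>(x, y). \<pi> (\<phi> (\<pi> x) \<odot>\<^bsub>B\<^esub> y)) (cop b)"
    using cop_carrier[OF b] c by (auto simp: C_simps pi.smult)
  then have "tensor_lift R C (\<lambda>x y. \<phi> x \<odot>\<^bsub>C\<^esub> y) (comult C (\<pi> b)) = \<pi> (CD.DB (\<lambda>x y. \<phi> (\<pi> x) \<odot>\<^bsub>B\<^esub> y) b)"
    unfolding lift_C[OF functional_C_bilinear(2)[OF \<phi>] b]
    using msum_pi[of "\<lambda>x y. \<phi> (\<pi> x) \<odot>\<^bsub>B\<^esub> y" b] c b by (simp del: map_eq_conv)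
  then show "tensor_lift R C (\<lambda>x y. \<phi> x \<odot>\<^bsub>C\<^esub> y) (comult C (\<pi> b)) = \<phi> (\<pi> b) \<odot>\<^bsub>C\<^esub> \<one>\<^bsub>C\<^esub> \<longleftrightarrow>
      CD.DB (\<lambda>x y. \<phi> (\<pi> x) \<odot>\<^bsub>B\<^esub> y) b \<ominus>\<^bsub>B\<^esub> \<phi> (\<pi> b) \<odot>\<^bsub>B\<^esub> \<one>\<^bsub>B\<^esub> \<in> A.I"
    unfolding one using b c by (simp add: QI.coset_eq_iff H.DB_closed)
qed

lemma ball_C: "(\<forall>X\<in>carrier C. P X) \<longleftrightarrow> (\<forall>b\<in>carrier B. P (\<pi> b))"
  using QI.coset_cases QI.coset_carrier unfolding C_simps by metis

lemma bex_C: "(\<exists>X\<in>carrier C. P X) \<longleftrightarrow> (\<exists>b\<in>carrier B. P (\<pi> b))"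
  using ball_C[of "\<lambda>X. \<not> P X"] by blast

lemma DB_cong: "b \<in> carrier B \<Longrightarrow> (\<And>x y. x \<in> carrier B \<Longrightarrow> y \<in> carrier B \<Longrightarrow> h x y = k x y) \<Longrightarrow> CD.DB h b = CD.DB k b"
  unfolding CD.DB_def using cop_carrier by (intro arg_cong[where f="msum B"] map_cong) auto

lemma left_integral_C:
  "has_nonzero_left_integral R C \<longleftrightarrow>
    (\<exists>\<phi>. A.left_integral_on_quotient \<phi> \<and> (\<exists>b\<in>carrier B. \<phi> b \<noteq> \<zero>))"
proof
  assume "has_nonzero_left_integral R C"
  then obtain \<phi> where \<phi>: "\<phi> \<in> module_hom R C (self_module R)"
    and int: "\<forall>b\<in>carrier B. tensor_lift R C (\<lambda>x y. \<phi> y \<odot>\<^bsub>C\<^esub> x) (comult C (\<pi> b)) = \<phi> (\<pi> b) \<odot>\<^bsub>C\<^esub> \<one>\<^bsub>C\<^esub>"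
    and nz: "\<exists>b\<in>carrier B. \<phi> (\<pi> b) \<noteq> \<zero>"
    unfolding has_nonzero_left_integral_def left_integral_def ball_C bex_C by blast
  have "A.left_integral_on_quotient (\<lambda>b. \<phi> (\<pi> b))"
    unfolding A.left_integral_on_quotient_def
    using functional_C[OF \<phi>] int integral_equation_C(1)[OF \<phi>] by simp
  then show "\<exists>\<phi>. A.left_integral_on_quotient \<phi> \<and> (\<exists>b\<in>carrier B. \<phi> b \<noteq> \<zero>)"
    using nz by (intro exI[of _ "\<lambda>b. \<phi> (\<pi> b)"] conjI)
next
  assume "\<exists>\<phi>. A.left_integral_on_quotient \<phi> \<and> (\<exists>b\<in>carrier B. \<phi> b \<noteq> \<zero>)"
  then obtain \<phi> where \<phi>: "H.lin_to_R \<phi>" "\<And>i. i \<in> A.I \<Longrightarrow> \<phi> i = \<zero>" and nz: "\<exists>b\<in>carrier B. \<phi> b \<noteq> \<zero>"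
    and int: "\<And>b. b \<in> carrier B \<Longrightarrow> CD.DB (\<lambda>x y. \<phi> y \<odot>\<^bsub>B\<^esub> x) b \<ominus>\<^bsub>B\<^esub> \<phi> b \<odot>\<^bsub>B\<^esub> \<one>\<^bsub>B\<^esub> \<in> A.I"
    unfolding A.left_integral_on_quotient_def by blast
  obtain \<phi>' where \<phi>': "\<phi>' \<in> module_hom R C (self_module R)" "\<And>b. b \<in> carrier B \<Longrightarrow> \<phi>' (\<pi> b) = \<phi> b"
    using functional_from_B[OF \<phi>] by blast
  have "tensor_lift R C (\<lambda>x y. \<phi>' y \<odot>\<^bsub>C\<^esub> x) (comult C (\<pi> b)) = \<phi>' (\<pi> b) \<odot>\<^bsub>C\<^esub> \<one>\<^bsub>C\<^esub>" if b: "b \<in> carrier B" for b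
    unfolding integral_equation_C(1)[OF \<phi>'(1) b]
    using int[OF b] DB_cong[OF b, of "\<lambda>x y. \<phi>' (\<pi> y) \<odot>\<^bsub>B\<^esub> x" "\<lambda>x y. \<phi> y \<odot>\<^bsub>B\<^esub> x"] by (simp add: \<phi>'(2) b)
  moreover have "\<exists>b\<in>carrier B. \<phi>' (\<pi> b) \<noteq> \<zero>" using nz \<phi>'(2) by auto
  ultimately show "has_nonzero_left_integral R C"
    unfolding has_nonzero_left_integral_def left_integral_def ball_C bex_C using \<phi>'(1)
    by (intro exI[of _ \<phi>'] conjI ballI)
qed

lemma right_integral_C:
  "has_nonzero_right_integral R C \<longleftrightarrow>
    (\<exists>\<phi>. A.right_integral_on_quotient \<phi> \<and> (\<exists>b\<in>carrier B. \<phi> b \<noteq> \<zero>))"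
proof
  assume "has_nonzero_right_integral R C"
  then obtain \<phi> where \<phi>: "\<phi> \<in> module_hom R C (self_module R)"
    and int: "\<forall>b\<in>carrier B. tensor_lift R C (\<lambda>x y. \<phi> x \<odot>\<^bsub>C\<^esub> y) (comult C (\<pi> b)) = \<phi> (\<pi> b) \<odot>\<^bsub>C\<^esub> \<one>\<^bsub>C\<^esub>"
    and nz: "\<exists>b\<in>carrier B. \<phi> (\<pi> b) \<noteq> \<zero>"
    unfolding has_nonzero_right_integral_def right_integral_def ball_C bex_C by blast
  have "A.right_integral_on_quotient (\<lambda>b. \<phi> (\<pi> b))"
    unfolding A.right_integral_on_quotient_def
    using functional_C[OF \<phi>] int integral_equation_C(2)[OF \<phi>] by simp
  then show "\<exists>\<phi>. A.right_integral_on_quotient \<phi> \<and> (\<exists>b\<in>carrier B. \<phi> b \<noteq> \<zero>)"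
    using nz by (intro exI[of _ "\<lambda>b. \<phi> (\<pi> b)"] conjI)
next
  assume "\<exists>\<phi>. A.right_integral_on_quotient \<phi> \<and> (\<exists>b\<in>carrier B. \<phi> b \<noteq> \<zero>)"
  then obtain \<phi> where \<phi>: "H.lin_to_R \<phi>" "\<And>i. i \<in> A.I \<Longrightarrow> \<phi> i = \<zero>" and nz: "\<exists>b\<in>carrier B. \<phi> b \<noteq> \<zero>"
    and int: "\<And>b. b \<in> carrier B \<Longrightarrow> CD.DB (\<lambda>x y. \<phi> x \<odot>\<^bsub>B\<^esub> y) b \<ominus>\<^bsub>B\<^esub> \<phi> b \<odot>\<^bsub>B\<^esub> \<one>\<^bsub>B\<^esub> \<in> A.I"
    unfolding A.right_integral_on_quotient_def by blast
  obtain \<phi>' where \<phi>': "\<phi>' \<in> module_hom R C (self_module R)" "\<And>b. b \<in> carrier B \<Longrightarrow> \<phi>' (\<pi> b) = \<phi> b"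
    using functional_from_B[OF \<phi>] by blast
  have "tensor_lift R C (\<lambda>x y. \<phi>' x \<odot>\<^bsub>C\<^esub> y) (comult C (\<pi> b)) = \<phi>' (\<pi> b) \<odot>\<^bsub>C\<^esub> \<one>\<^bsub>C\<^esub>" if b: "b \<in> carrier B" for b
    unfolding integral_equation_C(2)[OF \<phi>'(1) b]
    using int[OF b] DB_cong[OF b, of "\<lambda>x y. \<phi>' (\<pi> x) \<odot>\<^bsub>B\<^esub> y" "\<lambda>x y. \<phi> x \<odot>\<^bsub>B\<^esub> y"] by (simp add: \<phi>'(2) b)
  moreover have "\<exists>b\<in>carrier B. \<phi>' (\<pi> b) \<noteq> \<zero>" using nz \<phi>'(2) by auto
  ultimately show "has_nonzero_right_integral R C"
    unfolding has_nonzero_right_integral_def right_integral_def ball_C bex_C using \<phi>'(1)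
    by (intro exI[of _ \<phi>'] conjI ballI)
qed

lemma integrals_iff:
  "(has_nonzero_left_integral R B \<longleftrightarrow> has_nonzero_left_integral R C) \<and>
   (has_nonzero_right_integral R B \<longleftrightarrow> has_nonzero_right_integral R C)"
proof -
  have "has_nonzero_left_integral R B \<longleftrightarrow> (\<exists>\<phi>. A.left_integral_on_algebra \<phi> \<and> (\<exists>b\<in>carrier B. \<phi> b \<noteq> \<zero>))"
    "has_nonzero_right_integral R B \<longleftrightarrow> (\<exists>\<phi>. A.right_integral_on_algebra \<phi> \<and> (\<exists>b\<in>carrier B. \<phi> b \<noteq> \<zero>))"
    unfolding has_nonzero_left_integral_def has_nonzero_right_integral_def left_integral_B right_integral_B
    by (rule refl)+
  then show ?thesis
    by (simp only: left_integral_C right_integral_C A.left_integral_iff A.right_integral_iff)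
qed

end

section \<open>The equivalence\<close>

theorem theorem4p4:
  fixes R :: "('r, 'x) ring_scheme"
    and B :: "('r, 'b, 'y) hopf_scheme"
    and A :: "'b set"
  assumes "dedekind_ring R"
    and "hopf_algebra R B"
    and "flat_module R B"
    and "normal_hopf_subalgebra A R B"
    and "saturated A R B"
    and "finitely_generated_module R (B\<lparr>carrier := A\<rparr>)"
  shows "(has_nonzero_left_integral R B \<longleftrightarrow>
            has_nonzero_left_integral R (hopf_quotient_by R B A)) \<and>
         (has_nonzero_right_integral R B \<longleftrightarrow>
            has_nonzero_right_integral R (hopf_quotient_by R B A))"
proof -
  interpret dedekind_ring R by fact
  interpret B: hopf_algebra R B by fact
  have R: "domain R" by (rule domain_axioms)
  have mB: "module R B" by (rule B.module_axioms)
  interpret BB: tensor_pair R B B by (rule tensor_pairI[OF R mB mB])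
  have sub: "submodule A R B"
    and comA: "\<And>a. a \<in> A \<Longrightarrow> comult B a \<in>
      module_span R (tensor R B B) {pure_tensor R B B a' a'' | a' a''. a' \<in> A \<and> a'' \<in> A}"
    using assms(4) by (auto simp: normal_hopf_subalgebra_def hopf_subalgebra_def)
  have AB: "A \<subseteq> carrier B" using B.submoduleE(1)[OF sub] .
  have "\<exists>xs. set xs \<subseteq> carrier B \<times> carrier B \<and> (b \<in> A \<longrightarrow> set xs \<subseteq> A \<times> A) \<and>
      comult B b = msum (tensor R B B) (map (\<lambda>(x, y). pure_tensor R B B x y) xs)" if b: "b \<in> carrier B" for b
  proof (cases "b \<in> A")
    case True
    from BB.span_pure_lists[OF sub comA[OF True] AB] show ?thesis using AB by blast
  next
    case False
    have "comult B b \<in> carrier (tensor R B B)"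
      using B.comult_linear b by (auto simp: module_hom_def)
    from BB.tensor_lists[OF this] show ?thesis using False by blast
  qed
  then obtain cop where cop: "\<And>b. b \<in> carrier B \<Longrightarrow> set (cop b) \<subseteq> carrier B \<times> carrier B"
    "\<And>b. b \<in> carrier B \<Longrightarrow> b \<in> A \<Longrightarrow> set (cop b) \<subseteq> A \<times> A"
    "\<And>b. b \<in> carrier B \<Longrightarrow> comult B b = msum (tensor R B B) (map (\<lambda>(x, y). pure_tensor R B B x y) (cop b))"
    by metis
  interpret normal_sub_with_lists R B "\<lambda>r. ufrac_of R r \<one>\<^bsub>R\<^esub>" cop A
  proof (intro normal_sub_with_lists.intro hopf_with_lists.intro hopf_with_lists_axioms.intro
      normal_sub_with_lists_axioms.intro fraction_embedding_ufrac R assms flat_torsion_free)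
    show "set (cop a) \<subseteq> A \<times> A" if "a \<in> A" for a
      using cop(2)[of a] that AB by blast
  qed (fact cop)+
  show ?thesis by (rule integrals_iff)
qed

end
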